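(* Let $\mathcal M$ be an invariant subspace of the tensor product $F^2(H_{n_1})\otimes\cdots\otimes F^2(H_{n_k})\otimes\mathcal E$, where $\mathcal E$ is a finite dimensional Hilbert space. Then the multiplicity $m(\mathcal M)$ exists (i.e. the limit defining it exists) and satisfies $$m(\mathcal M)=\lim_{(q_1,\ldots,q_k)\in\mathbb Z_+^k}\frac{\mathrm{trace}\left[P_{\mathcal M}(P^{(1)}_{q_1}\otimes\cdots\otimes P^{(k)}_{q_k}\otimes I_{\mathcal E})\right]}{\mathrm{trace}\left[P^{(1)}_{q_1}\otimes\cdots\otimes P^{(k)}_{q_k}\right]}=\lim_{q_1\to\infty}\cdots\lim_{q_k\to\infty}\frac{\mathrm{trace}\left[P_{\mathcal M}(P_{\le(q_1,\ldots,q_k)}\otimes I_{\mathcal E})\right]}{\mathrm{trace}\left[P_{\le(q_1,\ldots,q_k)}\right]}$$ $$=\lim_{m\to\infty}\frac1{\binom{m+k-1}{k-1}}\sum_{\substack{q_1\ge0,\ldots,q_k\ge0\\ q_1+\cdots+q_k=m}}\frac{\mathrm{trace}\left[P_{\mathcal M}(P^{(1)}_{q_1}\otimes\cdots\otimes P^{(k)}_{q_k}\otimes I_{\mathcal E})\right]}{\mathrm{trace}\left[P^{(1)}_{q_1}\otimes\cdots\otimes P^{(k)}_{q_k}\right]}=\dim\mathcal E-\mathrm{curv}(\mathbf M),$$ where $\mathbf M:=(M_1,\ldots,M_k)$ with $M_i:=(M_{i,1},\ldots,M_{i,n_i})$ and $M_{i,j}:=P_{\mathcal M^\perp}(\mathbf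 S_{i,j}\otimes I_{\mathcal E})|_{\mathcal M^\perp}$.
   Context: All Hilbert spaces are complex; $\mathbb N=\{1,2,\ldots\}$, $\mathbb Z_+=\{0,1,\ldots\}$. Fix $k\in\mathbb N$ and $\mathbf n=(n_1,\ldots,n_k)\in\mathbb N^k$. $F^2(H_{n_i})=\mathbb C1\oplus\bigoplus_{p\ge1}H_{n_i}^{\otimes p}$ is the full Fock space of an $n_i$-dimensional Hilbert space $H_{n_i}$ with orthonormal basis $e^i_1,\ldots,e^i_{n_i}$. $\mathbb F_{n_i}^+$ is the free unital semigroup on $n_i$ generators $g_1^i,\ldots,g_{n_i}^i$ with length $|\cdot|$; for $\alpha=g^i_{j_1}\cdots g^i_{j_p}$ put $e^i_\alpha=e^i_{j_1}\otimes\cdots\otimes e^i_{j_p}$, and $e^i_\alpha=1$ for the neutral element. Let $S_{i,j}e^i_\alpha=e^i_{g^i_j\alpha}$ be the left creation operators and $\mathbf S_{i,j}=I\otimes\cdots\otimes S_{i,j}\otimes\cdots\otimes I$ ($S_{i,j}$ in position $i$) on $\bigotimes_{i=1}^kF^2(H_{n_i})$. An invariant subspace of $\bigotimes_iF^2(H_{n_i})\otimes\mathcal E$ is a closed subspace invariant under every $\mathbf S_{i,j}\otimes I_{\mathcal E}$. $P_{\mathcal M}$ is the orthogonal projection onto $\mathcal M$. $P^{(i)}_q$ is the orthogonal projection of $F^2(H_{n_i})$ onto the span of all $e^i_\alpha$ with $|\alpha|=q$; $P_{\le(q_1,\ldots,q_k)}$ is the orthogonal projection of $\bigotimes_iF^2(H_{n_i})$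 onto the span of all $e^1_{\alpha_1}\otimes\cdots\otimes e^k_{\alpha_k}$ with $|\alpha_i|\le q_i$ for all $i$. The multiplicity of $\mathcal M$ is defined by $$m(\mathcal M):=\lim_{m\to\infty}\frac1{\binom{m+k}{k}}\sum_{\substack{q_1\ge0,\ldots,q_k\ge0\\ q_1+\cdots+q_k\le m}}\frac{\mathrm{trace}\left[P_{\mathcal M}(P^{(1)}_{q_1}\otimes\cdots\otimes P^{(k)}_{q_k}\otimes I_{\mathcal E})\right]}{\mathrm{trace}\left[P^{(1)}_{q_1}\otimes\cdots\otimes P^{(k)}_{q_k}\right]}.$$ For $X_i=(X_{i,1},\ldots,X_{i,n_i})\in B(\mathcal H)^{n_i}$ let $\Phi_{X_i}(Y)=\sum_{j=1}^{n_i}X_{i,j}YX_{i,j}^*$. The regular polyball $\mathbf B_{\mathbf n}(\mathcal H)$ is the set of all $\mathbf X=(X_1,\ldots,X_k)$ with $X_i\in B(\mathcal H)^{n_i}$ such that every entry of $X_s$ commutes with every entry of $X_t$ whenever $s\ne t$ and $(id-\Phi_{X_1})^{p_1}\circ\cdots\circ(id-\Phi_{X_k})^{p_k}(I)\ge0$ for all $(p_1,\ldots,p_k)\in\{0,1\}^k$. Put $\mathbf\Delta_{\mathbf X}=(id-\Phi_{X_1})\circ\cdots\circ(id-\Phi_{X_k})$. With $\mathcal D_{\mathbf T}=\overline{\mathbf\Delta_{\mathbf T}(I)\mathcal H}$ and $T_{i,\alpha}=T_{i,j_1}\cdots T_{i,j_p}$ for $\alpha=g^i_{j_1}\cdots g^i_{j_p}$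 ($T_{i,\alpha}=I$ for the neutral element), the Berezin kernel of $\mathbf T\in\mathbf B_{\mathbf n}(\mathcal H)$ is $\mathbf K_{\mathbf T}:\mathcal H\to\bigotimes_iF^2(H_{n_i})\otimes\mathcal D_{\mathbf T}$, $$\mathbf K_{\mathbf T}h=\sum_{\beta_i\in\mathbb F_{n_i}^+,\,i=1,\ldots,k}e^1_{\beta_1}\otimes\cdots\otimes e^k_{\beta_k}\otimes\mathbf\Delta_{\mathbf T}(I)^{1/2}T_{1,\beta_1}^*\cdots T_{k,\beta_k}^*h.$$ For $\mathbf T$ with trace class $\mathbf\Delta_{\mathbf T}(I)$, $$\mathrm{curv}(\mathbf T):=\lim_{m\to\infty}\frac1{\binom{m+k}{k}}\sum_{\substack{q_1\ge0,\ldots,q_k\ge0\\ q_1+\cdots+q_k\le m}}\frac{\mathrm{trace}\left[\mathbf K_{\mathbf T}^*(P^{(1)}_{q_1}\otimes\cdots\otimes P^{(k)}_{q_k}\otimes I_{\mathcal D_{\mathbf T}})\mathbf K_{\mathbf T}\right]}{\mathrm{trace}\left[P^{(1)}_{q_1}\otimes\cdots\otimes P^{(k)}_{q_k}\right]}$$ (this limit exists). The tuple $\mathbf M$ belongs to $\mathbf B_{\mathbf n}(\mathcal M^\perp)$ and has finite rank defect. Limits over $\mathbb Z_+^k$ are limits of nets for the coordinatewise order. *)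

theory Defs
  imports "HOL-Analysis.Analysis"
begin

section \<open>Complex Hilbert spaces\<close>

text \<open>The inner product \<open>cinner\<close> is linear in its first argument.\<close>

class complex_inner = real_inner +
  fixes scaleC :: "complex \<Rightarrow> 'a \<Rightarrow> 'a"  (infixr "*\<^sub>C" 75)
    and cinner :: "'a \<Rightarrow> 'a \<Rightarrow> complex"
  assumes scaleC_add_right: "c *\<^sub>C (x + y) = c *\<^sub>C x + c *\<^sub>C y"
    and scaleC_add_left: "(c + d) *\<^sub>C x = c *\<^sub>C x + d *\<^sub>C x"
    and scaleC_scaleC: "c *\<^sub>C d *\<^sub>C x = (c * d) *\<^sub>C x"
    and scaleR_scaleC: "r *\<^sub>R x = complex_of_real r *\<^sub>C x"
    and cinner_add_left: "cinner (x + y) z = cinner x z + cinner y z"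
    and cinner_scaleC_left: "cinner (c *\<^sub>C x) y = c * cinner x y"
    and cinner_commute: "cinner x y = cnj (cinner y x)"
    and inner_eq_Re_cinner: "inner x y = Re (cinner x y)"

class chilbert_space = complex_inner + complete_space

global_interpretation complex_vector: vector_space "scaleC :: complex \<Rightarrow> 'a \<Rightarrow> 'a :: complex_inner"
  defines csubspace = complex_vector.subspace
    and cspan = complex_vector.span
    and cdim = complex_vector.dim
    and cdependent = complex_vector.dependent
    and cextend_basis = complex_vector.extend_basis
    and crepresentation = complex_vector.representation
proof unfold_locales
  fix x :: 'a
  show "1 *\<^sub>C x = x"
    using scaleR_scaleC[of 1 x] by simp
qed (simp_all add: scaleC_add_right scaleC_add_left scaleC_scaleC)

instantiation complex :: chilbert_space
begin

definition scaleC_complex :: "complex \<Rightarrow> complex \<Rightarrow> complex"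
  where "scaleC_complex c x = c * x"

definition cinner_complex :: "complex \<Rightarrow> complex \<Rightarrow> complex"
  where "cinner_complex x y = x * cnj y"

instance
  by standard (auto simp: scaleC_complex_def cinner_complex_def inner_complex_def algebra_simps
      scaleR_conv_of_real)

end

lemma cinner_zero_left [simp]: "cinner 0 (y :: 'a :: complex_inner) = 0"
  using cinner_add_left[of 0 0 y] by simp

lemma cinner_zero_right [simp]: "cinner (x :: 'a :: complex_inner) 0 = 0"
  using cinner_commute[of x 0] by simp

lemma cinner_add_right: "cinner (x :: 'a :: complex_inner) (y + z) = cinner x y + cinner x z"
  by (metis cinner_add_left cinner_commute complex_cnj_add)

lemma cinner_scaleC_right: "cinner (x :: 'a :: complex_inner) (c *\<^sub>C y) = cnj c * cinner x y"
  by (metis cinner_commute cinner_scaleC_left complex_cnj_mult)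

lemma cinner_uminus_left: "cinner (- x :: 'a :: complex_inner) y = - cinner x y"
  using cinner_add_left[of x "- x" y] by (simp add: eq_neg_iff_add_eq_0 add.commute)

lemma cinner_diff_left: "cinner (x - y :: 'a :: complex_inner) z = cinner x z - cinner y z"
  using cinner_add_left[of x "- y" z] by (simp add: cinner_uminus_left)

lemma cinner_self: "cinner (x :: 'a :: complex_inner) x = complex_of_real ((norm x)\<^sup>2)"
proof (rule complex_eqI)
  show "Re (cinner x x) = Re (complex_of_real ((norm x)\<^sup>2))"
    by (simp add: inner_eq_Re_cinner[symmetric] power2_norm_eq_inner)
  have "Im (cinner x x) = - Im (cinner x x)"
    by (subst cinner_commute) simp
  then show "Im (cinner x x) = Im (complex_of_real ((norm x)\<^sup>2))"
    by simp
qed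

lemma norm_scaleC: "norm (c *\<^sub>C (x :: 'a :: complex_inner)) = norm c * norm x"
proof -
  have "cinner (c *\<^sub>C x) (c *\<^sub>C x) = (c * cnj c) * cinner x x"
    by (simp add: cinner_scaleC_left cinner_scaleC_right mult.assoc)
  also have "\<dots> = complex_of_real ((norm c * norm x)\<^sup>2)"
    by (simp only: cinner_self complex_norm_square[symmetric] of_real_mult power_mult_distrib)
  finally have "complex_of_real ((norm (c *\<^sub>C x))\<^sup>2) = complex_of_real ((norm c * norm x)\<^sup>2)"
    by (simp only: cinner_self)
  then have "(norm (c *\<^sub>C x))\<^sup>2 = (norm c * norm x)\<^sup>2"
    by (simp only: of_real_eq_iff)
  then show ?thesis
    by (simp add: power2_eq_iff_nonneg)
qed

lemma norm_cinner_le: "norm (cinner (x :: 'a :: complex_inner) y) \<le> norm x * norm y"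
proof -
  define c where "c = cnj (sgn (cinner x y))"
  have "c * cinner x y = complex_of_real (norm (cinner x y))"
  proof (cases "cinner x y = 0")
    case False
    have "cnj (cinner x y) * cinner x y = complex_of_real ((norm (cinner x y))\<^sup>2)"
      by (simp only: complex_norm_square mult.commute)
    then show ?thesis
      using False by (simp add: c_def sgn_eq power2_eq_square)
  qed (simp add: c_def)
  then have "norm (cinner x y) = Re (cinner (c *\<^sub>C x) y)"
    by (simp add: cinner_scaleC_left)
  also have "\<dots> = inner (c *\<^sub>C x) y"
    by (simp add: inner_eq_Re_cinner)
  also have "\<dots> \<le> norm (c *\<^sub>C x) * norm y"
    by (rule norm_cauchy_schwarz)
  also have "\<dots> \<le> norm x * norm y"
    by (simp add: norm_scaleC c_def norm_sgn mult_right_mono)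
  finally show ?thesis .
qed


section \<open>Square-summable families\<close>

typedef (overloaded) ('i, 'a) ell2 = "{f :: 'i \<Rightarrow> 'a :: complex_inner. (\<lambda>i. (norm (f i))\<^sup>2) summable_on UNIV}"
  morphisms coord Abs_ell2
  by (rule exI[of _ "\<lambda>_. 0"]) simp

setup_lifting type_definition_ell2

lemma coord_summable: "(\<lambda>i. (norm (coord f i))\<^sup>2) summable_on UNIV"
  using coord[of f] by simp

lemma ell2_eqI: "(\<And>i. coord f i = coord g i) \<Longrightarrow> f = g"
  by (metis coord_inject ext)

lemma power2_norm_add_le: "(norm (x + y :: 'a :: real_normed_vector))\<^sup>2 \<le> 2 * (norm x)\<^sup>2 + 2 * (norm y)\<^sup>2"
proof -
  have "(norm (x + y))\<^sup>2 \<le> (norm x + norm y)\<^sup>2"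
    by (intro power_mono norm_triangle_ineq norm_ge_zero)
  also have "\<dots> \<le> 2 * (norm x)\<^sup>2 + 2 * (norm y)\<^sup>2"
    using sum_squares_bound[of "norm x" "norm y"] by (simp add: power2_sum)
  finally show ?thesis .
qed

instantiation ell2 :: (type, complex_inner) complex_inner
begin

lift_definition zero_ell2 :: "('a, 'b) ell2" is "\<lambda>_. 0"
  by simp

lift_definition plus_ell2 :: "('a, 'b) ell2 \<Rightarrow> ('a, 'b) ell2 \<Rightarrow> ('a, 'b) ell2"
  is "\<lambda>f g i. f i + g i"
proof -
  fix f g :: "'a \<Rightarrow> 'b"
  assume "(\<lambda>i. (norm (f i))\<^sup>2) summable_on UNIV" "(\<lambda>i. (norm (g i))\<^sup>2) summable_on UNIV"
  then have "(\<lambda>i. 2 * (norm (f i))\<^sup>2 + 2 * (norm (g i))\<^sup>2) summable_on UNIV"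
    by (intro summable_on_add summable_on_cmult_right)
  then show "(\<lambda>i. (norm (f i + g i))\<^sup>2) summable_on UNIV"
    by (rule summable_on_comparison_test) (auto intro: power2_norm_add_le)
qed

lift_definition uminus_ell2 :: "('a, 'b) ell2 \<Rightarrow> ('a, 'b) ell2" is "\<lambda>f i. - f i"
  by simp

lift_definition minus_ell2 :: "('a, 'b) ell2 \<Rightarrow> ('a, 'b) ell2 \<Rightarrow> ('a, 'b) ell2"
  is "\<lambda>f g i. f i - g i"
proof -
  fix f g :: "'a \<Rightarrow> 'b"
  assume "(\<lambda>i. (norm (f i))\<^sup>2) summable_on UNIV" "(\<lambda>i. (norm (g i))\<^sup>2) summable_on UNIV"
  then have "(\<lambda>i. 2 * (norm (f i))\<^sup>2 + 2 * (norm (g i))\<^sup>2) summable_on UNIV"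
    by (intro summable_on_add summable_on_cmult_right)
  then show "(\<lambda>i. (norm (f i - g i))\<^sup>2) summable_on UNIV"
    by (rule summable_on_comparison_test)
       (use power2_norm_add_le[of "f _" "- g _"] in auto)
qed

lift_definition scaleC_ell2 :: "complex \<Rightarrow> ('a, 'b) ell2 \<Rightarrow> ('a, 'b) ell2" is "\<lambda>c f i. c *\<^sub>C f i"
  by (auto simp: norm_scaleC power_mult_distrib intro: summable_on_cmult_right)

lift_definition scaleR_ell2 :: "real \<Rightarrow> ('a, 'b) ell2 \<Rightarrow> ('a, 'b) ell2" is "\<lambda>r f i. r *\<^sub>R f i"
  by (auto simp: power_mult_distrib intro: summable_on_cmult_right)

definition cinner_ell2 :: "('a, 'b) ell2 \<Rightarrow> ('a, 'b) ell2 \<Rightarrow> complex"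
  where "cinner_ell2 f g = (\<Sum>\<^sub>\<infinity>i. cinner (coord f i) (coord g i))"

definition inner_ell2 :: "('a, 'b) ell2 \<Rightarrow> ('a, 'b) ell2 \<Rightarrow> real"
  where "inner_ell2 f g = Re (cinner f g)"

definition norm_ell2 :: "('a, 'b) ell2 \<Rightarrow> real"
  where "norm_ell2 f = sqrt (inner f f)"

definition sgn_ell2 :: "('a, 'b) ell2 \<Rightarrow> ('a, 'b) ell2"
  where "sgn_ell2 f = inverse (norm f) *\<^sub>R f"

definition dist_ell2 :: "('a, 'b) ell2 \<Rightarrow> ('a, 'b) ell2 \<Rightarrow> real"
  where "dist_ell2 f g = norm (f - g)"

definition uniformity_ell2 :: "(('a, 'b) ell2 \<times> ('a, 'b) ell2) filter"
  where "uniformity_ell2 = (INF e\<in>{0 <..}. principal {(f, g). dist f g < e})"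

definition open_ell2 :: "('a, 'b) ell2 set \<Rightarrow> bool"
  where "open_ell2 U = (\<forall>x\<in>U. \<forall>\<^sub>F (x', y) in uniformity. x' = x \<longrightarrow> y \<in> U)"

lemma cinner_ell2_summable:
  fixes f g :: "('a, 'b) ell2"
  shows "(\<lambda>i. cinner (coord f i) (coord g i)) summable_on UNIV"
proof -
  have "(\<lambda>i. (norm (coord f i))\<^sup>2 + (norm (coord g i))\<^sup>2) summable_on UNIV"
    by (intro summable_on_add coord_summable)
  then have "(\<lambda>i. norm (cinner (coord f i) (coord g i))) summable_on UNIV"
  proof (rule summable_on_comparison_test)
    fix i
    have "norm (cinner (coord f i) (coord g i)) \<le> norm (coord f i) * norm (coord g i)"
      by (rule norm_cinner_le)
    also have "\<dots> \<le> (norm (coord f i))\<^sup>2 + (norm (coord g i))\<^sup>2"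
      using sum_squares_bound[of "norm (coord f i)" "norm (coord g i)"]
        mult_nonneg_nonneg[OF norm_ge_zero[of "coord f i"] norm_ge_zero[of "coord g i"]]
      by linarith
    finally show "norm (cinner (coord f i) (coord g i)) \<le> (norm (coord f i))\<^sup>2 + (norm (coord g i))\<^sup>2" .
  qed auto
  then show ?thesis
    by (rule abs_summable_summable)
qed

lemma cinner_self_ell2:
  fixes f :: "('a, 'b) ell2"
  shows "cinner f f = complex_of_real (\<Sum>\<^sub>\<infinity>i. (norm (coord f i))\<^sup>2)"
proof -
  have "((\<lambda>i. (norm (coord f i))\<^sup>2) has_sum (\<Sum>\<^sub>\<infinity>i. (norm (coord f i))\<^sup>2)) UNIV"
    using coord_summable by (rule has_sum_infsum)
  then have "((\<lambda>i. complex_of_real ((norm (coord f i))\<^sup>2)) has_sum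
      complex_of_real (\<Sum>\<^sub>\<infinity>i. (norm (coord f i))\<^sup>2)) UNIV"
    by (rule has_sum_of_real)
  then show ?thesis
    by (simp add: cinner_ell2_def cinner_self infsumI)
qed

instance
proof
  fix f g h :: "('a, 'b) ell2" and c d :: complex and r s :: real
  show "f + g + h = f + (g + h)" by transfer (simp add: add.assoc)
  show "f + g = g + f" by transfer (simp add: add.commute)
  show "0 + f = f" by transfer simp
  show "- f + f = 0" by transfer simp
  show "f - g = f + - g" by transfer simp
  show "r *\<^sub>R (f + g) = r *\<^sub>R f + r *\<^sub>R g" by transfer (simp add: scaleR_add_right)
  show "(r + s) *\<^sub>R f = r *\<^sub>R f + s *\<^sub>R f" by transfer (simp add: scaleR_add_left)
  show "r *\<^sub>R s *\<^sub>R f = (r * s) *\<^sub>R f" by transfer simp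
  show "1 *\<^sub>R f = f" by transfer simp
  show "sgn f = inverse (norm f) *\<^sub>R f" by (rule sgn_ell2_def)
  show "dist f g = norm (f - g)" by (rule dist_ell2_def)
  show "(uniformity :: (('a, 'b) ell2 \<times> ('a, 'b) ell2) filter) =
      (INF e\<in>{0 <..}. principal {(f, g). dist f g < e})" by (rule uniformity_ell2_def)
  show "open U = (\<forall>x\<in>U. \<forall>\<^sub>F (x', y) in uniformity. x' = x \<longrightarrow> y \<in> U)" for U :: "('a, 'b) ell2 set"
    by (rule open_ell2_def)
  show scaleC_add_r: "c *\<^sub>C (f + g) = c *\<^sub>C f + c *\<^sub>C g" by transfer (simp add: scaleC_add_right)
  show "(c + d) *\<^sub>C f = c *\<^sub>C f + d *\<^sub>C f" by transfer (simp add: scaleC_add_left)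
  show "c *\<^sub>C d *\<^sub>C f = (c * d) *\<^sub>C f" by transfer (simp add: scaleC_scaleC)
  show scR: "r *\<^sub>R f = complex_of_real r *\<^sub>C f" by transfer (simp add: scaleR_scaleC)
  show add: "cinner (f + g) h = cinner f h + cinner g h"
    by (simp add: cinner_ell2_def plus_ell2.rep_eq cinner_add_left infsum_add cinner_ell2_summable)
  show scC: "cinner (c *\<^sub>C f) g = c * cinner f g" for c and f g :: "('a, 'b) ell2"
    by (simp add: cinner_ell2_def scaleC_ell2.rep_eq cinner_scaleC_left infsum_cmult_right')
  show comm: "cinner f g = cnj (cinner g f)"
    unfolding cinner_ell2_def infsum_cnj[symmetric] by (rule infsum_cong) (rule cinner_commute)
  show "inner f g = Re (cinner f g)" by (rule inner_ell2_def)
  show "inner f g = inner g f"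
    unfolding inner_ell2_def using comm by simp
  show "inner (f + g) h = inner f h + inner g h"
    by (simp add: inner_ell2_def add)
  show "inner (r *\<^sub>R f) g = r * inner f g"
    by (simp add: inner_ell2_def scR scC)
  show "0 \<le> inner f f"
    by (simp add: inner_ell2_def cinner_self_ell2 infsum_nonneg)
  show "inner f f = 0 \<longleftrightarrow> f = 0"
  proof
    assume "inner f f = 0"
    then have "(\<Sum>\<^sub>\<infinity>i. (norm (coord f i))\<^sup>2) \<le> 0"
      by (simp add: inner_ell2_def cinner_self_ell2)
    then have "(norm (coord f i))\<^sup>2 = 0" for i
      by (rule nonneg_infsum_le_0D) (auto intro: coord_summable)
    then show "f = 0"
      by (intro ell2_eqI) (simp add: zero_ell2.rep_eq)
  qed (simp add: inner_ell2_def cinner_self_ell2 zero_ell2.rep_eq)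
  show "norm f = sqrt (inner f f)" by (rule norm_ell2_def)
qed

end

lemma power2_norm_ell2: "(norm f)\<^sup>2 = (\<Sum>\<^sub>\<infinity>i. (norm (coord f i))\<^sup>2)"
  by (simp add: power2_norm_eq_inner inner_ell2_def cinner_self_ell2)

lemma norm_coord_le: "norm (coord f i) \<le> norm f"
proof -
  have "(norm (coord f i))\<^sup>2 = (\<Sum>\<^sub>\<infinity>j\<in>{i}. (norm (coord f j))\<^sup>2)"
    by simp
  also have "\<dots> \<le> (norm f)\<^sup>2"
    unfolding power2_norm_ell2 by (rule infsum_mono_neutral) (auto intro: coord_summable)
  finally show ?thesis
    by (rule power2_le_imp_le) simp
qed

instance ell2 :: (type, chilbert_space) chilbert_space
proof
  fix X :: "nat \<Rightarrow> ('a, 'b) ell2"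
  assume X: "Cauchy X"
  have "Cauchy (\<lambda>n. coord (X n) i)" for i
  proof (rule metric_CauchyI)
    fix e :: real
    assume "0 < e"
    then obtain N where N: "dist (X m) (X n) < e" if "m \<ge> N" "n \<ge> N" for m n
      using X by (meson metric_CauchyD)
    have "dist (coord (X m) i) (coord (X n) i) \<le> dist (X m) (X n)" for m n
      using norm_coord_le[of "X m - X n" i] by (simp add: dist_norm minus_ell2.rep_eq)
    then show "\<exists>N. \<forall>m\<ge>N. \<forall>n\<ge>N. dist (coord (X m) i) (coord (X n) i) < e"
      using N by (meson le_less_trans)
  qed
  then have "\<forall>i. \<exists>l. (\<lambda>n. coord (X n) i) \<longlonglongrightarrow> l"
    by (auto simp: Cauchy_convergent_iff convergent_def)
  then obtain g where g: "(\<lambda>n. coord (X n) i) \<longlonglongrightarrow> g i" for i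
    by (auto dest!: choice)
  have fin: "(\<Sum>i\<in>F. (norm (coord (X n) i - g i))\<^sup>2) \<le> e\<^sup>2"
    if N: "\<And>m. m \<ge> N \<Longrightarrow> dist (X n) (X m) \<le> e" and F: "finite F" for n N e and F :: "'a set"
  proof (rule tendsto_upperbound)
    show "(\<lambda>m. \<Sum>i\<in>F. (norm (coord (X n) i - coord (X m) i))\<^sup>2)
        \<longlonglongrightarrow> (\<Sum>i\<in>F. (norm (coord (X n) i - g i))\<^sup>2)"
      by (intro tendsto_intros g)
    have "(\<Sum>i\<in>F. (norm (coord (X n) i - coord (X m) i))\<^sup>2) \<le> e\<^sup>2" if "m \<ge> N" for m
    proof -
      have "(\<Sum>i\<in>F. (norm (coord (X n - X m) i))\<^sup>2) \<le> (norm (X n - X m))\<^sup>2"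
        unfolding power2_norm_ell2 using F by (intro finite_sum_le_infsum coord_summable) auto
      also have "\<dots> \<le> e\<^sup>2"
        using N[OF that] by (intro power_mono) (auto simp: dist_norm)
      finally show ?thesis
        by (simp add: minus_ell2.rep_eq)
    qed
    then show "\<forall>\<^sub>F m in sequentially. (\<Sum>i\<in>F. (norm (coord (X n) i - coord (X m) i))\<^sup>2) \<le> e\<^sup>2"
      by (auto simp: eventually_sequentially)
  qed simp
  have diff_summable: "(\<lambda>i. (norm (coord (X n) i - g i))\<^sup>2) summable_on UNIV"
    if "\<And>m. m \<ge> N \<Longrightarrow> dist (X n) (X m) \<le> e" for n N e
    by (rule nonneg_bdd_above_summable_on)
       (auto intro!: bdd_aboveI2[where M = "e\<^sup>2"] simp: fin[OF that])
  obtain N1 where N1: "dist (X m) (X n) < 1" if "m \<ge> N1" "n \<ge> N1" for m n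
    using X by (metis metric_CauchyD zero_less_one)
  have s: "(\<lambda>i. (norm (coord (X N1) i - g i))\<^sup>2) summable_on UNIV"
    by (rule diff_summable[of N1 N1 1]) (use N1 in \<open>auto intro: less_imp_le\<close>)
  have "coord (X N1 - Abs_ell2 (\<lambda>i. coord (X N1) i - g i)) = g"
    using s by (auto simp: minus_ell2.rep_eq Abs_ell2_inverse)
  then obtain G where G: "coord G = g"
    by blast
  have "X \<longlonglongrightarrow> G"
  proof (rule metric_LIMSEQ_I)
    fix e :: real
    assume e: "0 < e"
    then obtain N where N: "dist (X m) (X n) < e / 2" if "m \<ge> N" "n \<ge> N" for m n
      using X by (metis metric_CauchyD half_gt_zero)
    have "dist (X n) G < e" if n: "n \<ge> N" for n
    proof -
      have N': "dist (X n) (X m) \<le> e / 2" if "m \<ge> N" for m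
        using N[OF n that] by simp
      have "(norm (X n - G))\<^sup>2 \<le> (e / 2)\<^sup>2"
        unfolding power2_norm_ell2 minus_ell2.rep_eq G
        by (rule infsum_le_finite_sums[OF diff_summable[OF N']]) (auto intro: fin[OF N'])
      then have "norm (X n - G) \<le> e / 2"
        using e by (auto dest: power2_le_imp_le)
      then show ?thesis
        using e by (simp add: dist_norm)
    qed
    then show "\<exists>no. \<forall>n\<ge>no. dist (X n) G < e"
      by blast
  qed
  then show "convergent X"
    by (auto simp: convergent_def)
qed


section \<open>Operators on closed subspaces\<close>

text \<open>
  A Hilbert space \<open>H\<close> is represented by a closed subspace of an ambient type. An operator on \<open>H\<close> is a
  function on the ambient type of which only the restriction to \<open>H\<close> matters.
\<close>

definition orth_proj :: "'a :: complex_inner set \<Rightarrow> 'a \<Rightarrow> 'a"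
  where "orth_proj M x = (THE y. y \<in> M \<and> (\<forall>z\<in>M. cinner (x - y) z = 0))"

definition bounded_op_on :: "'a :: complex_inner set \<Rightarrow> ('a \<Rightarrow> 'a) \<Rightarrow> bool"
  where "bounded_op_on H A \<longleftrightarrow>
    (\<forall>x\<in>H. A x \<in> H) \<and>
    (\<forall>x\<in>H. \<forall>y\<in>H. A (x + y) = A x + A y) \<and>
    (\<forall>c. \<forall>x\<in>H. A (c *\<^sub>C x) = c *\<^sub>C A x) \<and>
    (\<exists>C. \<forall>x\<in>H. norm (A x) \<le> C * norm x)"

definition positive_on :: "'a :: complex_inner set \<Rightarrow> ('a \<Rightarrow> 'a) \<Rightarrow> bool"
  where "positive_on H A \<longleftrightarrow> (\<forall>x\<in>H. cinner (A x) x \<in> \<real>\<^sub>\<ge>\<^sub>0)"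

text \<open>The adjoint of an operator from \<open>H\<close> to another space; its values lie in \<open>H\<close>.\<close>

definition adjoint_on :: "'a :: complex_inner set \<Rightarrow> ('a \<Rightarrow> 'b :: complex_inner) \<Rightarrow> 'b \<Rightarrow> 'a"
  where "adjoint_on H A y = (THE z. z \<in> H \<and> (\<forall>x\<in>H. cinner (A x) y = cinner x z))"

text \<open>On \<open>H\<close>, the positive square root of a positive operator is unique, so the choice concerns
  only the irrelevant values outside \<open>H\<close>.\<close>

definition op_sqrt :: "'a :: complex_inner set \<Rightarrow> ('a \<Rightarrow> 'a) \<Rightarrow> 'a \<Rightarrow> 'a"
  where "op_sqrt H A = (SOME R. bounded_op_on H R \<and> positive_on H R \<and> (\<forall>x\<in>H. R (R x) = A x))"

definition is_onb :: "'a :: complex_inner set \<Rightarrow> 'a set \<Rightarrow> bool"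
  where "is_onb H B \<longleftrightarrow> B \<subseteq> H \<and>
    (\<forall>x\<in>B. \<forall>y\<in>B. cinner x y = (if x = y then 1 else 0)) \<and> closure (cspan B) = H"

text \<open>For a trace class operator the sum does not depend on the chosen orthonormal basis.\<close>

definition op_trace :: "'a :: complex_inner set \<Rightarrow> ('a \<Rightarrow> 'a) \<Rightarrow> complex"
  where "op_trace H A = (\<Sum>\<^sub>\<infinity>b\<in>(SOME B. is_onb H B). cinner (A b) b)"

lemma orth_proj_eqI:
  assumes M: "csubspace M" and y: "y \<in> M" "\<And>z. z \<in> M \<Longrightarrow> cinner (x - y) z = 0"
  shows "orth_proj M x = y"
  unfolding orth_proj_def
proof (rule the_equality)
  fix y' assume y': "y' \<in> M \<and> (\<forall>z\<in>M. cinner (x - y') z = 0)"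
  have "y' - y \<in> M"
    using y y' M by (auto intro: complex_vector.subspace_diff)
  then have "cinner ((x - y) - (x - y')) (y' - y) = 0"
    using y y' by (simp only: cinner_diff_left) simp
  then have "cinner (y' - y) (y' - y) = 0"
    by simp
  then show "y' = y"
    by (simp add: cinner_self)
qed (use y in auto)


section \<open>Tensor products of full Fock spaces\<close>

text \<open>
  A list \<open>ns = [n\<^sub>1, \<dots>, n\<^sub>k]\<close> encodes both \<open>k\<close> and the numbers \<open>n\<^sub>i\<close>; all indices start at \<open>0\<close>.
  A word over the letters \<open>0, \<dots>, n\<^sub>i - 1\<close> is an element of the free semigroup on \<open>n\<^sub>i\<close> generators, and a
  list of \<open>k\<close> such words is a multi-index \<open>(\<alpha>\<^sub>1, \<dots>, \<alpha>\<^sub>k)\<close>. Via the orthonormal bases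
  \<open>e\<^sub>\<alpha>\<close> of the Fock spaces, the tensor product of the \<open>k\<close> Fock spaces and a Hilbert space
  \<open>V\<close> is the space of square-summable families of vectors of \<open>V\<close> indexed by these multi-indices.
\<close>

definition multiwords :: "nat list \<Rightarrow> nat list list set"
  where "multiwords ns = {w. length w = length ns \<and> (\<forall>i<length ns. set (w ! i) \<subseteq> {..<ns ! i})}"

definition ell2_on :: "'i set \<Rightarrow> 'a :: complex_inner set \<Rightarrow> ('i, 'a) ell2 set"
  where "ell2_on A V = {f. (\<forall>w\<in>A. coord f w \<in> V) \<and> (\<forall>w. w \<notin> A \<longrightarrow> coord f w = 0)}"

definition tensor_fock :: "nat list \<Rightarrow> 'a :: complex_inner set \<Rightarrow> (nat list list, 'a) ell2 set"
  where "tensor_fock ns V = ell2_on (multiwords ns) V"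

text \<open>\<open>etensor [\<alpha>\<^sub>1, \<dots>, \<alpha>\<^sub>k] x\<close> is the elementary tensor of the basis vectors with indices
  \<open>\<alpha>\<^sub>1, \<dots>, \<alpha>\<^sub>k\<close> and of \<open>x\<close>.\<close>

lift_definition etensor :: "'i \<Rightarrow> 'a :: complex_inner \<Rightarrow> ('i, 'a) ell2"
  is "\<lambda>w x v. if v = w then x else 0"
proof -
  fix w :: 'i and x :: 'a
  have "(\<lambda>v. (norm (if v = w then x else 0))\<^sup>2) summable_on {w}"
    by simp
  then show "(\<lambda>v. (norm (if v = w then x else 0))\<^sup>2) summable_on UNIV"
    by (rule summable_on_cong_neutral[THEN iffD1, rotated -1]) auto
qed

lemma cinner_etensor: "cinner (etensor v x) (etensor w y) = (if v = w then cinner x y else 0)"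
proof -
  have "cinner (etensor v x) (etensor w y) = (\<Sum>\<^sub>\<infinity>u\<in>{v}. if v = w then cinner x y else 0)"
    unfolding cinner_ell2_def by (rule infsum_cong_neutral) (auto simp: etensor.rep_eq)
  then show ?thesis by simp
qed

text \<open>The creation operator with generator \<open>j\<close> in position \<open>i\<close>, tensored with the identity of the
  coefficient space.\<close>

lift_definition creation :: "nat \<Rightarrow> nat \<Rightarrow> (nat list list, 'a :: complex_inner) ell2 \<Rightarrow> (nat list list, 'a) ell2"
  is "\<lambda>i j f w. if i < length w \<and> w ! i \<noteq> [] \<and> hd (w ! i) = j then f (w[i := tl (w ! i)]) else 0"
proof -
  fix i j :: nat and f :: "nat list list \<Rightarrow> 'a"
  assume f: "(\<lambda>w. (norm (f w))\<^sup>2) summable_on UNIV"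
  define A where "A = {w :: nat list list. i < length w \<and> w ! i \<noteq> [] \<and> hd (w ! i) = j}"
  define h where "h = (\<lambda>w :: nat list list. w[i := tl (w ! i)])"
  have "inj_on h A"
  proof (rule inj_on_inverseI)
    fix w assume "w \<in> A"
    then show "(\<lambda>v. v[i := j # v ! i]) (h w) = w"
      by (auto simp: A_def h_def)
  qed
  then have "(\<lambda>w. (norm (f (h w)))\<^sup>2) summable_on A"
    using summable_on_reindex[of h A "\<lambda>w. (norm (f w))\<^sup>2"] summable_on_subset_banach[OF f, of "h ` A"]
    by (simp add: o_def)
  then show "(\<lambda>w. (norm (if i < length w \<and> w ! i \<noteq> [] \<and> hd (w ! i) = j
      then f (w[i := tl (w ! i)]) else 0))\<^sup>2) summable_on UNIV"
    by (rule summable_on_cong_neutral[THEN iffD1, rotated -1]) (auto simp: A_def h_def)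
qed

lemma creation_etensor:
  assumes "i < length w"
  shows "creation i j (etensor w x) = etensor (w[i := j # w ! i]) x"
proof (rule ell2_eqI)
  fix v :: "nat list list"
  have "(i < length v \<and> v ! i \<noteq> [] \<and> hd (v ! i) = j \<and> v[i := tl (v ! i)] = w) \<longleftrightarrow> v = w[i := j # w ! i]"
    using assms by (auto simp: list_update_same_conv)
  then show "coord (creation i j (etensor w x)) v = coord (etensor (w[i := j # w ! i]) x) v"
    by (auto simp: creation.rep_eq etensor.rep_eq)
qed

definition words_of_degree :: "nat list \<Rightarrow> nat list \<Rightarrow> nat list list set"
  where "words_of_degree ns q = {w \<in> multiwords ns. map length w = q}"

definition words_upto :: "nat list \<Rightarrow> nat list \<Rightarrow> nat list list set"
  where "words_upto ns q = {w \<in> multiwords ns. list_all2 (\<le>) (map length w) q}"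

text \<open>The projections \<open>P\<^sub>q\<^sub>1 \<otimes> \<dots> \<otimes> P\<^sub>q\<^sub>k \<otimes> I\<^sub>V\<close> and \<open>P\<^sub>\<le>\<^sub>q \<otimes> I\<^sub>V\<close>.\<close>

definition degree_proj :: "nat list \<Rightarrow> nat list \<Rightarrow> 'a :: complex_inner set
    \<Rightarrow> (nat list list, 'a) ell2 \<Rightarrow> (nat list list, 'a) ell2"
  where "degree_proj ns q V = orth_proj (ell2_on (words_of_degree ns q) V)"

definition upto_proj :: "nat list \<Rightarrow> nat list \<Rightarrow> 'a :: complex_inner set
    \<Rightarrow> (nat list list, 'a) ell2 \<Rightarrow> (nat list list, 'a) ell2"
  where "upto_proj ns q V = orth_proj (ell2_on (words_upto ns q) V)"

lemma csubspace_ell2_on: "csubspace V \<Longrightarrow> csubspace (ell2_on A V)"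
  unfolding complex_vector.subspace_def ell2_on_def
  by (auto simp: zero_ell2.rep_eq plus_ell2.rep_eq scaleC_ell2.rep_eq)

lemma orth_proj_ell2_on_etensor:
  assumes "csubspace V" "x \<in> V"
  shows "orth_proj (ell2_on A V) (etensor w x) = (if w \<in> A then etensor w x else 0)"
proof (rule orth_proj_eqI[OF csubspace_ell2_on[OF assms(1)]])
  show "(if w \<in> A then etensor w x else 0) \<in> ell2_on A V"
    using assms by (auto simp: ell2_on_def etensor.rep_eq zero_ell2.rep_eq complex_vector.subspace_0)
  fix z assume "z \<in> ell2_on A V"
  then show "cinner (etensor w x - (if w \<in> A then etensor w x else 0)) z = 0"
    by (auto simp: cinner_ell2_def ell2_on_def etensor.rep_eq zero_ell2.rep_eq minus_ell2.rep_eq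
        intro!: infsum_0)
qed

definition invariant_subspace :: "nat list \<Rightarrow> (nat list list, 'e :: complex_inner) ell2 set \<Rightarrow> bool"
  where "invariant_subspace ns M \<longleftrightarrow>
    M \<subseteq> tensor_fock ns UNIV \<and> csubspace M \<and> closed M \<and>
    (\<forall>i<length ns. \<forall>j<ns ! i. creation i j ` M \<subseteq> M)"

definition orth_compl :: "nat list \<Rightarrow> (nat list list, 'e :: complex_inner) ell2 set
    \<Rightarrow> (nat list list, 'e) ell2 set"
  where "orth_compl ns M = {f \<in> tensor_fock ns UNIV. \<forall>g\<in>M. cinner f g = 0}"


section \<open>The regular polyball and the curvature invariant\<close>

text \<open>A tuple \<open>T\<close> of operators on \<open>H\<close> consists of \<open>T i j\<close> for \<open>i < length ns\<close> and \<open>j < ns ! i\<close>.\<close>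

definition Phi :: "'a :: complex_inner set \<Rightarrow> nat \<Rightarrow> (nat \<Rightarrow> 'a \<Rightarrow> 'a) \<Rightarrow> ('a \<Rightarrow> 'a) \<Rightarrow> 'a \<Rightarrow> 'a"
  where "Phi H n X Y = (\<lambda>h. \<Sum>j<n. X j (Y (adjoint_on H (X j) h)))"

definition id_minus_Phi :: "'a :: complex_inner set \<Rightarrow> nat \<Rightarrow> (nat \<Rightarrow> 'a \<Rightarrow> 'a) \<Rightarrow> ('a \<Rightarrow> 'a) \<Rightarrow> 'a \<Rightarrow> 'a"
  where "id_minus_Phi H n X Y = (\<lambda>h. Y h - Phi H n X Y h)"

definition defect_map :: "nat list \<Rightarrow> 'a :: complex_inner set \<Rightarrow> (nat \<Rightarrow> nat \<Rightarrow> 'a \<Rightarrow> 'a) \<Rightarrow> nat list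
    \<Rightarrow> ('a \<Rightarrow> 'a) \<Rightarrow> 'a \<Rightarrow> 'a"
  where "defect_map ns H T p = foldr (\<lambda>i. id_minus_Phi H (ns ! i) (T i) ^^ (p ! i)) [0..<length ns]"

definition regular_polyball :: "nat list \<Rightarrow> 'a :: complex_inner set \<Rightarrow> (nat \<Rightarrow> nat \<Rightarrow> 'a \<Rightarrow> 'a) set"
  where "regular_polyball ns H = {T.
    (\<forall>i<length ns. \<forall>j<ns ! i. bounded_op_on H (T i j)) \<and>
    (\<forall>s<length ns. \<forall>t<length ns. s \<noteq> t \<longrightarrow>
      (\<forall>a<ns ! s. \<forall>b<ns ! t. \<forall>h\<in>H. T s a (T t b h) = T t b (T s a h))) \<and>
    (\<forall>p. length p = length ns \<and> set p \<subseteq> {0, 1} \<longrightarrow> positive_on H (defect_map ns H T p id))}"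

definition defect :: "nat list \<Rightarrow> 'a :: complex_inner set \<Rightarrow> (nat \<Rightarrow> nat \<Rightarrow> 'a \<Rightarrow> 'a) \<Rightarrow> 'a \<Rightarrow> 'a"
  where "defect ns H T = defect_map ns H T (replicate (length ns) 1) id"

definition defect_space :: "nat list \<Rightarrow> 'a :: complex_inner set \<Rightarrow> (nat \<Rightarrow> nat \<Rightarrow> 'a \<Rightarrow> 'a) \<Rightarrow> 'a set"
  where "defect_space ns H T = closure (defect ns H T ` H)"

definition word_op :: "(nat \<Rightarrow> 'a \<Rightarrow> 'a) \<Rightarrow> nat list \<Rightarrow> 'a \<Rightarrow> 'a"
  where "word_op X \<alpha> = foldr X \<alpha>"

definition berezin_kernel :: "nat list \<Rightarrow> 'a :: complex_inner set \<Rightarrow> (nat \<Rightarrow> nat \<Rightarrow> 'a \<Rightarrow> 'a)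
    \<Rightarrow> 'a \<Rightarrow> (nat list list, 'a) ell2"
  where "berezin_kernel ns H T h = (\<Sum>\<^sub>\<infinity>\<beta>\<in>multiwords ns. etensor \<beta>
    (op_sqrt H (defect ns H T) (foldr (\<lambda>i. adjoint_on H (word_op (T i) (\<beta> ! i))) [0..<length ns] h)))"

definition curv_term :: "nat list \<Rightarrow> 'a :: complex_inner set \<Rightarrow> (nat \<Rightarrow> nat \<Rightarrow> 'a \<Rightarrow> 'a) \<Rightarrow> nat list \<Rightarrow> complex"
  where "curv_term ns H T q =
    op_trace H (\<lambda>h. adjoint_on H (berezin_kernel ns H T)
      (degree_proj ns q (defect_space ns H T) (berezin_kernel ns H T h)))
    / op_trace (tensor_fock ns (UNIV :: complex set)) (degree_proj ns q UNIV)"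

definition curv_seq :: "nat list \<Rightarrow> 'a :: complex_inner set \<Rightarrow> (nat \<Rightarrow> nat \<Rightarrow> 'a \<Rightarrow> 'a) \<Rightarrow> nat \<Rightarrow> complex"
  where "curv_seq ns H T m =
    (\<Sum>q | length q = length ns \<and> sum_list q \<le> m. curv_term ns H T q)
    / of_nat ((m + length ns) choose length ns)"

text \<open>The curvature is meaningful for \<open>T\<close> in the regular polyball with trace class defect.\<close>

definition curv :: "nat list \<Rightarrow> 'a :: complex_inner set \<Rightarrow> (nat \<Rightarrow> nat \<Rightarrow> 'a \<Rightarrow> 'a) \<Rightarrow> complex"
  where "curv ns H T = lim (curv_seq ns H T)"


section \<open>Multiplicity\<close>

definition mult_term :: "nat list \<Rightarrow> (nat list list, 'e :: complex_inner) ell2 set \<Rightarrow> nat list \<Rightarrow> complex"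
  where "mult_term ns M q =
    op_trace (tensor_fock ns UNIV) (\<lambda>f. orth_proj M (degree_proj ns q UNIV f))
    / op_trace (tensor_fock ns (UNIV :: complex set)) (degree_proj ns q UNIV)"

definition mult_term_upto :: "nat list \<Rightarrow> (nat list list, 'e :: complex_inner) ell2 set \<Rightarrow> nat list \<Rightarrow> complex"
  where "mult_term_upto ns M q =
    op_trace (tensor_fock ns UNIV) (\<lambda>f. orth_proj M (upto_proj ns q UNIV f))
    / op_trace (tensor_fock ns (UNIV :: complex set)) (upto_proj ns q UNIV)"

definition mult_seq :: "nat list \<Rightarrow> (nat list list, 'e :: complex_inner) ell2 set \<Rightarrow> nat \<Rightarrow> complex"
  where "mult_seq ns M m =
    (\<Sum>q | length q = length ns \<and> sum_list q \<le> m. mult_term ns M q)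
    / of_nat ((m + length ns) choose length ns)"

definition subspace_multiplicity :: "nat list \<Rightarrow> (nat list list, 'e :: complex_inner) ell2 set \<Rightarrow> complex"
  where "subspace_multiplicity ns M = lim (mult_seq ns M)"

definition compression :: "nat list \<Rightarrow> (nat list list, 'e :: complex_inner) ell2 set
    \<Rightarrow> nat \<Rightarrow> nat \<Rightarrow> (nat list list, 'e) ell2 \<Rightarrow> (nat list list, 'e) ell2"
  where "compression ns M i j = (\<lambda>h. orth_proj (orth_compl ns M) (creation i j h))"


section \<open>Limits in several indices\<close>

text \<open>The filter of the net of all \<open>k\<close>-tuples of natural numbers with the coordinatewise order.\<close>

definition multi_at_top :: "nat \<Rightarrow> nat list filter"
  where "multi_at_top k = (INF N\<in>{N. length N = k}. principal {q. list_all2 (\<le>) N q})"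

lemma eventually_multi_at_top:
  "eventually P (multi_at_top k) \<longleftrightarrow> (\<exists>N. length N = k \<and> (\<forall>q. list_all2 (\<le>) N q \<longrightarrow> P q))"
  unfolding multi_at_top_def
proof (subst eventually_INF_base)
  show "{N :: nat list. length N = k} \<noteq> {}"
    by (auto intro: exI[of _ "replicate k 0"])
next
  fix a b :: "nat list"
  assume "a \<in> {N. length N = k}" "b \<in> {N. length N = k}"
  then show "\<exists>x\<in>{N. length N = k}. principal {q. list_all2 (\<le>) x q}
      \<le> inf (principal {q. list_all2 (\<le>) a q}) (principal {q. list_all2 (\<le>) b q})"
    by (intro bexI[of _ "map2 max a b"]) (auto simp: list_all2_conv_all_nth)
qed (auto simp: eventually_principal)

text \<open>\<open>iterated_limit k f L\<close>: the limit of \<open>f [q\<^sub>1, \<dots>, q\<^sub>k]\<close> as first \<open>q\<^sub>k\<close>, then \<open>q\<^sub>k\<^sub>-\<^sub>1\<close>, \<dots>, and finally \<open>q\<^sub>1\<close>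
  tends to infinity is \<open>L\<close>, where every inner limit exists.\<close>

fun iterated_limit :: "nat \<Rightarrow> (nat list \<Rightarrow> complex) \<Rightarrow> complex \<Rightarrow> bool"
  where
    "iterated_limit 0 f L \<longleftrightarrow> f [] = L"
  | "iterated_limit (Suc k) f L \<longleftrightarrow>
      (\<exists>g. (\<forall>q. iterated_limit k (\<lambda>qs. f (q # qs)) (g q)) \<and> g \<longlonglongrightarrow> L)"

end

theory Submission
  imports Defs "HOL-Real_Asymp.Real_Asymp"
begin

text \<open>
  Let \<open>F w\<close> be the trace of \<open>P\<^sub>M\<close> compressed to \<open>e\<^sub>w \<otimes> \<E>\<close>. The creation operators are isometries that leave
  \<open>M\<close> invariant, so \<open>F\<close> does not decrease when a letter is put in front of one of the words of \<open>w\<close>.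
  Hence the average of \<open>F\<close> over the words of multidegree \<open>q\<close>, which is the quotient of traces in the
  theorem, is nondecreasing in \<open>q\<close> and bounded; it converges, and each of the other averages has
  the same limit.

  The defect of the compression is \<open>A\<^sup>* A\<close>, where \<open>A h = h(\<emptyset>)\<close> is the vacuum coefficient. So
  \<open>\<Delta>\<^sup>1\<^sup>/\<^sup>2 T\<^sub>\<beta>\<^sup>* h\<close> has the norm of the coefficient \<open>h(\<beta>)\<close>, and \<open>K\<^sup>* (P\<^sub>q \<otimes> I) K\<close> is the compression of \<open>P\<^sub>q \<otimes> I\<close> to the
  orthogonal complement of \<open>M\<close>. The terms of the curvature are therefore \<open>dim \<E>\<close> minus those of
  the multiplicity.
\<close>

section \<open>Complex Hilbert spaces\<close>

text \<open>The statement contains choices: \<open>op_trace\<close> sums over some orthonormal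
  basis, \<open>op_sqrt\<close> picks some root. For traces the choice is harmless: every operator
  traced here has finite rank, and Parseval's identity gives the same sum for each basis. For
  \<open>op_sqrt\<close> existence has to be shown; the binomial series applies because
  \<open>1 - \<Delta>\<close> is a contraction. The root enters only through being bounded and
  positive with square \<Delta>: this determines the inner products
  \<open>cinner (R x) (R y)\<close> and places the range of \<open>R\<close> in the defect space.
  The quotients for the projections onto all degrees up to \<open>q\<close> are not plain means over
  multidegrees: in a position with \<open>n\<close> letters, degree \<open>p\<close> carries the
  weight \<open>n ^ p\<close>. The weights are at least 1, so their sums diverge and the weighted
  means of a convergent monotone sequence keep its limit. The weights factor over the positions, so
  the limits can be taken one position at a time.\<close>

instance chilbert_space \<subseteq> banach ..

lemma cinner_diff_right: "cinner (x :: 'a :: complex_inner) (y - z) = cinner x y - cinner x z"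
  by (metis cinner_commute cinner_diff_left complex_cnj_diff)

lemma cinner_sum_left: "cinner (\<Sum>i\<in>I. f i) (y :: 'a :: complex_inner) = (\<Sum>i\<in>I. cinner (f i) y)"
  by (induction I rule: infinite_finite_induct) (simp_all add: cinner_add_left)

lemma cinner_scaleR_left: "cinner (r *\<^sub>R x :: 'a :: complex_inner) y = complex_of_real r * cinner x y"
  by (simp add: scaleR_scaleC cinner_scaleC_left)

lemma bounded_linear_cinner_left: "bounded_linear (\<lambda>x :: 'a :: complex_inner. cinner x y)"
  by (rule bounded_linear_intro[where K = "norm y"])
     (simp_all add: cinner_add_left cinner_scaleR_left scaleR_conv_of_real norm_cinner_le)

lemma bounded_linear_scaleC: "bounded_linear (\<lambda>x :: 'a :: complex_inner. c *\<^sub>C x)"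
  by (rule bounded_linear_intro[where K = "norm c"])
     (simp_all add: scaleC_add_right scaleR_scaleC scaleC_scaleC norm_scaleC mult.commute)

lemma cinner_eq_0_iff: "cinner x (x :: 'a :: complex_inner) = 0 \<longleftrightarrow> x = 0"
  by (simp add: cinner_self)

lemma cinner_eq_0_commute: "cinner x (y :: 'a :: complex_inner) = 0 \<Longrightarrow> cinner y x = 0"
  by (metis cinner_commute complex_cnj_zero)

lemma csubspace_scaleR: "csubspace M \<Longrightarrow> x \<in> M \<Longrightarrow> r *\<^sub>R x \<in> M"
  by (simp add: scaleR_scaleC complex_vector.subspace_scale)

section \<open>Closed subspaces and orthogonal projections\<close>

lemma csubspace_closure:
  assumes "csubspace (M :: 'a :: complex_inner set)"
  shows "csubspace (closure M)"
  unfolding complex_vector.subspace_def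
proof (intro conjI ballI allI)
  show "0 \<in> closure M"
    using assms closure_subset complex_vector.subspace_0 by blast
next
  fix x y assume "x \<in> closure M" "y \<in> closure M"
  then obtain f g where f: "\<And>n. f n \<in> M" "f \<longlonglongrightarrow> x" and g: "\<And>n. g n \<in> M" "g \<longlonglongrightarrow> y"
    unfolding closure_sequential by blast
  have "(\<lambda>n. f n + g n) \<longlonglongrightarrow> x + y"
    using f g by (intro tendsto_intros)
  moreover have "f n + g n \<in> M" for n
    using assms f g by (simp add: complex_vector.subspace_add)
  ultimately show "x + y \<in> closure M"
    unfolding closure_sequential by (intro exI[of _ "\<lambda>n. f n + g n"]) simp
next
  fix x c assume "x \<in> closure M"
  then obtain f where f: "\<And>n. f n \<in> M" "f \<longlonglongrightarrow> x"
    unfolding closure_sequential by blast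
  have "(\<lambda>n. c *\<^sub>C f n) \<longlonglongrightarrow> c *\<^sub>C x"
    using f(2) by (rule bounded_linear.tendsto[OF bounded_linear_scaleC])
  moreover have "c *\<^sub>C f n \<in> M" for n
    using assms f by (simp add: complex_vector.subspace_scale)
  ultimately show "c *\<^sub>C x \<in> closure M"
    unfolding closure_sequential by (intro exI[of _ "\<lambda>n. c *\<^sub>C f n"]) simp
qed

text \<open>Subtracting \<open>t *\<^sub>R z\<close> with
  \<open>t = inner u z / (norm z)\<^sup>2\<close> would shorten \<open>u\<close> unless
  \<open>inner u z = 0\<close>. This settles the real part of \<open>cinner u z\<close>; the
  imaginary part is the real part for \<open>\<i> *\<^sub>C z\<close>, which lies in the complex
  subspace \<open>M\<close> too.\<close>

lemma norm_minimal_imp_orthogonal: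
  fixes M :: "'a :: complex_inner set"
  assumes M: "csubspace M" and min: "\<And>z. z \<in> M \<Longrightarrow> norm u \<le> norm (u - z)" and z: "z \<in> M"
  shows "cinner u z = 0"
proof -
  have Re: "inner u z = 0" if z: "z \<in> M" for z
  proof (cases "z = 0")
    case False
    define t where "t = inner u z / (norm z)\<^sup>2"
    have "inner u u \<le> inner (u - t *\<^sub>R z) (u - t *\<^sub>R z)"
      unfolding power2_norm_eq_inner[symmetric]
      using min[OF csubspace_scaleR[OF M z]] by (intro power_mono) auto
    also have "\<dots> = inner u u - 2 * t * inner u z + t * t * inner z z"
      by (simp add: inner_diff_left inner_diff_right inner_commute[of z u] algebra_simps)
    also have "\<dots> = inner u u - (inner u z)\<^sup>2 / inner z z"
      using False by (simp add: t_def power2_eq_square dot_square_norm field_simps)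
    finally have "(inner u z)\<^sup>2 / inner z z \<le> 0"
      by simp
    moreover have "0 < inner z z"
      using False by simp
    ultimately show ?thesis
      by (simp add: divide_le_0_iff)
  qed simp
  have "inner u (\<i> *\<^sub>C z) = 0"
    using M z by (intro Re complex_vector.subspace_scale)
  then have "Im (cinner u z) = 0"
    by (simp add: inner_eq_Re_cinner cinner_scaleC_right)
  moreover have "Re (cinner u z) = 0"
    using Re[OF z] by (simp add: inner_eq_Re_cinner)
  ultimately show ?thesis
    by (simp add: complex_eq_iff)
qed

text \<open>A minimising sequence for the distance from \<open>x\<close> to \<open>M\<close> is
  Cauchy; its limit is a nearest point, and minimality gives orthogonality.\<close>

lemma orth_proj_exists:
  fixes M :: "'a :: chilbert_space set"
  assumes M: "csubspace M" "closed M"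
  shows "\<exists>y\<in>M. \<forall>z\<in>M. cinner (x - y) z = 0"
proof -
  define d where "d = infdist x M"
  have ne: "M \<noteq> {}"
    using M complex_vector.subspace_0 by auto
  have d: "d \<le> norm (x - z)" if "z \<in> M" for z
    unfolding d_def using that infdist_le by (metis dist_norm)
  have d0: "0 \<le> d"
    by (simp add: d_def infdist_nonneg)
  have "\<exists>y\<in>M. norm (x - y) < d + 1 / real (Suc n)" for n
  proof -
    have "(INF a\<in>M. dist x a) < d + 1 / real (Suc n)"
      using ne by (simp add: d_def infdist_def)
    then show ?thesis
      using ne by (subst (asm) cINF_less_iff) (auto simp: dist_norm intro!: bdd_belowI2[of _ 0])
  qed
  then obtain y where yM: "y n \<in> M" and y: "norm (x - y n) < d + 1 / real (Suc n)" for n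
    by metis
  have lim: "(\<lambda>n. norm (x - y n)) \<longlonglongrightarrow> d"
  proof (rule tendsto_sandwich[where f = "\<lambda>_. d" and h = "\<lambda>n. d + 1 / real (Suc n)"])
    show "(\<lambda>n. d + 1 / real (Suc n)) \<longlonglongrightarrow> d"
      using tendsto_add[OF tendsto_const LIMSEQ_Suc[OF lim_1_over_n]] by simp
    show "\<forall>\<^sub>F n in sequentially. d \<le> norm (x - y n)"
      by (intro always_eventually allI d yM)
    show "\<forall>\<^sub>F n in sequentially. norm (x - y n) \<le> d + 1 / real (Suc n)"
      using y by (intro always_eventually allI less_imp_le)
  qed simp
  \<comment> \<open>The midpoint of \<open>y m\<close> and \<open>y n\<close> lies in
    \<open>M\<close>, so its distance from \<open>x\<close> is at least \<open>d\<close>; the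
    parallelogram law turns this into a bound on \<open>y m - y n\<close>.\<close>
  have sq: "(norm (y m - y n))\<^sup>2 \<le> 2 * ((norm (x - y m))\<^sup>2 - d\<^sup>2) + 2 * ((norm (x - y n))\<^sup>2 - d\<^sup>2)" for m n
  proof -
    have "(1/2) *\<^sub>R (y m + y n) \<in> M"
      using M(1) yM by (intro csubspace_scaleR complex_vector.subspace_add)
    then have "d\<^sup>2 \<le> (norm (x - (1/2) *\<^sub>R (y m + y n)))\<^sup>2"
      using d d0 by (intro power_mono) auto
    moreover have "(norm (y m - y n))\<^sup>2 + 4 * (norm (x - (1/2) *\<^sub>R (y m + y n)))\<^sup>2
        = 2 * (norm (x - y m))\<^sup>2 + 2 * (norm (x - y n))\<^sup>2"
      by (simp add: power2_norm_eq_inner inner_diff_left inner_diff_right inner_add_left inner_add_right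
          inner_commute algebra_simps)
    ultimately show ?thesis
      by argo
  qed
  have "Cauchy y"
  proof (rule metric_CauchyI)
    fix e :: real assume e: "0 < e"
    have "(\<lambda>n. (norm (x - y n))\<^sup>2) \<longlonglongrightarrow> d\<^sup>2"
      by (intro tendsto_power lim)
    then have "\<forall>\<^sub>F n in sequentially. (norm (x - y n))\<^sup>2 < d\<^sup>2 + e\<^sup>2 / 4"
      using e by (auto elim!: order_tendstoD)
    then obtain N where N: "(norm (x - y n))\<^sup>2 < d\<^sup>2 + e\<^sup>2 / 4" if "n \<ge> N" for n
      by (auto simp: eventually_sequentially)
    have "dist (y m) (y n) < e" if "m \<ge> N" "n \<ge> N" for m n
    proof -
      have "(norm (y m - y n))\<^sup>2 < e\<^sup>2"
        using sq[of m n] N[OF that(1)] N[OF that(2)] by argo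
      then show ?thesis
        using e by (auto simp: dist_norm dest: power_less_imp_less_base)
    qed
    then show "\<exists>N. \<forall>m\<ge>N. \<forall>n\<ge>N. dist (y m) (y n) < e"
      by blast
  qed
  then obtain l where l: "y \<longlonglongrightarrow> l"
    by (auto simp: Cauchy_convergent_iff convergent_def)
  have lM: "l \<in> M"
    using M(2) l yM closed_sequentially by blast
  have "(\<lambda>n. norm (x - y n)) \<longlonglongrightarrow> norm (x - l)"
    by (intro tendsto_intros l)
  then have "norm (x - l) = d"
    using lim LIMSEQ_unique by blast
  then have "norm (x - l) \<le> norm ((x - l) - z)" if "z \<in> M" for z
    using d[of "l + z"] M(1) lM that by (simp add: complex_vector.subspace_add diff_diff_add)
  then have "cinner (x - l) z = 0" if "z \<in> M" for z
    using norm_minimal_imp_orthogonal[OF M(1) _ that] by blast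
  then show ?thesis
    using lM by blast
qed

context
  fixes M :: "'a :: chilbert_space set"
  assumes M: "csubspace M" "closed M"
begin

lemma orth_proj_in: "orth_proj M x \<in> M"
  and cinner_orth_proj_diff: "z \<in> M \<Longrightarrow> cinner (x - orth_proj M x) z = 0"
proof -
  obtain y where y: "y \<in> M" "\<And>z. z \<in> M \<Longrightarrow> cinner (x - y) z = 0"
    using orth_proj_exists[OF M] by blast
  then have "orth_proj M x = y"
    using M by (intro orth_proj_eqI)
  then show "orth_proj M x \<in> M" "z \<in> M \<Longrightarrow> cinner (x - orth_proj M x) z = 0"
    using y by simp_all
qed

lemma orth_proj_same: "x \<in> M \<Longrightarrow> orth_proj M x = x"
  using M by (intro orth_proj_eqI) auto

lemma cinner_orth_proj_left: "z \<in> M \<Longrightarrow> cinner (orth_proj M x) z = cinner x z"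
  using cinner_orth_proj_diff[of z x] by (simp add: cinner_diff_left)

lemma cinner_orth_proj_right: "z \<in> M \<Longrightarrow> cinner z (orth_proj M x) = cinner z x"
  using cinner_orth_proj_left by (metis cinner_commute)

lemma orth_proj_add: "orth_proj M (x + y) = orth_proj M x + orth_proj M y"
  using M orth_proj_in
  by (intro orth_proj_eqI) (simp_all add: complex_vector.subspace_add cinner_diff_left cinner_add_left
      cinner_orth_proj_left)

lemma orth_proj_scaleC: "orth_proj M (c *\<^sub>C x) = c *\<^sub>C orth_proj M x"
  using M orth_proj_in
  by (intro orth_proj_eqI) (simp_all add: complex_vector.subspace_scale cinner_diff_left
      cinner_scaleC_left cinner_orth_proj_left)

lemma orth_proj_diff: "orth_proj M (x - y) = orth_proj M x - orth_proj M y"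
  using orth_proj_add[of "x - y" y] by simp

lemma orth_proj_sum: "orth_proj M (\<Sum>i\<in>I. f i) = (\<Sum>i\<in>I. orth_proj M (f i))"
  by (induction I rule: infinite_finite_induct)
     (simp_all add: orth_proj_add orth_proj_same complex_vector.subspace_0 M)

lemma power2_norm_orth_proj:
  "(norm x)\<^sup>2 = (norm (orth_proj M x))\<^sup>2 + (norm (x - orth_proj M x))\<^sup>2"
proof -
  have "inner (x - orth_proj M x) (orth_proj M x) = 0"
    using cinner_orth_proj_diff[OF orth_proj_in] by (simp add: inner_eq_Re_cinner)
  then show ?thesis
    by (simp add: power2_norm_eq_inner inner_diff_left inner_diff_right inner_commute)
qed

lemma norm_orth_proj_le: "norm (orth_proj M x) \<le> norm x"
  by (rule power2_le_imp_le) (use power2_norm_orth_proj[of x] in auto)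

end

section \<open>Orthonormal bases and traces\<close>

text \<open>The vectors orthogonal to the remainder form a subspace, so it suffices to test the
  elements of \<open>F\<close>.\<close>

lemma orthonormal_sum_orthogonal:
  fixes F :: "'a :: complex_inner set"
  assumes "finite F" and orth: "\<And>x y. x \<in> F \<Longrightarrow> y \<in> F \<Longrightarrow> cinner x y = (if x = y then 1 else 0)"
    and "v \<in> cspan F"
  shows "cinner (x - (\<Sum>b\<in>F. cinner x b *\<^sub>C b)) v = 0"
  using assms(3)
proof (induction rule: complex_vector.span_induct)
  case base
  show ?case
    by (rule complex_vector.subspaceI) (auto simp: cinner_add_right cinner_scaleC_right)
next
  case (step c)
  have "(\<Sum>b\<in>F. cinner x b * cinner b c) = (\<Sum>b\<in>F. if b = c then cinner x b else 0)"
    using step by (intro sum.cong) (auto simp: orth)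
  then show ?case
    using step assms(1) by (simp add: cinner_diff_left cinner_sum_left cinner_scaleC_left)
qed

text \<open>Density gives a finite \<open>F0\<close> and a \<open>v\<close> in its span near
  \<open>x\<close>. For every finite \<open>F\<close> between \<open>F0\<close> and \<open>B\<close>
  the Fourier sum is the best approximation of \<open>x\<close> from the span of \<open>F\<close>,
  hence at least as good as \<open>v\<close>.\<close>

lemma is_onb_has_sum:
  fixes H :: "'a :: complex_inner set"
  assumes B: "is_onb H B" and x: "x \<in> H"
  shows "((\<lambda>b. cinner x b *\<^sub>C b) has_sum x) B"
  unfolding has_sum_def tendsto_iff eventually_finite_subsets_at_top
proof (intro allI impI)
  fix e :: real assume e: "0 < e"
  have orth: "cinner x y = (if x = y then 1 else 0)" if "x \<in> B" "y \<in> B" for x y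
    using B that by (auto simp: is_onb_def)
  obtain v where v: "v \<in> cspan B" "dist v x < e"
    using B x e unfolding is_onb_def by (metis closure_approachable)
  obtain F0 where F0: "finite F0" "F0 \<subseteq> B" "v \<in> cspan F0"
  proof -
    obtain t r where "v = (\<Sum>a\<in>t. r a *\<^sub>C a)" "finite t" "t \<subseteq> B"
      using v(1) unfolding complex_vector.span_explicit by auto
    moreover from this have "v \<in> cspan t"
      by (auto intro: complex_vector.span_sum complex_vector.span_scale complex_vector.span_base)
    ultimately show ?thesis
      using that by blast
  qed
  show "\<exists>X. finite X \<and> X \<subseteq> B \<and> (\<forall>Y. finite Y \<and> X \<subseteq> Y \<and> Y \<subseteq> B \<longrightarrow>
      dist (\<Sum>b\<in>Y. cinner x b *\<^sub>C b) x < e)"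
  proof (intro exI[of _ F0] conjI allI impI F0)
    fix F assume F: "finite F \<and> F0 \<subseteq> F \<and> F \<subseteq> B"
    define p where "p = (\<Sum>b\<in>F. cinner x b *\<^sub>C b)"
    have "p \<in> cspan F"
      unfolding p_def by (intro complex_vector.span_sum complex_vector.span_scale complex_vector.span_base)
    moreover have "v \<in> cspan F"
      using F0 F complex_vector.span_mono by blast
    ultimately have "p - v \<in> cspan F"
      by (rule complex_vector.span_diff)
    then have "cinner (x - p) (p - v) = 0"
      unfolding p_def using F by (intro orthonormal_sum_orthogonal) (auto simp: orth subset_iff)
    then have "inner (x - p) (p - v) = 0"
      by (simp add: inner_eq_Re_cinner)
    then have "(norm (x - v))\<^sup>2 = (norm (x - p))\<^sup>2 + (norm (p - v))\<^sup>2"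
      using norm_add_Pythagorean[of "x - p" "p - v"] by (simp add: orthogonal_def)
    then have "norm (x - p) \<le> norm (x - v)"
      by (simp add: power2_le_imp_le)
    then show "dist p x < e"
      using v(2) by (simp add: dist_norm norm_minus_commute)
  qed
qed

lemma is_onb_Parseval:
  assumes "is_onb H B" "x \<in> H"
  shows "((\<lambda>b. cinner x b * cinner b y) has_sum cinner x y) B"
  using has_sum_bounded_linear[OF bounded_linear_cinner_left is_onb_has_sum[OF assms], of y]
  by (simp add: cinner_scaleC_left)

text \<open>Zorn's lemma for orthonormal subsets of \<open>H\<close>: if the closed span
  \<open>K\<close> of a maximal one missed some \<open>x\<close>, the normalised difference between
  \<open>x\<close> and its projection to \<open>K\<close> could be added.\<close>

lemma onb_exists:
  fixes H :: "'a :: chilbert_space set"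
  assumes H: "csubspace H" "closed H"
  shows "\<exists>B. is_onb H B"
proof -
  define \<A> where "\<A> = {B. B \<subseteq> H \<and> (\<forall>x\<in>B. \<forall>y\<in>B. cinner x y = (if x = y then 1 else 0))}"
  have "\<exists>U\<in>\<A>. \<forall>X\<in>\<C>. X \<subseteq> U" if C: "subset.chain \<A> \<C>" for \<C>
  proof (intro bexI[of _ "\<Union>\<C>"])
    have "\<C> \<subseteq> \<A>"
      using C by (auto simp: subset.chain_def)
    moreover have "\<exists>X\<in>\<C>. x \<in> X \<and> y \<in> X" if "x \<in> \<Union>\<C>" "y \<in> \<Union>\<C>" for x y
    proof -
      obtain X Y where XY: "X \<in> \<C>" "x \<in> X" "Y \<in> \<C>" "y \<in> Y"
        using \<open>x \<in> \<Union>\<C>\<close> \<open>y \<in> \<Union>\<C>\<close> by blast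
      then have "X \<subseteq> Y \<or> Y \<subseteq> X"
        using C by (auto simp: subset_chain_def)
      then show ?thesis
        using XY by blast
    qed
    ultimately show "\<Union>\<C> \<in> \<A>"
      unfolding \<A>_def by blast
  qed auto
  then have "\<exists>B\<in>\<A>. \<forall>X\<in>\<A>. B \<subseteq> X \<longrightarrow> X = B"
    by (rule subset_Zorn)
  then obtain B where B: "B \<in> \<A>" "\<And>X. X \<in> \<A> \<Longrightarrow> B \<subseteq> X \<Longrightarrow> X = B"
    by metis
  define K where "K = closure (cspan B)"
  have K: "csubspace K" "closed K"
    by (auto simp: K_def csubspace_closure)
  have "cspan B \<subseteq> H"
    using B(1) H by (intro complex_vector.span_minimal) (auto simp: \<A>_def)
  then have KH: "K \<subseteq> H"
    unfolding K_def using H(2) by (rule closure_minimal)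
  have "H \<subseteq> K"
  proof
    fix x assume x: "x \<in> H"
    define u where "u = x - orth_proj K x"
    show "x \<in> K"
    proof (rule ccontr)
      assume "x \<notin> K"
      then have u0: "u \<noteq> 0"
        using orth_proj_in[OF K, of x] by (auto simp: u_def)
      define v where "v = (1 / norm u) *\<^sub>R u"
      have "u \<in> H"
        unfolding u_def using H(1) x orth_proj_in[OF K] KH by (auto intro: complex_vector.subspace_diff)
      then have "v \<in> H"
        unfolding v_def using H(1) by (auto intro: csubspace_scaleR)
      moreover have vv: "cinner v v = 1"
        using u0 by (simp add: cinner_self v_def)
      moreover have "B \<subseteq> K"
        unfolding K_def using closure_subset complex_vector.span_superset by blast
      then have vb: "cinner v b = 0" if "b \<in> B" for b
        using cinner_orth_proj_diff[OF K, of b x] that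
        by (auto simp: v_def u_def cinner_scaleR_left)
      then have "cinner b v = 0" if "b \<in> B" for b
        using cinner_eq_0_commute that by blast
      ultimately have "insert v B \<in> \<A>"
        using B(1) vb unfolding \<A>_def by auto
      then have "v \<in> B"
        using B(2) by blast
      then show False
        using vb vv by fastforce
    qed
  qed
  then have "is_onb H B"
    using B(1) KH by (auto simp: is_onb_def \<A>_def K_def)
  then show ?thesis ..
qed

lemma has_sum_sum_finite:
  fixes f :: "'i \<Rightarrow> 'b \<Rightarrow> 'c :: topological_comm_monoid_add"
  assumes "\<And>i. i \<in> I \<Longrightarrow> (f i has_sum s i) A"
  shows "((\<lambda>x. \<Sum>i\<in>I. f i x) has_sum (\<Sum>i\<in>I. s i)) A"
  using assms by (induction I rule: infinite_finite_induct) (auto intro: has_sum_add)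

text \<open>By Parseval's identity each rank one summand contributes
  \<open>cinner (v i) (u i)\<close>, whatever basis \<open>op_trace\<close> has chosen.\<close>

lemma op_trace_finite_rank:
  fixes H :: "'a :: chilbert_space set"
  assumes H: "csubspace H" "closed H" and I: "finite I"
    and uv: "\<And>i. i \<in> I \<Longrightarrow> u i \<in> H" "\<And>i. i \<in> I \<Longrightarrow> v i \<in> H"
    and A: "\<And>x. x \<in> H \<Longrightarrow> A x = (\<Sum>i\<in>I. cinner x (u i) *\<^sub>C v i)"
  shows "op_trace H A = (\<Sum>i\<in>I. cinner (v i) (u i))"
proof -
  define B where "B = (SOME B. is_onb H B)"
  have B: "is_onb H B"
    unfolding B_def using onb_exists[OF H] by (rule someI_ex)
  have "((\<lambda>b. \<Sum>i\<in>I. cinner (v i) b * cinner b (u i)) has_sum (\<Sum>i\<in>I. cinner (v i) (u i))) B"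
    using uv by (intro has_sum_sum_finite is_onb_Parseval[OF B])
  moreover have "(\<Sum>i\<in>I. cinner (v i) b * cinner b (u i)) = cinner (A b) b" if "b \<in> B" for b
    using that B by (subst A) (auto simp: is_onb_def cinner_sum_left cinner_scaleC_left mult.commute)
  ultimately have "((\<lambda>b. cinner (A b) b) has_sum (\<Sum>i\<in>I. cinner (v i) (u i))) B"
    by (simp cong: has_sum_cong)
  then show ?thesis
    unfolding op_trace_def B_def[symmetric] by (rule infsumI)
qed

text \<open>Orthonormal vectors are linearly independent, so the basis is finite; its Fourier
  expansion is then a finite sum, which makes \<open>E\<close> an algebraic basis and its size the
  dimension.\<close>

lemma finite_dim_onb:
  assumes "\<exists>B :: ('e :: chilbert_space) set. finite B \<and> cspan B = UNIV"
  obtains E :: "('e :: chilbert_space) set" where "finite E" "card E = cdim (UNIV :: 'e set)" "is_onb UNIV E"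
    "\<And>x. x = (\<Sum>e\<in>E. cinner x e *\<^sub>C e)"
proof -
  obtain E :: "'e set" where E: "is_onb UNIV E"
    using onb_exists[of "UNIV :: 'e set"] by auto
  obtain B :: "'e set" where B: "finite B" "cspan B = UNIV"
    using assms by blast
  have orth: "cinner x y = (if x = y then 1 else 0)" if "x \<in> E" "y \<in> E" for x y
    using E that by (auto simp: is_onb_def)
  have indep: "\<not> cdependent E"
  proof
    assume "cdependent E"
    then obtain a where a: "a \<in> E" "a \<in> cspan (E - {a})"
      by (auto simp: complex_vector.dependent_def)
    have "cspan (E - {a}) \<subseteq> {v. cinner a v = 0}"
      using a(1) orth
      by (intro complex_vector.span_minimal complex_vector.subspaceI)
         (auto simp: cinner_add_right cinner_scaleC_right)
    then have "cinner a a = 0"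
      using a(2) by blast
    then show False
      using orth a(1) by auto
  qed
  have fin: "finite E"
    using complex_vector.independent_span_bound[OF B(1) indep] B(2) by auto
  have ex: "x = (\<Sum>e\<in>E. cinner x e *\<^sub>C e)" for x
    using is_onb_has_sum[OF E, of x] fin by (simp add: has_sum_finite_iff)
  have "x \<in> cspan E" for x
    by (subst ex) (intro complex_vector.span_sum complex_vector.span_scale complex_vector.span_base)
  then have "cspan E = cspan UNIV"
    by auto
  then have "cdim (UNIV :: 'e set) = card E"
    using indep by (rule complex_vector.dim_eq_card)
  then show ?thesis
    using that[OF fin _ E ex] by simp
qed

section \<open>Square roots of positive operators\<close>

text \<open>The Taylor coefficients of \<open>sqrt (1 - x)\<close>. They are absolutely summable, so the series
  converges at every contraction \<open>1 - A\<close>, and its value there is the square root of \<open>A\<close>.\<close>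

definition sqrt_coeff :: "nat \<Rightarrow> real"
  where "sqrt_coeff n = ((1/2) gchoose n) * (- 1) ^ n"

lemma sqrt_coeff_0 [simp]: "sqrt_coeff 0 = 1"
  by (simp add: sqrt_coeff_def)

text \<open>These are the Taylor coefficients of \<open>(1 - x)^(-1/2)\<close>; passing from
  \<open>n\<close> to \<open>n + 1\<close> multiplies by \<open>(1/2 + n) / (n + 1)\<close>. They
  control both the signs and the partial sums of \<open>sqrt_coeff\<close>.\<close>

lemma gbinomial_neg_half_nonneg: "0 \<le> (- 1) ^ n * ((- 1/2 :: real) gchoose n)"
proof (induction n)
  case (Suc n)
  have "(- 1/2 :: real) gchoose Suc n = ((- 1/2) gchoose n) * - ((1/2 + real n) / real (Suc n))"
    using gbinomial_absorb_comp[of "- 1/2 :: real" n] gbinomial_absorption[of n "- 1/2 :: real"]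
    by (simp add: field_simps)
  then have "(- 1) ^ Suc n * ((- 1/2 :: real) gchoose Suc n)
      = ((- 1) ^ n * ((- 1/2) gchoose n)) * ((1/2 + real n) / real (Suc n))"
    by (simp only:) simp
  then show ?case
    using Suc by simp
qed simp

text \<open>The derivative of \<open>sqrt (1 - x)\<close> is \<open>-1/2 (1 - x)^(-1/2)\<close>,
  read coefficientwise.\<close>

lemma sqrt_coeff_Suc_nonpos: "sqrt_coeff (Suc n) \<le> 0"
proof -
  have "((1/2 :: real) gchoose Suc n) * real (Suc n) = (1/2) * ((- 1/2) gchoose n)"
    using gbinomial_absorption[of n "1/2 :: real"] by (simp add: mult.commute)
  moreover have "sqrt_coeff (Suc n) * real (Suc n) = - ((- 1) ^ n * (((1/2 :: real) gchoose Suc n) * real (Suc n)))"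
    by (simp only: sqrt_coeff_def power_Suc) (simp only: mult_ac mult_minus_left mult_1_left)
  ultimately have "sqrt_coeff (Suc n) * real (Suc n) = - ((- 1) ^ n * ((1/2) * ((- 1/2) gchoose n)))"
    by (simp only:)
  also have "\<dots> = - (1/2) * ((- 1) ^ n * ((- 1/2) gchoose n))"
    by simp
  also have "\<dots> \<le> 0"
    using gbinomial_neg_half_nonneg[of n] by simp
  finally show ?thesis
    by (simp add: mult_le_0_iff)
qed

text \<open>Partial sums are the coefficients of
  \<open>sqrt (1 - x) / (1 - x) = (1 - x)^(-1/2)\<close>.\<close>

lemma sum_sqrt_coeff_nonneg: "0 \<le> (\<Sum>i\<le>n. sqrt_coeff i)"
  unfolding sqrt_coeff_def gbinomial_sum_lower_neg using gbinomial_neg_half_nonneg[of n] by simp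

text \<open>All coefficients but the first, which is 1, are at most 0, so their absolute sum is 1
  minus a nonnegative partial sum. The bound 1, and not just finiteness, makes the square root
  positive.\<close>

lemma sum_abs_sqrt_coeff_Suc_le: "finite F \<Longrightarrow> (\<Sum>i\<in>F. \<bar>sqrt_coeff (Suc i)\<bar>) \<le> 1"
proof -
  assume "finite F"
  then obtain n where n: "F \<subseteq> {..<n}"
    using finite_nat_iff_bounded by blast
  have "(\<Sum>i\<in>F. \<bar>sqrt_coeff (Suc i)\<bar>) \<le> (\<Sum>i<n. \<bar>sqrt_coeff (Suc i)\<bar>)"
    using n by (intro sum_mono2) auto
  also have "\<dots> = - (\<Sum>i<n. sqrt_coeff (Suc i))"
    by (simp add: sum_negf abs_of_nonpos sqrt_coeff_Suc_nonpos)
  also have "\<dots> = 1 - (\<Sum>i\<le>n. sqrt_coeff i)"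
    by (simp add: sum.atMost_shift)
  also have "\<dots> \<le> 1"
    using sum_sqrt_coeff_nonneg[of n] by simp
  finally show ?thesis .
qed

lemma summable_abs_sqrt_coeff_Suc: "(\<lambda>n. \<bar>sqrt_coeff (Suc n)\<bar>) summable_on UNIV"
  by (rule nonneg_bdd_above_summable_on)
     (auto intro!: bdd_aboveI2[where M = 1] sum_abs_sqrt_coeff_Suc_le)

lemma infsum_abs_sqrt_coeff_Suc_le: "(\<Sum>\<^sub>\<infinity>n. \<bar>sqrt_coeff (Suc n)\<bar>) \<le> 1"
  by (rule infsum_le_finite_sums[OF summable_abs_sqrt_coeff_Suc]) (auto intro: sum_abs_sqrt_coeff_Suc_le)

lemma summable_abs_sqrt_coeff: "(\<lambda>n. \<bar>sqrt_coeff n\<bar>) summable_on UNIV"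
proof -
  have "(\<lambda>n. \<bar>sqrt_coeff n\<bar>) summable_on range Suc"
    using summable_abs_sqrt_coeff_Suc by (subst summable_on_reindex) (simp_all add: o_def)
  then have "(\<lambda>n. \<bar>sqrt_coeff n\<bar>) summable_on insert 0 (range Suc)"
    by (simp add: summable_on_insert_iff)
  then show ?thesis
    by (metis UNIV_nat_eq)
qed

text \<open>Vandermonde's identity for \<open>1/2 + 1/2 = 1\<close>: the Cauchy square of the series
  is the polynomial \<open>1 - x\<close>.\<close>

lemma sqrt_coeff_convolution:
  "(\<Sum>i\<le>n. sqrt_coeff i * sqrt_coeff (n - i)) = (if n = 0 then 1 else if n = 1 then - 1 else 0)"
proof -
  have "(\<Sum>i\<le>n. sqrt_coeff i * sqrt_coeff (n - i))
      = (- 1) ^ n * (\<Sum>i\<in>{0..n}. ((1/2 :: real) gchoose i) * ((1/2) gchoose (n - i)))"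
    unfolding sum_distrib_left atLeast0AtMost
    by (intro sum.cong) (auto simp: sqrt_coeff_def algebra_simps simp flip: power_add)
  also have "\<dots> = (- 1) ^ n * (1 gchoose n)"
    by (subst gbinomial_Vandermonde) simp
  also have "(1 :: real) gchoose n = of_nat (1 choose n)"
    by (simp add: binomial_gbinomial)
  finally show ?thesis
    by (cases n rule: nat.exhaust; cases "n - 1") auto
qed

context
  fixes B :: "'a :: chilbert_space \<Rightarrow> 'a"
  assumes lin: "bounded_linear B" and contr: "\<And>x. norm (B x) \<le> norm x"
begin

definition sqrt_series :: "'a \<Rightarrow> 'a"
  where "sqrt_series x = (\<Sum>\<^sub>\<infinity>n. sqrt_coeff n *\<^sub>R (B ^^ n) x)"

lemma norm_funpow_le: "norm ((B ^^ n) x) \<le> norm x"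
  by (induction n) (auto intro: order.trans[OF contr])

lemma bounded_linear_funpow: "bounded_linear (B ^^ n)"
  by (induction n) (auto simp: bounded_linear_ident id_def o_def intro: bounded_linear_compose[OF lin])

lemma abs_summable_sqrt_series: "(\<lambda>n. norm (sqrt_coeff n *\<^sub>R (B ^^ n) x)) summable_on UNIV"
  by (rule Infinite_Sum.abs_summable_on_comparison_test'[OF summable_on_cmult_left[OF summable_abs_sqrt_coeff, of "norm x"]])
     (auto intro: mult_left_mono norm_funpow_le)

lemma has_sum_sqrt_series: "((\<lambda>n. sqrt_coeff n *\<^sub>R (B ^^ n) x) has_sum sqrt_series x) UNIV"
  unfolding sqrt_series_def
  by (rule has_sum_infsum[OF Infinite_Sum.abs_summable_summable[OF abs_summable_sqrt_series]])

text \<open>The double series over \<open>(n, m)\<close> is dominated by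
  \<open>|c_n| |c_m| norm x\<close> with \<open>c = sqrt_coeff\<close>, hence absolutely convergent.
  Summed by rows it is the iterated series; summed along \<open>n + m = N\<close> it collapses by
  \<open>sqrt_coeff_convolution\<close>.\<close>

lemma sqrt_series_sqrt_series: "sqrt_series (sqrt_series x) = x - B x"
proof -
  define f where "f = (\<lambda>(n, m). (sqrt_coeff n * sqrt_coeff m) *\<^sub>R (B ^^ (n + m)) x)"
  have "(\<lambda>p. norm (case p of (n, m) \<Rightarrow> (sqrt_coeff n * sqrt_coeff m) * norm x)) summable_on UNIV \<times> UNIV"
    unfolding Infinite_Sum.abs_summable_on_Sigma_iff
  proof (intro conjI ballI)
    fix n show "(\<lambda>m. norm (case (n, m) of (n, m) \<Rightarrow> sqrt_coeff n * sqrt_coeff m * norm x)) summable_on UNIV"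
      by (auto simp: abs_mult intro!: summable_on_cmult_left summable_on_cmult_right summable_abs_sqrt_coeff)
  next
    have "(\<Sum>\<^sub>\<infinity>m. norm (case (n, m) of (n, m) \<Rightarrow> sqrt_coeff n * sqrt_coeff m * norm x))
        = \<bar>sqrt_coeff n\<bar> * (\<Sum>\<^sub>\<infinity>m. \<bar>sqrt_coeff m\<bar>) * norm x" for n
      by (simp add: abs_mult infsum_cmult_left' infsum_cmult_right')
    then show "(\<lambda>n. norm (\<Sum>\<^sub>\<infinity>m. norm (case (n, m) of (n, m) \<Rightarrow> sqrt_coeff n * sqrt_coeff m * norm x)))
        summable_on UNIV"
      by (auto simp: abs_mult intro!: summable_on_cmult_left summable_abs_sqrt_coeff)
  qed
  then have "(\<lambda>p. norm (f p)) summable_on UNIV \<times> UNIV"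
    by (rule Infinite_Sum.abs_summable_on_comparison_test)
       (auto simp: f_def abs_mult intro!: mult_left_mono norm_funpow_le)
  then have "f summable_on UNIV \<times> UNIV"
    by (rule Infinite_Sum.abs_summable_summable)
  then obtain S where S: "(f has_sum S) (UNIV \<times> UNIV)"
    by (auto simp: summable_on_def)
  have inner: "((\<lambda>m. f (n, m)) has_sum sqrt_coeff n *\<^sub>R (B ^^ n) (sqrt_series x)) UNIV" for n
  proof -
    have "((\<lambda>m. sqrt_coeff n *\<^sub>R (B ^^ n) (sqrt_coeff m *\<^sub>R (B ^^ m) x)) has_sum
        sqrt_coeff n *\<^sub>R (B ^^ n) (sqrt_series x)) UNIV"
      by (intro has_sum_scaleR has_sum_bounded_linear[OF bounded_linear_funpow] has_sum_sqrt_series)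
    then show ?thesis
      by (simp add: f_def funpow_add linear_simps[OF bounded_linear_funpow])
  qed
  have "((\<lambda>n. sqrt_coeff n *\<^sub>R (B ^^ n) (sqrt_series x)) has_sum S) UNIV"
    using has_sum_SigmaD[OF S inner] .
  then have 1: "sqrt_series (sqrt_series x) = S"
    using has_sum_sqrt_series has_sum_unique by blast
  have "((\<lambda>(N, n). f (n, N - n)) has_sum S) (SIGMA N:UNIV. {..N})"
    using S by (subst has_sum_reindex_bij_witness[where i = "\<lambda>(n, m). (n + m, n)" and
          j = "\<lambda>(N, n). (n, N - n)" and T = "UNIV \<times> UNIV" and h = f]) auto
  then have "((\<lambda>N. \<Sum>n\<le>N. f (n, N - n)) has_sum S) UNIV"
    by (rule has_sum_SigmaD) auto
  moreover have "(\<Sum>n\<le>N. f (n, N - n)) = (if N = 0 then 1 else if N = 1 then - 1 else 0) *\<^sub>R (B ^^ N) x" for N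
    unfolding sqrt_coeff_convolution[symmetric] scaleR_left.sum
    by (intro sum.cong) (auto simp: f_def)
  ultimately have "((\<lambda>N. (if N = 0 then 1 else if N = 1 then - 1 else 0) *\<^sub>R (B ^^ N) x) has_sum S) UNIV"
    by simp
  moreover have "((\<lambda>N. (if N = 0 then 1 else if N = 1 then - 1 else 0 :: real) *\<^sub>R (B ^^ N) x) has_sum (x - B x)) UNIV"
    by (rule has_sum_finite_neutralI[where B = "{0, 1}"]) auto
  ultimately show ?thesis
    using 1 has_sum_unique by blast
qed

lemma bounded_linear_sqrt_series: "bounded_linear sqrt_series"
proof (rule bounded_linear_intro[where K = "\<Sum>\<^sub>\<infinity>n. \<bar>sqrt_coeff n\<bar>"])
  show "sqrt_series (x + y) = sqrt_series x + sqrt_series y" for x y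
  proof (rule has_sum_unique[OF has_sum_sqrt_series])
    show "((\<lambda>n. sqrt_coeff n *\<^sub>R (B ^^ n) (x + y)) has_sum (sqrt_series x + sqrt_series y)) UNIV"
      using has_sum_add[OF has_sum_sqrt_series[of x] has_sum_sqrt_series[of y]]
      by (simp add: linear_simps[OF bounded_linear_funpow] scaleR_add_right)
  qed
  show "sqrt_series (r *\<^sub>R x) = r *\<^sub>R sqrt_series x" for r x
  proof (rule has_sum_unique[OF has_sum_sqrt_series])
    show "((\<lambda>n. sqrt_coeff n *\<^sub>R (B ^^ n) (r *\<^sub>R x)) has_sum (r *\<^sub>R sqrt_series x)) UNIV"
      using has_sum_scaleR[OF has_sum_sqrt_series[of x], of r]
      by (simp add: linear_simps[OF bounded_linear_funpow] mult.commute)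
  qed
  show "norm (sqrt_series x) \<le> norm x * (\<Sum>\<^sub>\<infinity>n. \<bar>sqrt_coeff n\<bar>)" for x
  proof -
    have "norm (sqrt_series x) \<le> (\<Sum>\<^sub>\<infinity>n. \<bar>sqrt_coeff n\<bar> * norm x)"
    proof (rule norm_infsum_le[OF has_sum_sqrt_series has_sum_infsum])
      show "(\<lambda>n. \<bar>sqrt_coeff n\<bar> * norm x) summable_on UNIV"
        by (intro summable_on_cmult_left summable_abs_sqrt_coeff)
    qed (auto intro: mult_left_mono norm_funpow_le)
    then show ?thesis
      by (simp only: infsum_cmult_left' mult.commute[of "norm x"])
  qed
qed

end

text \<open>\<open>A\<close> matters on \<open>H\<close> only, while the series needs an operator on
  the whole type. Composing \<open>A\<close> with the projection to \<open>H\<close> gives such an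
  extension \<open>B\<close> of \<open>1 - A\<close>, which preserves \<open>H\<close> and is still
  a contraction.\<close>

lemma op_sqrt_exists:
  fixes H :: "'a :: chilbert_space set"
  assumes H: "csubspace H" "closed H" and A: "bounded_op_on H A"
    and sym: "\<And>x y. x \<in> H \<Longrightarrow> y \<in> H \<Longrightarrow> cinner (A x) y = cinner x (A y)"
    and contr: "\<And>x. x \<in> H \<Longrightarrow> norm (x - A x) \<le> norm x"
  shows "\<exists>R. bounded_op_on H R \<and> positive_on H R \<and> (\<forall>x\<in>H. R (R x) = A x)"
proof -
  define B where "B x = x - A (orth_proj H x)" for x
  note P = orth_proj_in[OF H]
  have A_in: "A x \<in> H" if "x \<in> H" for x
    using A that by (auto simp: bounded_op_on_def)
  have Badd: "B (x + y) = B x + B y" for x y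
    using A P by (simp add: B_def orth_proj_add[OF H] bounded_op_on_def)
  have BscaleC: "B (c *\<^sub>C x) = c *\<^sub>C B x" for c x
    using A P by (simp add: B_def orth_proj_scaleC[OF H] bounded_op_on_def
        complex_vector.scale_right_diff_distrib)
  \<comment> \<open>\<open>B x\<close> is the sum of \<open>x - p\<close>, orthogonal to
    \<open>H\<close>, and of \<open>p - A p\<close> in \<open>H\<close>.\<close>
  have Bcontr: "norm (B x) \<le> norm x" for x
  proof (rule power2_le_imp_le)
    define p where "p = orth_proj H x"
    have pA: "p - A p \<in> H"
      using P A_in H by (simp add: p_def complex_vector.subspace_diff)
    then have "inner (x - p) (p - A p) = 0"
      using cinner_orth_proj_diff[OF H] by (simp add: p_def inner_eq_Re_cinner)
    then have "(norm (B x))\<^sup>2 = (norm (x - p))\<^sup>2 + (norm (p - A p))\<^sup>2"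
      using norm_add_Pythagorean[of "x - p" "p - A p"] by (simp add: B_def p_def orthogonal_def)
    also have "\<dots> \<le> (norm (x - p))\<^sup>2 + (norm p)\<^sup>2"
      using contr P by (intro add_left_mono power_mono) (auto simp: p_def)
    also have "\<dots> = (norm x)\<^sup>2"
      using power2_norm_orth_proj[OF H, of x] by (simp add: p_def)
    finally show "(norm (B x))\<^sup>2 \<le> (norm x)\<^sup>2" .
  qed simp
  have Blin: "bounded_linear B"
    by (rule bounded_linear_intro[where K = 1]) (use Badd BscaleC Bcontr in \<open>auto simp: scaleR_scaleC\<close>)
  note [simp] = orth_proj_same[OF H]
  have BH: "B x \<in> H" if "x \<in> H" for x
    using that A_in H by (simp add: B_def complex_vector.subspace_diff)
  then have BnH: "(B ^^ n) x \<in> H" if "x \<in> H" for n x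
    using that by (induction n) auto
  have Bsym: "cinner (B x) y = cinner x (B y)" if "x \<in> H" "y \<in> H" for x y
    using that by (simp add: B_def cinner_diff_left cinner_diff_right sym)
  have Bnsym: "cinner ((B ^^ n) x) y = cinner x ((B ^^ n) y)" if "x \<in> H" "y \<in> H" for n x y
    using that(2)
  proof (induction n arbitrary: y)
    case (Suc n)
    have "cinner ((B ^^ Suc n) x) y = cinner x ((B ^^ n) (B y))"
      using Suc that(1) by (simp add: Bsym BnH BH)
    then show ?case
      by (simp add: funpow_swap1)
  qed simp
  define R where "R = sqrt_series B"
  note hs = has_sum_sqrt_series[OF Blin Bcontr, folded R_def]
  have Rlin: "bounded_linear R"
    unfolding R_def by (rule bounded_linear_sqrt_series[OF Blin Bcontr])
  have BnC: "(B ^^ n) (c *\<^sub>C x) = c *\<^sub>C (B ^^ n) x" for n c x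
    by (induction n) (auto simp: BscaleC)
  have RscaleC: "R (c *\<^sub>C x) = c *\<^sub>C R x" for c x
  proof -
    have "((\<lambda>n. c *\<^sub>C sqrt_coeff n *\<^sub>R (B ^^ n) x) has_sum c *\<^sub>C R x) UNIV"
      using hs by (rule has_sum_bounded_linear[OF bounded_linear_scaleC])
    moreover have "c *\<^sub>C sqrt_coeff n *\<^sub>R (B ^^ n) x = sqrt_coeff n *\<^sub>R (B ^^ n) (c *\<^sub>C x)" for n
      by (simp add: BnC scaleR_scaleC scaleC_scaleC mult.commute)
    ultimately have "((\<lambda>n. sqrt_coeff n *\<^sub>R (B ^^ n) (c *\<^sub>C x)) has_sum c *\<^sub>C R x) UNIV"
      by simp
    then show ?thesis
      using hs has_sum_unique by blast
  qed
  have RH: "R x \<in> H" if x: "x \<in> H" for x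
  proof (rule Lim_in_closed_set[OF H(2)])
    show "(sum (\<lambda>n. sqrt_coeff n *\<^sub>R (B ^^ n) x) \<longlongrightarrow> R x) (finite_subsets_at_top UNIV)"
      using hs by (simp add: has_sum_def)
    show "\<forall>\<^sub>F F in finite_subsets_at_top UNIV. (\<Sum>n\<in>F. sqrt_coeff n *\<^sub>R (B ^^ n) x) \<in> H"
      using H BnH[OF x] by (intro always_eventually allI complex_vector.subspace_sum csubspace_scaleR) auto
  qed simp
  have pos: "cinner (R x) x \<in> \<real>\<^sub>\<ge>\<^sub>0" if x: "x \<in> H" for x
  proof -
    have real: "cinner ((B ^^ n) x) x = complex_of_real (inner ((B ^^ n) x) x)" for n
      using cinner_commute[of "(B ^^ n) x" x] Bnsym[OF x x, of n]
      by (auto simp: complex_eq_iff inner_eq_Re_cinner)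
    have Rhs: "((\<lambda>n. sqrt_coeff n * inner ((B ^^ n) x) x) has_sum inner (R x) x) UNIV"
      using has_sum_bounded_linear[OF bounded_linear_inner_left hs[of x], of x] by simp
    have Chs: "((\<lambda>n. complex_of_real (sqrt_coeff n * inner ((B ^^ n) x) x)) has_sum cinner (R x) x) UNIV"
      using has_sum_bounded_linear[OF bounded_linear_cinner_left hs[of x], of x]
      by (simp add: cinner_scaleR_left real)
    have eq: "cinner (R x) x = complex_of_real (inner (R x) x)"
      using has_sum_unique[OF Chs has_sum_of_real[OF Rhs]] .
    \<comment> \<open>The term for \<open>n = 0\<close> is \<open>(norm x)\<^sup>2\<close>. The
      others sum to at most that in absolute value, as their coefficients have absolute sum at most
      1; so the total is nonnegative.\<close>
    have "((\<lambda>n. sqrt_coeff n * inner ((B ^^ n) x) x) has_sum (inner (R x) x - (norm x)\<^sup>2)) (UNIV - {0})"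
      using has_sum_Diff[OF Rhs, of "{0}" "(norm x)\<^sup>2"] by (simp add: has_sum_finite_iff power2_norm_eq_inner)
    moreover have "UNIV - {0} = range Suc"
      by (auto simp: image_iff) (metis not0_implies_Suc)
    ultimately have "((\<lambda>n. sqrt_coeff (Suc n) * inner ((B ^^ Suc n) x) x) has_sum
        (inner (R x) x - (norm x)\<^sup>2)) UNIV"
      by (simp add: has_sum_reindex o_def)
    moreover have "((\<lambda>n. \<bar>sqrt_coeff (Suc n)\<bar> * (norm x)\<^sup>2) has_sum
        ((\<Sum>\<^sub>\<infinity>n. \<bar>sqrt_coeff (Suc n)\<bar>) * (norm x)\<^sup>2)) UNIV"
      by (intro has_sum_cmult_left has_sum_infsum summable_abs_sqrt_coeff_Suc)
    moreover have "norm (sqrt_coeff (Suc n) * inner ((B ^^ Suc n) x) x) \<le> \<bar>sqrt_coeff (Suc n)\<bar> * (norm x)\<^sup>2" for n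
    proof -
      have "\<bar>inner ((B ^^ Suc n) x) x\<bar> \<le> norm ((B ^^ Suc n) x) * norm x"
        by (rule Cauchy_Schwarz_ineq2)
      also have "\<dots> \<le> norm x * norm x"
        by (intro mult_right_mono norm_funpow_le[OF Blin Bcontr]) auto
      finally show ?thesis
        by (auto simp: abs_mult power2_eq_square intro!: mult_left_mono)
    qed
    ultimately have "norm (inner (R x) x - (norm x)\<^sup>2) \<le> (\<Sum>\<^sub>\<infinity>n. \<bar>sqrt_coeff (Suc n)\<bar>) * (norm x)\<^sup>2"
      by (rule norm_infsum_le)
    also have "\<dots> \<le> 1 * (norm x)\<^sup>2"
      by (intro mult_right_mono infsum_abs_sqrt_coeff_Suc_le) auto
    finally have "0 \<le> inner (R x) x"
      by simp
    then show ?thesis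
      by (simp add: eq)
  qed
  have "R (R x) = A x" if "x \<in> H" for x
  proof -
    have "R (R x) = x - B x"
      unfolding R_def by (rule sqrt_series_sqrt_series[OF Blin Bcontr])
    then show ?thesis
      using that by (simp add: B_def)
  qed
  moreover have "bounded_op_on H R"
    unfolding bounded_op_on_def
    using RH RscaleC bounded_linear.bounded[OF Rlin] by (auto simp: linear_simps[OF Rlin] mult.commute)
  ultimately show ?thesis
    using pos by (auto simp: positive_on_def)
qed

section \<open>Square-summable families\<close>

text \<open>The coordinate projection for \<open>A\<close>. It agrees with
  \<open>orth_proj (ell2_on A V)\<close> on families whose coefficients over \<open>A\<close> lie in
  \<open>V\<close>, and so replaces all degree projections.\<close>

lift_definition restr :: "'i set \<Rightarrow> ('i, 'a :: complex_inner) ell2 \<Rightarrow> ('i, 'a) ell2"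
  is "\<lambda>A f w. if w \<in> A then f w else 0"
  by (erule summable_on_comparison_test) auto

lemma ell2_on_UNIV_eq: "ell2_on A UNIV = {f. \<forall>w. w \<notin> A \<longrightarrow> coord f w = 0}"
  by (auto simp: ell2_on_def)

lemma bounded_linear_coord: "bounded_linear (\<lambda>f :: ('i, 'a :: complex_inner) ell2. coord f w)"
  by (rule bounded_linear_intro[where K = 1])
     (simp_all add: plus_ell2.rep_eq scaleR_ell2.rep_eq norm_coord_le)

lemma closed_ell2_on_UNIV: "closed (ell2_on A UNIV :: ('i, 'a :: complex_inner) ell2 set)"
  unfolding ell2_on_UNIV_eq Collect_all_eq Collect_imp_eq
proof (intro closed_INT ballI)
  fix w :: 'i
  have "closed {f :: ('i, 'a) ell2. coord f w = 0}"
    by (intro closed_Collect_eq linear_continuous_on bounded_linear_coord continuous_on_const)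
  then show "closed (- {f :: ('i, 'a) ell2. w \<notin> A} \<union> {f. coord f w = 0})"
    by (cases "w \<in> A") auto
qed

lemma coord_sum: "coord (\<Sum>i\<in>I. f i) w = (\<Sum>i\<in>I. coord (f i) w)"
  by (induction I rule: infinite_finite_induct) (simp_all add: zero_ell2.rep_eq plus_ell2.rep_eq)

lemma cinner_restr_left: "cinner (restr A f) g = (\<Sum>\<^sub>\<infinity>w\<in>A. cinner (coord f w) (coord g w))"
  unfolding cinner_ell2_def by (rule infsum_cong_neutral) (auto simp: restr.rep_eq)

lemma cinner_restr_right: "cinner f (restr A g) = (\<Sum>\<^sub>\<infinity>w\<in>A. cinner (coord f w) (coord g w))"
  unfolding cinner_ell2_def by (rule infsum_cong_neutral) (auto simp: restr.rep_eq)

lemma orth_proj_ell2_on: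
  assumes "csubspace V" "\<And>w. w \<in> A \<Longrightarrow> coord f w \<in> V"
  shows "orth_proj (ell2_on A V) f = restr A f"
proof (rule orth_proj_eqI[OF csubspace_ell2_on[OF assms(1)]])
  show "restr A f \<in> ell2_on A V"
    using assms by (auto simp: ell2_on_def restr.rep_eq)
  fix z assume "z \<in> ell2_on A V"
  then show "cinner (f - restr A f) z = 0"
    by (auto simp: cinner_ell2_def ell2_on_def restr.rep_eq minus_ell2.rep_eq intro!: infsum_0)
qed

lemma restr_finite: "finite A \<Longrightarrow> restr A f = (\<Sum>w\<in>A. etensor w (coord f w))"
  by (rule ell2_eqI) (simp add: restr.rep_eq coord_sum etensor.rep_eq if_distrib cong: if_cong)

lemma etensor_add: "etensor w (x + y) = etensor w x + etensor w y"
  by (rule ell2_eqI) (simp add: etensor.rep_eq plus_ell2.rep_eq)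

lemma etensor_scaleC: "etensor w (c *\<^sub>C x) = c *\<^sub>C etensor w x"
  by (rule ell2_eqI) (simp add: etensor.rep_eq scaleC_ell2.rep_eq)

lemma etensor_zero: "etensor w 0 = 0"
  by (rule ell2_eqI) (simp add: etensor.rep_eq zero_ell2.rep_eq)

lemma etensor_sum: "etensor w (\<Sum>i\<in>I. f i) = (\<Sum>i\<in>I. etensor w (f i))"
  by (induction I rule: infinite_finite_induct) (simp_all add: etensor_zero etensor_add)

lemma restr_singleton: "restr {w} f = etensor w (coord f w)"
  by (simp add: restr_finite)

lemma cinner_etensor_left: "cinner (etensor w x) f = cinner x (coord f w)"
proof -
  have "cinner (etensor w x) f = cinner (restr {w} (etensor w x)) f"
    by (simp add: restr_singleton etensor.rep_eq)
  then show ?thesis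
    by (simp add: cinner_restr_left etensor.rep_eq)
qed

lemma cinner_etensor_right: "cinner f (etensor w x) = cinner (coord f w) x"
  by (metis cinner_commute cinner_etensor_left)

lemma norm_etensor: "norm (etensor w x) = norm x"
proof -
  have "complex_of_real ((norm (etensor w x))\<^sup>2) = complex_of_real ((norm x)\<^sup>2)"
    by (simp only: cinner_self[symmetric] cinner_etensor) simp
  then show ?thesis
    by (simp only: of_real_eq_iff power2_eq_iff_nonneg norm_ge_zero)
qed

text \<open>A finite coordinate projection as a sum of rank one operators, the form in which traces
  are evaluated.\<close>

lemma restr_onb:
  fixes f :: "('i, 'e :: complex_inner) ell2"
  assumes "finite A" "finite E" "\<And>x :: 'e. x = (\<Sum>e\<in>E. cinner x e *\<^sub>C e)"
  shows "restr A f = (\<Sum>(w, e)\<in>A \<times> E. cinner f (etensor w e) *\<^sub>C etensor w e)"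
proof -
  have "restr A f = (\<Sum>w\<in>A. etensor w (\<Sum>e\<in>E. cinner (coord f w) e *\<^sub>C e))"
    by (simp add: restr_finite[OF assms(1)] assms(3)[symmetric])
  also have "\<dots> = (\<Sum>w\<in>A. \<Sum>e\<in>E. cinner f (etensor w e) *\<^sub>C etensor w e)"
    by (simp add: etensor_sum etensor_scaleC cinner_etensor_right)
  finally show ?thesis
    by (simp add: sum.cartesian_product)
qed

text \<open>The error of the partial sum over \<open>Y\<close> is \<open>restr (A - Y) f\<close>,
  and its squared norm is a tail of a convergent series. The sum in the Berezin kernel is of this
  kind.\<close>

lemma has_sum_etensor: "((\<lambda>w. etensor w (coord f w)) has_sum restr A f) A"
  unfolding has_sum_def tendsto_iff eventually_finite_subsets_at_top
proof (intro allI impI)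
  fix e :: real assume e: "0 < e"
  have s: "(\<lambda>w. (norm (coord f w))\<^sup>2) summable_on A"
    by (rule summable_on_subset_banach[OF coord_summable subset_UNIV])
  define S where "S = (\<Sum>\<^sub>\<infinity>w\<in>A. (norm (coord f w))\<^sup>2)"
  have "((\<lambda>w. (norm (coord f w))\<^sup>2) has_sum S) A"
    unfolding S_def using s by (rule has_sum_infsum)
  then obtain X where X: "finite X" "X \<subseteq> A"
    "\<And>Y. finite Y \<Longrightarrow> X \<subseteq> Y \<Longrightarrow> Y \<subseteq> A \<Longrightarrow> dist (\<Sum>w\<in>Y. (norm (coord f w))\<^sup>2) S < e\<^sup>2"
    using e unfolding has_sum_def tendsto_iff eventually_finite_subsets_at_top
    by (metis zero_less_power)
  show "\<exists>X. finite X \<and> X \<subseteq> A \<and> (\<forall>Y. finite Y \<and> X \<subseteq> Y \<and> Y \<subseteq> A \<longrightarrow>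
      dist (\<Sum>w\<in>Y. etensor w (coord f w)) (restr A f) < e)"
  proof (intro exI[of _ X] conjI allI impI X(1,2))
    fix Y assume Y: "finite Y \<and> X \<subseteq> Y \<and> Y \<subseteq> A"
    have "(norm (restr A f - restr Y f))\<^sup>2 = (\<Sum>\<^sub>\<infinity>w\<in>A - Y. (norm (coord f w))\<^sup>2)"
      unfolding power2_norm_ell2 using Y
      by (intro infsum_cong_neutral) (auto simp: restr.rep_eq minus_ell2.rep_eq)
    also have "\<dots> = S - (\<Sum>w\<in>Y. (norm (coord f w))\<^sup>2)"
      unfolding S_def using Y s by (subst infsum_Diff) auto
    also have "\<dots> < e\<^sup>2"
      using X(3)[of Y] Y by (auto simp: dist_real_def)
    finally have "norm (restr A f - restr Y f) < e"
      using e by (auto dest: power_less_imp_less_base)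
    then show "dist (\<Sum>w\<in>Y. etensor w (coord f w)) (restr A f) < e"
      using Y by (simp add: restr_finite dist_norm norm_minus_commute)
  qed
qed

section \<open>Creation and annihilation operators\<close>

text \<open>The adjoint of the product of the creation operators with the letters of \<open>\<alpha>\<close> in position \<open>i\<close>.\<close>

lift_definition annihilation :: "nat \<Rightarrow> nat list \<Rightarrow> (nat list list, 'a :: complex_inner) ell2 \<Rightarrow> (nat list list, 'a) ell2"
  is "\<lambda>i \<alpha> f w. if i < length w then f (w[i := \<alpha> @ w ! i]) else 0"
proof -
  fix i :: nat and \<alpha> :: "nat list" and f :: "nat list list \<Rightarrow> 'a"
  assume f: "(\<lambda>w. (norm (f w))\<^sup>2) summable_on UNIV"
  define A where "A = {w :: nat list list. i < length w}"
  define h where "h = (\<lambda>w :: nat list list. w[i := \<alpha> @ w ! i])"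
  have "inj_on h A"
    by (rule inj_on_inverseI[where g = "\<lambda>v. v[i := drop (length \<alpha>) (v ! i)]"]) (auto simp: A_def h_def)
  then have "(\<lambda>w. (norm (f (h w)))\<^sup>2) summable_on A"
    using summable_on_reindex[of h A "\<lambda>w. (norm (f w))\<^sup>2"] summable_on_subset_banach[OF f, of "h ` A"]
    by (simp add: o_def)
  then show "(\<lambda>w. (norm (if i < length w then f (w[i := \<alpha> @ w ! i]) else 0))\<^sup>2) summable_on UNIV"
    by (rule summable_on_cong_neutral[THEN iffD1, rotated -1]) (auto simp: A_def h_def)
qed

lemma creation_add: "creation i j (f + g) = creation i j f + creation i j g"
  by (rule ell2_eqI) (simp add: creation.rep_eq plus_ell2.rep_eq)

lemma creation_scaleC: "creation i j (c *\<^sub>C f) = c *\<^sub>C creation i j f"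
  by (rule ell2_eqI) (simp add: creation.rep_eq scaleC_ell2.rep_eq)

text \<open>Prepending \<open>j\<close> in position \<open>i\<close> maps the multi-indices that
  have such a position bijectively onto those whose word there begins with \<open>j\<close>; the sum
  is reindexed along this map.\<close>

lemma cinner_creation_left: "cinner (creation i j f) g = cinner f (annihilation i [j] g)"
proof -
  define A where "A = {w :: nat list list. i < length w}"
  define h where "h = (\<lambda>w :: nat list list. w[i := j # w ! i])"
  have inj: "inj_on h A"
    by (rule inj_on_inverseI[where g = "\<lambda>v. v[i := tl (v ! i)]"]) (auto simp: A_def h_def)
  have im: "h ` A = {w. i < length w \<and> w ! i \<noteq> [] \<and> hd (w ! i) = j}"
  proof (intro equalityI subsetI)
    fix w assume "w \<in> {w. i < length w \<and> w ! i \<noteq> [] \<and> hd (w ! i) = j}"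
    then show "w \<in> h ` A"
      by (intro image_eqI[of _ _ "w[i := tl (w ! i)]"]) (auto simp: A_def h_def)
  qed (auto simp: A_def h_def)
  have "cinner (creation i j f) g = (\<Sum>\<^sub>\<infinity>w\<in>h ` A. cinner (coord f (w[i := tl (w ! i)])) (coord g w))"
    unfolding cinner_ell2_def im by (rule infsum_cong_neutral) (auto simp: creation.rep_eq)
  also have "\<dots> = (\<Sum>\<^sub>\<infinity>w\<in>A. cinner (coord f w) (coord g (h w)))"
    by (subst infsum_reindex[OF inj]) (auto intro!: infsum_cong simp: A_def h_def)
  also have "\<dots> = cinner f (annihilation i [j] g)"
    unfolding cinner_ell2_def by (rule infsum_cong_neutral) (auto simp: A_def h_def annihilation.rep_eq)
  finally show ?thesis .
qed

lemma multiwords_update_iff: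
  assumes "i < length ns" "i < length w" "set \<alpha> \<subseteq> {..<ns ! i}"
  shows "w[i := \<alpha> @ w ! i] \<in> multiwords ns \<longleftrightarrow> w \<in> multiwords ns"
proof
  assume *: "w[i := \<alpha> @ w ! i] \<in> multiwords ns"
  have "set (w ! m) \<subseteq> {..<ns ! m}" if "m < length ns" for m
    using * that assms unfolding multiwords_def by (cases "m = i") (fastforce simp: nth_list_update)+
  then show "w \<in> multiwords ns"
    using * by (auto simp: multiwords_def)
qed (use assms in \<open>auto simp: multiwords_def nth_list_update subset_iff\<close>)

lemma annihilation_in_tensor_fock:
  assumes "i < length ns" "set \<alpha> \<subseteq> {..<ns ! i}" "f \<in> tensor_fock ns UNIV"
  shows "annihilation i \<alpha> f \<in> tensor_fock ns UNIV"
  using assms by (auto simp: tensor_fock_def ell2_on_UNIV_eq annihilation.rep_eq multiwords_update_iff)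

text \<open>Annihilation discards multi-indices too short to have a position \<open>i\<close>;
  membership in \<open>tensor_fock\<close> ensures that \<open>f\<close> has no coefficients
  there.\<close>

lemma annihilation_creation:
  assumes "i < length ns" "f \<in> tensor_fock ns UNIV"
  shows "annihilation i [j] (creation i j f) = f"
proof (rule ell2_eqI)
  fix w :: "nat list list"
  show "coord (annihilation i [j] (creation i j f)) w = coord f w"
  proof (cases "i < length w")
    case False
    then have "w \<notin> multiwords ns"
      using assms by (auto simp: multiwords_def)
    then show ?thesis
      using False assms by (auto simp: annihilation.rep_eq tensor_fock_def ell2_on_UNIV_eq)
  qed (simp add: annihilation.rep_eq creation.rep_eq)
qed

lemma cinner_creation_creation:
  assumes "i < length ns" "f \<in> tensor_fock ns UNIV" "g \<in> tensor_fock ns UNIV"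
  shows "cinner (creation i j f) (creation i j g) = cinner f g"
  using assms by (simp add: cinner_creation_left annihilation_creation)

lemma norm_creation:
  assumes "i < length ns" "f \<in> tensor_fock ns UNIV"
  shows "norm (creation i j f) = norm f"
proof -
  have "complex_of_real ((norm (creation i j f))\<^sup>2) = complex_of_real ((norm f)\<^sup>2)"
    by (simp only: cinner_self[symmetric] cinner_creation_creation[OF assms(1) assms(2) assms(2)])
  then show ?thesis
    by (simp only: of_real_eq_iff power2_eq_iff_nonneg norm_ge_zero)
qed

text \<open>The order is that of \<open>(S_j S_\<alpha>)* = S_\<alpha>* S_j*\<close>: the letter
  removed first heads the combined prefix.\<close>

lemma annihilation_annihilation: "annihilation i \<alpha> (annihilation i [j] f) = annihilation i (j # \<alpha>) f"
  by (rule ell2_eqI) (simp add: annihilation.rep_eq)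

lemma annihilation_Nil:
  assumes "i < length ns" "f \<in> tensor_fock ns UNIV"
  shows "annihilation i [] f = f"
  using assms by (intro ell2_eqI) (auto simp: annihilation.rep_eq tensor_fock_def ell2_on_UNIV_eq multiwords_def)

text \<open>For a set \<open>I\<close> of positions, \<open>restr (vacuum I)\<close> acts on
  \<open>tensor_fock\<close> as the vacuum projection in each position of \<open>I\<close> and as
  the identity in the others.\<close>

definition vacuum :: "nat set \<Rightarrow> nat list list set"
  where "vacuum I = {w. \<forall>i\<in>I. w ! i = []}"

text \<open>\<open>1 - \<Sum>j. S_j S_j*\<close> is the vacuum projection in position
  \<open>i\<close>; as \<open>i\<close> is not in \<open>I\<close>, it commutes with those already
  present. This is one factor of the defect before compression.\<close>

lemma sum_creation_restr_annihilation:
  assumes f: "f \<in> tensor_fock ns UNIV" and i: "i < length ns" "i \<notin> I"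
  shows "restr (vacuum I) f - (\<Sum>j<ns ! i. creation i j (restr (vacuum I) (annihilation i [j] f)))
    = restr (vacuum (insert i I)) f"
proof (rule ell2_eqI)
  fix w :: "nat list list"
  show "coord (restr (vacuum I) f - (\<Sum>j<ns ! i. creation i j (restr (vacuum I) (annihilation i [j] f)))) w
    = coord (restr (vacuum (insert i I)) f) w"
  proof (cases "w \<in> multiwords ns")
    case False
    have "coord (annihilation i [j] f) (w[i := tl (w ! i)]) = 0"
      if "i < length w" "w ! i \<noteq> []" "hd (w ! i) = j" for j
      using that False f by (auto simp: annihilation.rep_eq tensor_fock_def ell2_on_UNIV_eq)
    then show ?thesis
      using False f
      by (auto simp: minus_ell2.rep_eq coord_sum creation.rep_eq restr.rep_eq tensor_fock_def
          ell2_on_UNIV_eq intro!: sum.neutral)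
  next
    case True
    then have len: "i < length w" and hd: "w ! i \<noteq> [] \<Longrightarrow> hd (w ! i) < ns ! i"
      using i by (auto simp: multiwords_def) (metis hd_in_set lessThan_iff subsetD)
    have "w[i := v] ! l = w ! l" if "l \<in> I" for v l
      using that i(2) by (metis nth_list_update_neq)
    then have vac: "w[i := v] \<in> vacuum I \<longleftrightarrow> w \<in> vacuum I" for v
      by (simp add: vacuum_def)
    \<comment> \<open>Only the first letter of \<open>w ! i\<close> can contribute, and the fact
      \<open>hd\<close> says that it occurs in the sum over \<open>j\<close>.\<close>
    have "coord (creation i j (restr (vacuum I) (annihilation i [j] f))) w
        = (if j = hd (w ! i) then (if w ! i \<noteq> [] \<and> w \<in> vacuum I then coord f w else 0) else 0)" for j
      using len by (auto simp: creation.rep_eq restr.rep_eq annihilation.rep_eq vac)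
    then have "coord (\<Sum>j<ns ! i. creation i j (restr (vacuum I) (annihilation i [j] f))) w
        = (if w ! i \<noteq> [] \<and> w \<in> vacuum I then coord f w else 0)"
      using hd by (simp add: coord_sum)
    then show ?thesis
      by (auto simp: minus_ell2.rep_eq restr.rep_eq vacuum_def)
  qed
qed

section \<open>Averages over words\<close>

lemma card_le_sum_lists: "card {q :: nat list. length q = k \<and> sum_list q \<le> m} = (m + k) choose k"
proof -
  \<comment> \<open>The slack \<open>m - sum_list q\<close>, as an extra entry, turns the inequality
    into an equation in one more variable.\<close>
  have "bij_betw tl {l :: nat list. length l = Suc k \<and> sum_list l = m} {q. length q = k \<and> sum_list q \<le> m}"
    by (rule bij_betwI[where g = "\<lambda>q. (m - sum_list q) # q"]) (auto simp: length_Suc_conv)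
  then have "card {q :: nat list. length q = k \<and> sum_list q \<le> m} = (m + Suc k - 1) choose m"
    using card_length_sum_list[of "Suc k" m] by (simp only: bij_betw_same_card)
  also have "\<dots> = (m + k) choose k"
    using binomial_symmetric[of m "m + k"] by simp
  finally show ?thesis .
qed

lemma card_eq_sum_lists: "card {q :: nat list. length q = Suc d \<and> sum_list q = m} = (m + d) choose d"
  using card_length_sum_list[of "Suc d" m] binomial_symmetric[of m "m + d"] by simp

lemma sum_list_map_plus: "sum_list (map ((+) N) q) = sum_list q + length q * (N :: nat)"
  by (induction q) auto

text \<open>Both binomials are polynomials in \<open>m\<close> of degree \<open>d\<close> with the
  same leading coefficient; raising \<open>d\<close> by one multiplies the quotient by a factor that
  tends to 1.\<close>

lemma binomial_shift_ratio: "(\<lambda>m. real ((m + d) choose d) / real ((m + c + d) choose d)) \<longlonglongrightarrow> 1"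
proof (induction d)
  case (Suc d)
  have rec: "real ((m + Suc d) choose Suc d) = real ((m + d) choose d) * (real (m + Suc d) / real (Suc d))" for m
    using Suc_times_binomial_eq[of "m + d" d] by (simp add: field_simps flip: of_nat_mult of_nat_Suc)
  have "(\<lambda>m. real (m + Suc d) / real (m + c + Suc d)) \<longlonglongrightarrow> 1"
    by real_asymp
  from tendsto_mult[OF Suc this] show ?case
    unfolding mult_1
  proof (rule tendsto_cong[THEN iffD1, rotated])
    have "(a / b) * (x / y) = (a * (x / s)) / (b * (y / s))" if "s \<noteq> 0" for a b x y s :: real
      using that by simp
    then show "\<forall>\<^sub>F m in sequentially. real ((m + d) choose d) / real ((m + c + d) choose d) *
        (real (m + Suc d) / real (m + c + Suc d))
        = real ((m + Suc d) choose Suc d) / real ((m + c + Suc d) choose Suc d)"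
      unfolding rec by (intro always_eventually allI) (simp only: of_nat_eq_0_iff nat.simps not_False_eq_True)
  qed
qed simp

text \<open>\<open>A m\<close> stands for the lists with sum \<open>m\<close> and for the lists with sum at most \<open>m\<close>. Most of them
  have only large entries, because the lists with entries at least \<open>N\<close> are a translate of \<open>A (m - k N)\<close>.\<close>

lemma simplex_average_tendsto:
  fixes f :: "nat list \<Rightarrow> real" and A :: "nat \<Rightarrow> nat list set"
  assumes fin: "\<And>m. finite (A m)" and card: "\<And>m. card (A m) = (m + d) choose d"
    and len: "\<And>m q. q \<in> A m \<Longrightarrow> length q = k"
    and shift: "\<And>m q N. q \<in> A m \<Longrightarrow> map ((+) N) q \<in> A (m + k * N)"
    and f0: "\<And>q. length q = k \<Longrightarrow> 0 \<le> f q" and fL: "\<And>q. length q = k \<Longrightarrow> f q \<le> L"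
    and lim: "\<And>c. c < L \<Longrightarrow> \<exists>N. \<forall>q. length q = k \<longrightarrow> (\<forall>x\<in>set q. N \<le> x) \<longrightarrow> c \<le> f q"
  shows "(\<lambda>m. (\<Sum>q\<in>A m. f q) / real ((m + d) choose d)) \<longlonglongrightarrow> L"
proof (rule order_tendstoI)
  fix a assume a: "L < a"
  have "(\<Sum>q\<in>A m. f q) \<le> real ((m + d) choose d) * L" for m
    using sum_bounded_above[of "A m" f L] fL len card by auto
  then have "(\<Sum>q\<in>A m. f q) / real ((m + d) choose d) \<le> L" for m
    by (simp add: divide_le_eq mult.commute)
  then show "\<forall>\<^sub>F m in sequentially. (\<Sum>q\<in>A m. f q) / real ((m + d) choose d) < a"
    using a by (intro always_eventually allI) (rule le_less_trans)
next
  fix a assume a: "a < L"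
  show "\<forall>\<^sub>F m in sequentially. a < (\<Sum>q\<in>A m. f q) / real ((m + d) choose d)"
  proof (cases "a < 0")
    case True
    have "0 \<le> (\<Sum>q\<in>A m. f q) / real ((m + d) choose d)" for m
      using f0 len by (intro divide_nonneg_nonneg sum_nonneg) auto
    then show ?thesis
      using True by (intro always_eventually allI) (rule less_le_trans)
  next
    case False
    obtain c where c: "a < c" "c < L"
      using a dense by blast
    obtain N where N: "\<And>q. length q = k \<Longrightarrow> (\<forall>x\<in>set q. N \<le> x) \<Longrightarrow> c \<le> f q"
      using lim[OF c(2)] by blast
    have "(\<lambda>m. c * (real ((m + d) choose d) / real ((m + k * N + d) choose d))) \<longlonglongrightarrow> c * 1"
      by (intro tendsto_intros binomial_shift_ratio)
    then have ev: "\<forall>\<^sub>F m in sequentially. a < c * (real ((m + d) choose d) / real ((m + k * N + d) choose d))"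
      using c by (auto elim: order_tendstoD)
    have le: "c * (real ((m + d) choose d) / real ((m + k * N + d) choose d))
        \<le> (\<Sum>q\<in>A (m + k * N). f q) / real ((m + k * N + d) choose d)" for m
    proof -
      \<comment> \<open>The translate has as many elements as \<open>A m\<close>, all its entries
        are at least \<open>N\<close>, and the lists outside it only add nonnegative terms.\<close>
      define G where "G = map ((+) N) ` A m"
      have inj: "inj_on (map ((+) N)) (A m)"
        by (rule inj_on_subset[OF inj_mapI subset_UNIV]) simp
      have "c * real ((m + d) choose d) = (\<Sum>q\<in>G. c)"
        using inj by (simp add: G_def card_image card)
      also have "\<dots> \<le> (\<Sum>q\<in>G. f q)"
        using len by (intro sum_mono N) (auto simp: G_def)
      also have "\<dots> \<le> (\<Sum>q\<in>A (m + k * N). f q)"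
        using shift len f0 by (intro sum_mono2 fin) (auto simp: G_def)
      finally show ?thesis
        by (simp add: divide_right_mono)
    qed
    have "\<forall>\<^sub>F m in sequentially. a < (\<Sum>q\<in>A (m + k * N). f q) / real ((m + k * N + d) choose d)"
      using ev by eventually_elim (use le in \<open>auto intro: less_le_trans\<close>)
    then show ?thesis
      by (subst (asm) eventually_sequentially_seg[of _ "k * N", symmetric, THEN sym]) auto
  qed
qed

section \<open>Words of given degree and recursion over the tensor factors\<close>

definition words :: "nat \<Rightarrow> nat \<Rightarrow> nat list set"
  where "words n p = {u. set u \<subseteq> {..<n} \<and> length u = p}"

lemma finite_words: "finite (words n p)"
  unfolding words_def by (rule finite_lists_length_eq) simp

lemma card_words: "card (words n p) = n ^ p"
  unfolding words_def by (subst card_lists_length_eq) auto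

lemma sum_words_Suc: "(\<Sum>u\<in>words n (Suc p). f u) = (\<Sum>j<n. \<Sum>u\<in>words n p. f (j # u))"
proof -
  have "(\<Sum>u\<in>words n (Suc p). f u) = (\<Sum>(j, u)\<in>{..<n} \<times> words n p. f (j # u))"
    by (rule sum.reindex_bij_witness[where i = "\<lambda>(j, u). j # u" and j = "\<lambda>u. (hd u, tl u)"])
       (auto simp: words_def length_Suc_conv)
  then show ?thesis
    by (simp add: sum.cartesian_product)
qed

lemma multiwords_Nil: "multiwords [] = {[]}"
  by (auto simp: multiwords_def)

lemma Cons_in_multiwords_iff: "u # w \<in> multiwords (n # ns) \<longleftrightarrow> set u \<subseteq> {..<n} \<and> w \<in> multiwords ns"
  by (auto simp: multiwords_def less_Suc_eq_0_disj all_conj_distrib nth_Cons split: nat.splits)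

lemma multiwords_ConsE:
  assumes "w \<in> multiwords (n # ns)"
  obtains u v where "w = u # v" "set u \<subseteq> {..<n}" "v \<in> multiwords ns"
  using assms Cons_in_multiwords_iff by (cases w) (auto simp: multiwords_def)

lemma words_of_degree_Nil: "words_of_degree [] [] = {[]}"
  by (auto simp: words_of_degree_def multiwords_Nil)

lemma words_upto_Nil: "words_upto [] [] = {[]}"
  by (auto simp: words_upto_def multiwords_Nil)

lemma sum_words_of_degree_Cons:
  "(\<Sum>w\<in>words_of_degree (n # ns) (q # qs). F w)
    = (\<Sum>u\<in>words n q. \<Sum>v\<in>words_of_degree ns qs. F (u # v))"
proof -
  have "(\<Sum>w\<in>words_of_degree (n # ns) (q # qs). F w)
      = (\<Sum>(u, v)\<in>words n q \<times> words_of_degree ns qs. F (u # v))"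
    by (rule sum.reindex_bij_witness[where i = "\<lambda>(u, v). u # v" and j = "\<lambda>w. (hd w, tl w)"])
       (auto simp: words_def words_of_degree_def Cons_in_multiwords_iff elim!: multiwords_ConsE)
  then show ?thesis
    by (simp add: sum.cartesian_product)
qed

lemma finite_words_upto: "finite (words_upto ns q)"
proof (induction ns arbitrary: q)
  case (Cons n ns)
  show ?case
  proof (cases q)
    case q: (Cons p ps)
    have "words_upto (n # ns) (p # ps) \<subseteq> (\<lambda>(u, v). u # v) ` ((\<Union>l\<le>p. words n l) \<times> words_upto ns ps)"
      by (force simp: words_def words_upto_def Cons_in_multiwords_iff elim!: multiwords_ConsE)
    then show ?thesis
      using Cons.IH finite_words q by (auto intro: finite_subset)
  qed (auto simp: words_upto_def multiwords_def)
qed (auto simp: words_upto_def multiwords_Nil)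

lemma finite_words_of_degree: "finite (words_of_degree ns q)"
  by (rule finite_subset[OF _ finite_words_upto[of ns q]])
     (auto simp: words_of_degree_def words_upto_def list_all2_refl)

lemma sum_words_upto_Cons:
  "(\<Sum>w\<in>words_upto (n # ns) (q # qs). F w)
    = (\<Sum>p\<le>q. \<Sum>u\<in>words n p. \<Sum>v\<in>words_upto ns qs. F (u # v))"
proof -
  have "(\<Sum>w\<in>words_upto (n # ns) (q # qs). F w)
      = (\<Sum>(p, u, v)\<in>(SIGMA p:{..q}. words n p \<times> words_upto ns qs). F (u # v))"
    by (rule sum.reindex_bij_witness[where i = "\<lambda>(p, u, v). u # v" and j = "\<lambda>w. (length (hd w), hd w, tl w)"])
       (auto simp: words_def words_upto_def Cons_in_multiwords_iff elim!: multiwords_ConsE)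
  also have "\<dots> = (\<Sum>p\<le>q. \<Sum>(u, v)\<in>words n p \<times> words_upto ns qs. F (u # v))"
  proof -
    show ?thesis
      by (subst sum.Sigma) (auto simp: finite_words finite_words_upto)
  qed
  finally show ?thesis
    by (simp add: sum.cartesian_product)
qed

definition word_avg :: "nat list \<Rightarrow> (nat list list \<Rightarrow> real) \<Rightarrow> nat list \<Rightarrow> real"
  where "word_avg ns F q = (\<Sum>w\<in>words_of_degree ns q. F w) / real (card (words_of_degree ns q))"

definition upto_avg :: "nat list \<Rightarrow> (nat list list \<Rightarrow> real) \<Rightarrow> nat list \<Rightarrow> real"
  where "upto_avg ns F q = (\<Sum>w\<in>words_upto ns q. F w) / real (card (words_upto ns q))"

lemma word_avg_Nil: "word_avg [] F [] = F []"
  by (simp add: word_avg_def words_of_degree_Nil)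

lemma upto_avg_Nil: "upto_avg [] F [] = F []"
  by (simp add: upto_avg_def words_upto_Nil)

text \<open>Fixing the first word leaves an average over the remaining positions; inductions over
  \<open>ns\<close> rest on this recursion.\<close>

lemma word_avg_Cons:
  "word_avg (n # ns) F (q # qs) = (\<Sum>u\<in>words n q. word_avg ns (\<lambda>v. F (u # v)) qs) / real n ^ q"
proof -
  have "real (card (words_of_degree (n # ns) (q # qs))) = real n ^ q * real (card (words_of_degree ns qs))"
    using sum_words_of_degree_Cons[where F = "\<lambda>_. 1 :: nat" and n = n and ns = ns and q = q and qs = qs]
    by (simp add: card_words)
  then show ?thesis
    by (simp add: word_avg_def sum_words_of_degree_Cons sum_divide_distrib mult.commute)
qed

text \<open>Degree \<open>p\<close> of the first word has the weight \<open>real n ^ p\<close>, the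
  number of its words, so the first position contributes a weighted mean of fixed-degree
  averages.\<close>

lemma upto_avg_Cons:
  "upto_avg (n # ns) F (q # qs)
    = (\<Sum>p\<le>q. \<Sum>u\<in>words n p. upto_avg ns (\<lambda>v. F (u # v)) qs) / (\<Sum>p\<le>q. real n ^ p)"
proof -
  have "real (card (words_upto (n # ns) (q # qs))) = (\<Sum>p\<le>q. real n ^ p) * real (card (words_upto ns qs))"
    using sum_words_upto_Cons[where F = "\<lambda>_. 1 :: nat" and n = n and ns = ns and q = q and qs = qs]
    by (simp add: card_words sum_distrib_right)
  then show ?thesis
    by (simp add: upto_avg_def sum_words_upto_Cons sum_divide_distrib mult.commute)
qed

section \<open>Monotone functions of multi-indices and the limit of their averages\<close>

lemma word_avg_mono_fun:
  assumes "\<And>w. w \<in> multiwords ns \<Longrightarrow> F w \<le> G w"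
  shows "word_avg ns F q \<le> word_avg ns G q"
  unfolding word_avg_def
  by (intro divide_right_mono sum_mono assms) (auto simp: words_of_degree_def)

definition mono_multiwords :: "nat list \<Rightarrow> (nat list list \<Rightarrow> real) \<Rightarrow> bool"
  where "mono_multiwords ns F \<longleftrightarrow>
    (\<forall>w\<in>multiwords ns. \<forall>i<length ns. \<forall>j<ns ! i. F w \<le> F (w[i := j # w ! i]))"

lemma mono_multiwords_Cons:
  assumes "mono_multiwords (n # ns) F"
  shows "set u \<subseteq> {..<n} \<Longrightarrow> mono_multiwords ns (\<lambda>v. F (u # v))"
    and "set u \<subseteq> {..<n} \<Longrightarrow> v \<in> multiwords ns \<Longrightarrow> j < n \<Longrightarrow> F (u # v) \<le> F ((j # u) # v)"
proof -
  show "F (u # v) \<le> F ((j # u) # v)" if "set u \<subseteq> {..<n}" "v \<in> multiwords ns" "j < n"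
    using assms[unfolded mono_multiwords_def, rule_format, of "u # v" 0 j] that
    by (simp add: Cons_in_multiwords_iff)
  show "mono_multiwords ns (\<lambda>v. F (u # v))" if "set u \<subseteq> {..<n}"
    unfolding mono_multiwords_def
  proof (intro ballI allI impI)
    fix v i j assume "v \<in> multiwords ns" "i < length ns" "j < ns ! i"
    then show "F (u # v) \<le> F (u # v[i := j # v ! i])"
      using assms[unfolded mono_multiwords_def, rule_format, of "u # v" "Suc i" j] that
      by (simp add: Cons_in_multiwords_iff)
  qed
qed

text \<open>The degrees behind the first are raised by the induction hypothesis, the first one in
  unit steps.\<close>

lemma word_avg_mono:
  assumes "mono_multiwords ns F" "\<forall>n\<in>set ns. 0 < n" "list_all2 (\<le>) p q" "length p = length ns"
  shows "word_avg ns F p \<le> word_avg ns F q"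
  using assms
proof (induction ns arbitrary: F p q)
  case (Cons n ns)
  obtain a ps b qs where pq: "p = a # ps" "q = b # qs" "a \<le> b" "list_all2 (\<le>) ps qs" "length ps = length ns"
    using Cons.prems(3,4) by (cases p; cases q) auto
  note mono = mono_multiwords_Cons[OF Cons.prems(1)]
  have n: "0 < n"
    using Cons.prems by simp
  have "word_avg (n # ns) F (a # ps) \<le> word_avg (n # ns) F (a # qs)"
    unfolding word_avg_Cons using Cons.prems pq mono(1)
    by (intro divide_right_mono sum_mono Cons.IH) (auto simp: words_def)
  also have "word_avg (n # ns) F (a # qs) \<le> word_avg (n # ns) F (b # qs)"
    using pq(3)
  proof (induction rule: dec_induct)
    case (step b)
    \<comment> \<open>Each word \<open>u\<close> of length \<open>b\<close> has \<open>n\<close>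
      prolongations \<open>j # u\<close>, none with a smaller value; the factor \<open>n\<close> is
      exactly the growth of the denominator.\<close>
    have "(\<Sum>j<n. \<Sum>u\<in>words n b. word_avg ns (\<lambda>v. F (u # v)) qs)
        \<le> (\<Sum>u\<in>words n (Suc b). word_avg ns (\<lambda>v. F (u # v)) qs)"
      unfolding sum_words_Suc
      by (intro sum_mono word_avg_mono_fun mono(2)) (auto simp: words_def)
    then have "real n * (\<Sum>u\<in>words n b. word_avg ns (\<lambda>v. F (u # v)) qs)
        \<le> (\<Sum>u\<in>words n (Suc b). word_avg ns (\<lambda>v. F (u # v)) qs)"
      by simp
    then have "word_avg (n # ns) F (b # qs) \<le> word_avg (n # ns) F (Suc b # qs)"
      unfolding word_avg_Cons using n by (simp add: divide_le_eq le_divide_eq mult.commute field_simps)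
    then show ?case
      using step by simp
  qed simp
  finally show ?case
    by (simp add: pq)
qed simp

lemma words_of_degree_nonempty:
  assumes "\<forall>n\<in>set ns. 0 < n" "length q = length ns"
  shows "words_of_degree ns q \<noteq> {}"
proof -
  have "map (\<lambda>m. replicate m 0) q \<in> words_of_degree ns q"
    using assms by (auto simp: words_of_degree_def multiwords_def o_def)
  then show ?thesis by blast
qed

lemma word_avg_bounds:
  assumes "\<forall>n\<in>set ns. 0 < n" "length q = length ns" "\<And>w. w \<in> multiwords ns \<Longrightarrow> 0 \<le> F w \<and> F w \<le> C"
  shows "0 \<le> word_avg ns F q" "word_avg ns F q \<le> C"
proof -
  have card: "0 < card (words_of_degree ns q)"
    using words_of_degree_nonempty[OF assms(1,2)] finite_words_of_degree by (simp add: card_gt_0_iff)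
  show "0 \<le> word_avg ns F q"
    unfolding word_avg_def using assms(3)
    by (intro divide_nonneg_nonneg sum_nonneg) (auto simp: words_of_degree_def)
  have "(\<Sum>w\<in>words_of_degree ns q. F w) \<le> real (card (words_of_degree ns q)) * C"
    using assms(3) by (intro sum_bounded_above) (auto simp: words_of_degree_def)
  then show "word_avg ns F q \<le> C"
    unfolding word_avg_def using card by (simp add: divide_le_eq mult.commute)
qed

text \<open>The diagonal is cofinal in the coordinatewise order, so for bounded functions satisfying
  \<open>mono_multiwords\<close> this limit is the supremum over all multidegrees.\<close>

definition word_avg_lim :: "nat list \<Rightarrow> (nat list list \<Rightarrow> real) \<Rightarrow> real"
  where "word_avg_lim ns F = lim (\<lambda>m. word_avg ns F (replicate (length ns) m))"

lemma list_all2_replicate_le: "list_all2 (\<le>) (replicate (length q) m) q \<longleftrightarrow> (\<forall>x\<in>set q. m \<le> (x :: nat))"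
  by (auto simp: list_all2_conv_all_nth all_set_conv_all_nth)

lemma list_all2_le_replicate: "list_all2 (\<le>) q (replicate (length q) m) \<longleftrightarrow> (\<forall>x\<in>set q. (x :: nat) \<le> m)"
  by (auto simp: list_all2_conv_all_nth all_set_conv_all_nth)

context
  fixes ns :: "nat list" and F :: "nat list list \<Rightarrow> real" and C :: real
  assumes pos: "\<forall>n\<in>set ns. 0 < n" and mono: "mono_multiwords ns F"
    and bounds: "\<And>w. w \<in> multiwords ns \<Longrightarrow> 0 \<le> F w \<and> F w \<le> C"
begin

lemma incseq_word_avg: "incseq (\<lambda>m. word_avg ns F (replicate (length ns) m))"
  by (intro incseq_SucI word_avg_mono[OF mono pos]) (auto simp: list_all2_conv_all_nth)

lemma word_avg_lim: "(\<lambda>m. word_avg ns F (replicate (length ns) m)) \<longlonglongrightarrow> word_avg_lim ns F"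
proof -
  have "\<forall>m. word_avg ns F (replicate (length ns) m) \<le> C"
    using word_avg_bounds(2)[OF pos _ bounds] by simp
  then obtain L where "(\<lambda>m. word_avg ns F (replicate (length ns) m)) \<longlonglongrightarrow> L"
    using incseq_convergent[OF incseq_word_avg] by blast
  then show ?thesis
    unfolding word_avg_lim_def by (simp add: convergentI convergent_LIMSEQ_iff[symmetric])
qed

lemma word_avg_le_lim: "length q = length ns \<Longrightarrow> word_avg ns F q \<le> word_avg_lim ns F"
proof -
  assume q: "length q = length ns"
  \<comment> \<open>A constant list dominating \<open>q\<close>; \<open>insert 0\<close> covers the
    empty list, where \<open>Max\<close> would be unspecified.\<close>
  have "word_avg ns F q \<le> word_avg ns F (replicate (length ns) (Max (insert 0 (set q))))"
    by (intro word_avg_mono[OF mono pos]) (auto simp: list_all2_le_replicate[of q, unfolded q] q)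
  also have "\<dots> \<le> word_avg_lim ns F"
    using incseq_le[OF incseq_word_avg word_avg_lim] .
  finally show ?thesis .
qed

text \<open>Monotonicity carries a value reached on the diagonal to every larger multidegree. This
  uniform form serves the net limit and the simplex averages alike.\<close>

lemma word_avg_eventually_ge:
  assumes "c < word_avg_lim ns F"
  shows "\<exists>N. \<forall>q. length q = length ns \<longrightarrow> (\<forall>x\<in>set q. N \<le> x) \<longrightarrow> c \<le> word_avg ns F q"
proof -
  have "\<forall>\<^sub>F m in sequentially. c < word_avg ns F (replicate (length ns) m)"
    using word_avg_lim assms by (rule order_tendstoD)
  then obtain N where N: "c < word_avg ns F (replicate (length ns) N)"
    by (auto simp: eventually_sequentially)
  show ?thesis
  proof (intro exI[of _ N] allI impI)
    fix q assume q: "length q = length ns" "\<forall>x\<in>set q. N \<le> x"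
    have "word_avg ns F (replicate (length ns) N) \<le> word_avg ns F q"
      by (intro word_avg_mono[OF mono pos]) (use q list_all2_replicate_le[of q N] in auto)
    then show "c \<le> word_avg ns F q"
      using N by simp
  qed
qed

lemma word_avg_tendsto: "(word_avg ns F \<longlongrightarrow> word_avg_lim ns F) (multi_at_top (length ns))"
proof (rule order_tendstoI)
  fix a assume "word_avg_lim ns F < a"
  then show "\<forall>\<^sub>F q in multi_at_top (length ns). word_avg ns F q < a"
    unfolding eventually_multi_at_top
    by (intro exI[of _ "replicate (length ns) 0"])
       (auto dest!: list_all2_lengthD intro: le_less_trans[OF word_avg_le_lim])
next
  fix a assume "a < word_avg_lim ns F"
  then obtain c where c: "a < c" "c < word_avg_lim ns F"
    using dense by blast
  then obtain N where N: "\<And>q. length q = length ns \<Longrightarrow> (\<forall>x\<in>set q. N \<le> x) \<Longrightarrow> c \<le> word_avg ns F q"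
    using word_avg_eventually_ge by blast
  show "\<forall>\<^sub>F q in multi_at_top (length ns). a < word_avg ns F q"
    unfolding eventually_multi_at_top
  proof (intro exI[of _ "replicate (length ns) N"] conjI allI impI)
    fix q assume q: "list_all2 (\<le>) (replicate (length ns) N) q"
    then have "length q = length ns"
      by (auto dest: list_all2_lengthD)
    then show "a < word_avg ns F q"
      using N[of q] c q list_all2_replicate_le[of q N] by auto
  qed simp
qed

lemma word_avg_sum_eq_tendsto:
  assumes "ns \<noteq> []"
  shows "(\<lambda>m. (\<Sum>q | length q = length ns \<and> sum_list q = m. word_avg ns F q)
    / real ((m + length ns - 1) choose (length ns - 1))) \<longlonglongrightarrow> word_avg_lim ns F"
proof -
  \<comment> \<open>A prescribed sum leaves one free entry fewer than the length, so the simplex has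
    dimension \<open>d = length ns - 1\<close>.\<close>
  obtain d where d: "length ns = Suc d"
    using assms by (cases ns) auto
  have fin: "finite {q :: nat list. length q = length ns \<and> sum_list q = m}" for m
    using card_eq_sum_lists[of d m] by (intro card_ge_0_finite) (simp add: d)
  have card: "card {q :: nat list. length q = length ns \<and> sum_list q = m} = (m + d) choose d" for m
    using card_eq_sum_lists[of d m] by (simp add: d)
  have "(\<lambda>m. (\<Sum>q | length q = length ns \<and> sum_list q = m. word_avg ns F q) / real ((m + d) choose d))
      \<longlonglongrightarrow> word_avg_lim ns F"
    by (rule simplex_average_tendsto[where k = "length ns"])
       (use word_avg_eventually_ge word_avg_le_lim word_avg_bounds(1)[OF pos _ bounds] fin card in
        \<open>auto simp: sum_list_map_plus\<close>)
  then show ?thesis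
    by (simp add: d)
qed

lemma word_avg_sum_le_tendsto:
  "(\<lambda>m. (\<Sum>q | length q = length ns \<and> sum_list q \<le> m. word_avg ns F q)
    / real ((m + length ns) choose length ns)) \<longlonglongrightarrow> word_avg_lim ns F"
proof -
  have fin: "finite {q :: nat list. length q = length ns \<and> sum_list q \<le> m}" for m
    using card_le_sum_lists[of "length ns" m] by (intro card_ge_0_finite) simp
  show ?thesis
    by (rule simplex_average_tendsto[where k = "length ns"])
       (use word_avg_eventually_ge word_avg_le_lim word_avg_bounds(1)[OF pos _ bounds] fin in
        \<open>auto simp: card_le_sum_lists sum_list_map_plus\<close>)
qed

end

section \<open>Iterated limits\<close>

lemma iterated_limit_sum:
  assumes "\<And>i. i \<in> I \<Longrightarrow> iterated_limit k (f i) (L i)"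
  shows "iterated_limit k (\<lambda>q. \<Sum>i\<in>I. f i q) (\<Sum>i\<in>I. L i)"
  using assms
proof (induction k arbitrary: f L)
  case (Suc k)
  have "\<forall>i\<in>I. \<exists>g. (\<forall>q. iterated_limit k (\<lambda>qs. f i (q # qs)) (g q)) \<and> g \<longlonglongrightarrow> L i"
    using Suc.prems by simp
  then obtain g where g: "\<And>i q. i \<in> I \<Longrightarrow> iterated_limit k (\<lambda>qs. f i (q # qs)) (g i q)"
    "\<And>i. i \<in> I \<Longrightarrow> g i \<longlonglongrightarrow> L i"
    by (auto dest!: bchoice)
  have "iterated_limit k (\<lambda>qs. \<Sum>i\<in>I. f i (q # qs)) (\<Sum>i\<in>I. g i q)" for q
    using g(1) by (intro Suc.IH)
  moreover have "(\<lambda>q. \<Sum>i\<in>I. g i q) \<longlonglongrightarrow> (\<Sum>i\<in>I. L i)"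
    using g(2) by (intro tendsto_sum)
  ultimately show ?case
    by (auto intro!: exI[of _ "\<lambda>q. \<Sum>i\<in>I. g i q"])
qed simp

lemma iterated_limit_divide:
  assumes "iterated_limit k f L"
  shows "iterated_limit k (\<lambda>q. f q / c) (L / c)"
  using assms
proof (induction k arbitrary: f L)
  case (Suc k)
  then obtain g where g: "\<And>q. iterated_limit k (\<lambda>qs. f (q # qs)) (g q)" "g \<longlonglongrightarrow> L"
    by auto
  have "(\<lambda>q. g q / c) \<longlonglongrightarrow> L / c"
    unfolding divide_inverse by (intro tendsto_mult_right g(2))
  then show ?case
    using Suc.IH[OF g(1)] by (auto intro!: exI[of _ "\<lambda>q. g q / c"])
qed simp

text \<open>The total weight grows at least linearly, so the finitely many terms with
  \<open>a p\<close> below a given \<open>c < L\<close> cannot hold the mean down; the upper bound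
  \<open>L\<close> comes from monotonicity.\<close>

lemma weighted_average_tendsto:
  fixes a w :: "nat \<Rightarrow> real"
  assumes a: "a \<longlonglongrightarrow> L" "incseq a" and w: "\<And>p. 1 \<le> w p"
  shows "(\<lambda>q. (\<Sum>p\<le>q. w p * a p) / (\<Sum>p\<le>q. w p)) \<longlonglongrightarrow> L"
proof (rule order_tendstoI)
  have wsum: "real (Suc q) \<le> (\<Sum>p\<le>q. w p)" for q
    using sum_mono[of "{..q}" "\<lambda>_. 1" w] w by simp
  then have wpos: "0 < (\<Sum>p\<le>q. w p)" for q
    by (rule less_le_trans[rotated]) simp
  {
    fix b assume b: "L < b"
    have "(\<Sum>p\<le>q. w p * a p) \<le> (\<Sum>p\<le>q. w p * L)" for q
      using w incseq_le[OF a(2,1)] by (intro sum_mono mult_left_mono) (auto intro: order.trans[OF zero_le_one])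
    then have "(\<Sum>p\<le>q. w p * a p) / (\<Sum>p\<le>q. w p) \<le> L" for q
      using wpos by (simp add: divide_le_eq sum_distrib_left mult.commute)
    then show "\<forall>\<^sub>F q in sequentially. (\<Sum>p\<le>q. w p * a p) / (\<Sum>p\<le>q. w p) < b"
      using b by (intro always_eventually allI) (rule le_less_trans)
  }
  fix b assume b: "b < L"
  then obtain c where c: "b < c" "c < L"
    using dense by blast
  obtain N where N: "c < a N"
    using order_tendstoD(1)[OF a(1) c(2)] by (auto simp: eventually_sequentially)
  \<comment> \<open>The weighted deficit of the terms before \<open>N\<close>. All later terms
    exceed \<open>c\<close>, so the mean falls short of \<open>c\<close> by at most
    \<open>\<bar>K\<bar> / real (Suc q)\<close>.\<close>
  define K where "K = (\<Sum>p<N. w p * (a p - c))"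
  have "(\<lambda>q. \<bar>K\<bar> / real (Suc q)) \<longlonglongrightarrow> 0"
    by real_asymp
  then have "\<forall>\<^sub>F q in sequentially. \<bar>K\<bar> / real (Suc q) < c - b"
    using c by (auto elim: order_tendstoD)
  then show "\<forall>\<^sub>F q in sequentially. b < (\<Sum>p\<le>q. w p * a p) / (\<Sum>p\<le>q. w p)"
    using eventually_ge_at_top[of N]
  proof eventually_elim
    case (elim q)
    have "K = (\<Sum>p<N. w p * (a p - c)) + (\<Sum>p\<in>{N..q}. 0)"
      by (simp add: K_def)
    also have "\<dots> \<le> (\<Sum>p<N. w p * (a p - c)) + (\<Sum>p\<in>{N..q}. w p * (a p - c))"
    proof (intro add_left_mono sum_mono mult_nonneg_nonneg)
      fix p assume "p \<in> {N..q}"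
      then show "0 \<le> w p" "0 \<le> a p - c"
        using w[of p] N incseqD[OF a(2), of N p] by auto
    qed
    also have "\<dots> = (\<Sum>p\<le>q. w p * (a p - c))"
      using elim by (subst sum.union_disjoint[symmetric]) (auto intro!: sum.cong)
    also have "\<dots> = (\<Sum>p\<le>q. w p * a p) - c * (\<Sum>p\<le>q. w p)"
      by (simp add: algebra_simps sum_subtractf sum_distrib_left)
    finally have "K / (\<Sum>p\<le>q. w p) \<le> (\<Sum>p\<le>q. w p * a p) / (\<Sum>p\<le>q. w p) - c"
      using wpos[of q] by (simp add: field_simps)
    moreover have "\<bar>K\<bar> / (\<Sum>p\<le>q. w p) \<le> \<bar>K\<bar> / real (Suc q)"
      using wsum by (intro divide_left_mono mult_pos_pos wpos) auto
    moreover have "- \<bar>K\<bar> / (\<Sum>p\<le>q. w p) \<le> K / (\<Sum>p\<le>q. w p)"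
      using wpos[of q] by (intro divide_right_mono) auto
    ultimately show ?case
      using elim by linarith
  qed
qed

text \<open>With the first word \<open>u\<close> fixed, the inner limits concern a function of fewer
  positions. What remains is a mean of the numbers \<open>a p\<close> with weights
  \<open>real n ^ p\<close>, where \<open>a p\<close> is the limit of the word averages with first
  degree \<open>p\<close>.\<close>

lemma upto_avg_iterated_limit:
  assumes "\<forall>n\<in>set ns. 0 < n" "mono_multiwords ns F" "\<And>w. w \<in> multiwords ns \<Longrightarrow> 0 \<le> F w \<and> F w \<le> C"
  shows "iterated_limit (length ns) (\<lambda>q. complex_of_real (upto_avg ns F q)) (complex_of_real (word_avg_lim ns F))"
  using assms
proof (induction ns arbitrary: F)
  case Nil
  have "word_avg_lim [] F = F []"
    by (simp add: word_avg_lim_def word_avg_Nil limI[OF tendsto_const])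
  then show ?case
    by (simp add: upto_avg_Nil)
next
  case (Cons n ns)
  define l where "l u = word_avg_lim ns (\<lambda>v. F (u # v))" for u
  define a where "a p = (\<Sum>u\<in>words n p. l u) / real n ^ p" for p
  define g where "g q = (\<Sum>p\<le>q. \<Sum>u\<in>words n p. l u) / (\<Sum>p\<le>q. real n ^ p)" for q
  have n: "0 < n" and pos: "\<forall>n\<in>set ns. 0 < n"
    using Cons.prems by auto
  have sub: "mono_multiwords ns (\<lambda>v. F (u # v))" "\<And>w. w \<in> multiwords ns \<Longrightarrow> 0 \<le> F (u # w) \<and> F (u # w) \<le> C"
    if "u \<in> words n p" for u p
    using that mono_multiwords_Cons(1)[OF Cons.prems(2)] Cons.prems(3)
    by (auto simp: words_def Cons_in_multiwords_iff)
  have inner: "iterated_limit (length ns) (\<lambda>qs. complex_of_real (upto_avg (n # ns) F (q # qs)))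
      (complex_of_real (g q))" for q
    unfolding upto_avg_Cons g_def of_real_divide of_real_sum l_def
    by (intro iterated_limit_divide iterated_limit_sum Cons.IH pos sub) auto
  have lim_l: "(\<lambda>m. word_avg ns (\<lambda>v. F (u # v)) (replicate (length ns) m)) \<longlonglongrightarrow> l u"
    if "u \<in> words n p" for u p
    unfolding l_def by (rule word_avg_lim[OF pos sub(1)[OF that] sub(2)[OF that]])
  have lim_a: "(\<lambda>m. word_avg (n # ns) F (p # replicate (length ns) m)) \<longlonglongrightarrow> a p" for p
    unfolding word_avg_Cons a_def
    by (intro tendsto_divide tendsto_sum tendsto_const lim_l) (use n in auto)
  note mono = word_avg_mono[OF Cons.prems(2,1)]
  have inc: "incseq a"
  proof (rule incseq_SucI)
    fix p
    show "a p \<le> a (Suc p)"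
      by (rule LIMSEQ_le[OF lim_a lim_a]) (auto intro!: mono simp: list_all2_conv_all_nth nth_Cons split: nat.splits)
  qed
  \<comment> \<open>The diagonal average at \<open>p\<close> lies below \<open>a p\<close>, where
    the other degrees have gone to infinity, and no word average exceeds
    \<open>word_avg_lim\<close>.\<close>
  have "a \<longlonglongrightarrow> word_avg_lim (n # ns) F"
  proof (rule tendsto_sandwich)
    show "(\<lambda>m. word_avg (n # ns) F (replicate (length (n # ns)) m)) \<longlonglongrightarrow> word_avg_lim (n # ns) F"
      using Cons.prems by (intro word_avg_lim)
    show "\<forall>\<^sub>F p in sequentially. word_avg (n # ns) F (replicate (length (n # ns)) p) \<le> a p"
    proof (intro always_eventually allI)
      fix p
      show "word_avg (n # ns) F (replicate (length (n # ns)) p) \<le> a p"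
        by (rule LIMSEQ_le_const[OF lim_a])
           (auto intro!: exI[of _ p] mono simp: list_all2_conv_all_nth nth_Cons split: nat.splits)
    qed
    show "\<forall>\<^sub>F p in sequentially. a p \<le> word_avg_lim (n # ns) F"
    proof (intro always_eventually allI)
      fix p
      show "a p \<le> word_avg_lim (n # ns) F"
        by (rule LIMSEQ_le_const2[OF lim_a]) (auto intro!: word_avg_le_lim[OF Cons.prems])
    qed
  qed simp
  moreover have "1 \<le> real n ^ p" for p
    using n by (simp add: Suc_leI)
  ultimately have "(\<lambda>q. (\<Sum>p\<le>q. real n ^ p * a p) / (\<Sum>p\<le>q. real n ^ p)) \<longlonglongrightarrow> word_avg_lim (n # ns) F"
    using inc by (intro weighted_average_tendsto)
  moreover have "real n ^ p * a p = (\<Sum>u\<in>words n p. l u)" for p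
    using n by (simp add: a_def)
  ultimately have "g \<longlonglongrightarrow> word_avg_lim (n # ns) F"
    by (simp add: g_def[abs_def])
  then have "(\<lambda>q. complex_of_real (g q)) \<longlonglongrightarrow> complex_of_real (word_avg_lim (n # ns) F)"
    by (rule tendsto_of_real)
  then show ?case
    using inner by (auto intro!: exI[of _ "\<lambda>q. complex_of_real (g q)"])
qed

section \<open>Operators on subspaces\<close>

lemma adjoint_on_eqI:
  assumes H: "csubspace H" and z: "z \<in> H" "\<And>x. x \<in> H \<Longrightarrow> cinner (A x) y = cinner x z"
  shows "adjoint_on H A y = z"
  unfolding adjoint_on_def
proof (rule the_equality)
  fix z' assume z': "z' \<in> H \<and> (\<forall>x\<in>H. cinner (A x) y = cinner x z')"
  have "z' - z \<in> H"
    using H z z' by (auto intro: complex_vector.subspace_diff)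
  then have "cinner (z' - z) z' = cinner (z' - z) z"
    using z z' by metis
  then have "cinner (z' - z) (z' - z) = 0"
    by (simp add: cinner_diff_right)
  then show "z' = z"
    by (simp add: cinner_eq_0_iff)
qed (use z in auto)

lemma cinner_eqI:
  assumes H: "csubspace H" "x \<in> H" "y \<in> H" and eq: "\<And>z. z \<in> H \<Longrightarrow> cinner x z = cinner y z"
  shows "x = y"
proof -
  have "cinner (x - y) (x - y) = 0"
    using eq complex_vector.subspace_diff[OF H] by (simp add: cinner_diff_left)
  then show ?thesis
    by (simp add: cinner_eq_0_iff)
qed

text \<open>Polarisation: the quadratic form is real at \<open>x + y\<close> and at
  \<open>x + \<i> *\<^sub>C y\<close>, which yields the imaginary and the real part of the
  claim.\<close>

lemma positive_on_symmetric:
  assumes H: "csubspace H" and R: "bounded_op_on H R" "positive_on H R" and xy: "x \<in> H" "y \<in> H"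
  shows "cinner (R x) y = cinner x (R y)"
proof -
  have Im: "Im (cinner (R z) z) = 0" if "z \<in> H" for z
    using R(2) that by (auto simp: positive_on_def complex_nonneg_Reals_iff)
  have iy: "\<i> *\<^sub>C y \<in> H"
    using H xy by (simp add: complex_vector.subspace_scale)
  have add: "R (a + b) = R a + R b" if "a \<in> H" "b \<in> H" for a b
    using R(1) that by (simp add: bounded_op_on_def)
  have scale: "R (c *\<^sub>C a) = c *\<^sub>C R a" if "a \<in> H" for a c
    using R(1) that by (simp add: bounded_op_on_def)
  have "Im (cinner (R (x + y)) (x + y)) = 0" "Im (cinner (R (x + \<i> *\<^sub>C y)) (x + \<i> *\<^sub>C y)) = 0"
    using H xy iy by (auto intro!: Im complex_vector.subspace_add)
  then have "Im (cinner (R x) y) = - Im (cinner (R y) x)" "Re (cinner (R x) y) = Re (cinner (R y) x)"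
    using xy iy Im by (simp_all add: add scale cinner_add_left cinner_add_right cinner_scaleC_left cinner_scaleC_right)
  then have "cinner (R x) y = cnj (cinner (R y) x)"
    by (simp add: complex_eq_iff)
  then show ?thesis
    by (metis cinner_commute)
qed

text \<open>If \<open>u\<close> is the part of \<open>R x\<close> orthogonal to the range of
  \<open>A\<close>, then \<open>cinner (R u) (R u) = cinner u (A u) = 0\<close>, so
  \<open>cinner u (R x) = cinner (R u) x = 0\<close> and \<open>u = 0\<close>. This places the
  coefficients of the Berezin kernel in the defect space.\<close>

lemma sqrt_in_closure_range:
  fixes H :: "'a :: chilbert_space set"
  assumes H: "csubspace H" "closed H" and A: "bounded_op_on H A"
    and R: "bounded_op_on H R" "positive_on H R" "\<And>x. x \<in> H \<Longrightarrow> R (R x) = A x" and x: "x \<in> H"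
  shows "R x \<in> closure (A ` H)"
proof -
  define D where "D = closure (A ` H)"
  have RH: "R z \<in> H" and AH: "A z \<in> H" if "z \<in> H" for z
    using R(1) A that by (auto simp: bounded_op_on_def)
  have "csubspace (A ` H)"
    unfolding complex_vector.subspace_def
  proof (intro conjI ballI allI)
    have "A (0 *\<^sub>C 0) = 0 *\<^sub>C A 0"
      using A H by (simp only: bounded_op_on_def complex_vector.subspace_0)
    then show "0 \<in> A ` H"
      using H complex_vector.subspace_0 by (metis complex_vector.scale_zero_left image_eqI)
  next
    fix a b assume "a \<in> A ` H" "b \<in> A ` H"
    then obtain u v where uv: "u \<in> H" "v \<in> H" "a = A u" "b = A v"
      by blast
    then have "a + b = A (u + v)"
      using A by (simp add: bounded_op_on_def)
    then show "a + b \<in> A ` H"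
      using H uv by (auto intro: complex_vector.subspace_add)
  next
    fix c a assume "a \<in> A ` H"
    then obtain u where u: "u \<in> H" "a = A u"
      by blast
    then have "c *\<^sub>C a = A (c *\<^sub>C u)"
      using A by (simp add: bounded_op_on_def)
    then show "c *\<^sub>C a \<in> A ` H"
      using H u by (auto intro: complex_vector.subspace_scale)
  qed
  then have D: "csubspace D" "closed D"
    by (auto simp: D_def csubspace_closure)
  have DH: "D \<subseteq> H"
    unfolding D_def using AH H(2) by (intro closure_minimal) auto
  note sym = positive_on_symmetric[OF H(1) R(1,2)]
  define u where "u = R x - orth_proj D (R x)"
  have u: "u \<in> H"
    unfolding u_def using H DH RH x orth_proj_in[OF D] by (auto intro: complex_vector.subspace_diff)
  have "A u \<in> D"
    unfolding D_def using closure_subset imageI[OF u] by (rule subsetD)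
  then have "cinner u (A u) = 0"
    unfolding u_def by (rule cinner_orth_proj_diff[OF D])
  then have "cinner u (R (R u)) = 0"
    using u by (simp add: R(3))
  then have "cinner (R u) (R u) = 0"
    using sym[OF u RH[OF u]] by (rule trans[rotated])
  then have Ru: "R u = 0"
    by (simp only: cinner_eq_0_iff)
  have "cinner u u = cinner u (R x) - cinner u (orth_proj D (R x))"
    using cinner_diff_right[of u "R x" "orth_proj D (R x)"] by (simp only: u_def[symmetric])
  also have "cinner u (orth_proj D (R x)) = 0"
    unfolding u_def by (rule cinner_orth_proj_diff[OF D orth_proj_in[OF D]])
  also have "cinner u (R x) = 0"
    using sym[OF u x] Ru by simp
  finally have "R x = orth_proj D (R x)"
    by (simp add: cinner_eq_0_iff u_def)
  then show ?thesis
    using orth_proj_in[OF D] unfolding D_def by metis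
qed

section \<open>The compressed creation operators\<close>

lemma csubspace_tensor_fock: "csubspace (tensor_fock ns UNIV :: (nat list list, 'e :: complex_inner) ell2 set)"
  unfolding tensor_fock_def by (intro csubspace_ell2_on complex_vector.subspace_UNIV)

lemma closed_tensor_fock: "closed (tensor_fock ns UNIV :: (nat list list, 'e :: complex_inner) ell2 set)"
  unfolding tensor_fock_def by (rule closed_ell2_on_UNIV)

lemma etensor_in_tensor_fock: "w \<in> multiwords ns \<Longrightarrow> etensor w x \<in> tensor_fock ns UNIV"
  by (auto simp: tensor_fock_def ell2_on_UNIV_eq etensor.rep_eq)

lemma orth_compl_subset: "orth_compl ns M \<subseteq> tensor_fock ns UNIV"
  by (auto simp: orth_compl_def)

lemma csubspace_orth_compl: "csubspace (orth_compl ns M)"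
  using csubspace_tensor_fock[of ns] unfolding orth_compl_def complex_vector.subspace_def
  by (auto simp: cinner_add_left cinner_scaleC_left)

lemma closed_orth_compl: "closed (orth_compl ns M)"
proof -
  have "orth_compl ns M = tensor_fock ns UNIV \<inter> (\<Inter>g\<in>M. {f. cinner f g = 0})"
    by (auto simp: orth_compl_def)
  also have "closed \<dots>"
    by (intro closed_Int closed_INT closed_tensor_fock ballI closed_Collect_eq linear_continuous_on
        bounded_linear_cinner_left continuous_on_const)
  finally show ?thesis .
qed

lemma positive_restr: "cinner (restr A f) f \<in> \<real>\<^sub>\<ge>\<^sub>0"
proof -
  have "cinner (restr A f) f = cinner (restr A f) (restr A f)"
    unfolding cinner_restr_left by (rule infsum_cong) (simp add: restr.rep_eq)
  then show ?thesis
    by (simp only: cinner_self nonneg_Reals_of_real_iff zero_le_power2)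
qed

text \<open>One formula for the traces in the multiplicity, in the curvature and in the
  denominators. The vector \<open>u w e\<close> represents the inner product with
  \<open>etensor w e\<close> inside \<open>H\<close>: it is \<open>etensor w e\<close> itself if
  \<open>H\<close> is the Fock space, and its projection if \<open>H\<close> is the complement of
  \<open>M\<close>.\<close>

lemma op_trace_restr:
  fixes H :: "(nat list list, 'e :: chilbert_space) ell2 set"
  assumes W: "finite W" and E: "finite E" "\<And>x :: 'e. x = (\<Sum>e\<in>E. cinner x e *\<^sub>C e)"
    and H: "csubspace H" "closed H"
    and u: "\<And>w e. w \<in> W \<Longrightarrow> e \<in> E \<Longrightarrow> u w e \<in> H"
      "\<And>w e f. w \<in> W \<Longrightarrow> e \<in> E \<Longrightarrow> f \<in> H \<Longrightarrow> cinner f (u w e) = cinner f (etensor w e)"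
    and P: "csubspace P" "closed P" "P \<subseteq> H"
    and A: "\<And>f. f \<in> H \<Longrightarrow> A f = orth_proj P (restr W f)"
  shows "op_trace H A = complex_of_real (\<Sum>w\<in>W. \<Sum>e\<in>E. (norm (orth_proj P (etensor w e)))\<^sup>2)"
proof -
  have "op_trace H A = (\<Sum>i\<in>W \<times> E. cinner (orth_proj P (etensor (fst i) (snd i))) (u (fst i) (snd i)))"
  proof (rule op_trace_finite_rank[OF H])
    fix f assume f: "f \<in> H"
    have "A f = (\<Sum>i\<in>W \<times> E. orth_proj P (cinner f (etensor (fst i) (snd i)) *\<^sub>C etensor (fst i) (snd i)))"
      by (simp add: A[OF f] restr_onb[OF W E] orth_proj_sum[OF P(1,2)] split_def)
    also have "\<dots> = (\<Sum>i\<in>W \<times> E. cinner f (u (fst i) (snd i)) *\<^sub>C orth_proj P (etensor (fst i) (snd i)))"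
      using u(2) f by (intro sum.cong) (auto simp: orth_proj_scaleC[OF P(1,2)])
    finally show "A f = (\<Sum>i\<in>W \<times> E. cinner f (u (fst i) (snd i)) *\<^sub>C orth_proj P (etensor (fst i) (snd i)))" .
  qed (use W E u(1) P orth_proj_in[OF P(1,2)] in auto)
  also have "\<dots> = (\<Sum>i\<in>W \<times> E. complex_of_real ((norm (orth_proj P (etensor (fst i) (snd i))))\<^sup>2))"
  proof (rule sum.cong[OF refl])
    fix i assume i: "i \<in> W \<times> E"
    define x where "x = etensor (fst i) (snd i)"
    have "cinner (orth_proj P x) (u (fst i) (snd i)) = cinner (orth_proj P x) x"
      unfolding x_def using i P(3) orth_proj_in[OF P(1,2)] by (intro u(2)) auto
    also have "\<dots> = cinner (orth_proj P x) (orth_proj P x)"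
      using cinner_orth_proj_right[OF P(1,2) orth_proj_in[OF P(1,2)]] by simp
    finally show "cinner (orth_proj P (etensor (fst i) (snd i))) (u (fst i) (snd i))
        = complex_of_real ((norm (orth_proj P (etensor (fst i) (snd i))))\<^sup>2)"
      by (simp only: x_def cinner_self)
  qed
  finally show ?thesis
    by (simp add: sum.cartesian_product split_def)
qed

text \<open>For scalar coefficients, with basis \<open>{1}\<close> and the projection to the whole
  Fock space, each word contributes 1.\<close>

lemma op_trace_ell2_proj_complex:
  assumes "finite W" "W \<subseteq> multiwords ns"
  shows "op_trace (tensor_fock ns (UNIV :: complex set)) (orth_proj (ell2_on W UNIV)) = of_nat (card W)"
proof -
  have ex: "x = (\<Sum>e\<in>{1}. cinner x e *\<^sub>C e)" for x :: complex
    by (simp add: cinner_complex_def scaleC_complex_def)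
  have P: "csubspace (tensor_fock ns (UNIV :: complex set))" "closed (tensor_fock ns (UNIV :: complex set))"
    by (rule csubspace_tensor_fock closed_tensor_fock)+
  have "op_trace (tensor_fock ns (UNIV :: complex set)) (orth_proj (ell2_on W UNIV))
      = complex_of_real (\<Sum>w\<in>W. \<Sum>e\<in>{1 :: complex}. (norm (orth_proj (tensor_fock ns UNIV) (etensor w e)))\<^sup>2)"
  proof (rule op_trace_restr[OF assms(1) _ ex P _ _ P subset_refl, where u = etensor])
    fix f :: "(nat list list, complex) ell2" assume "f \<in> tensor_fock ns UNIV"
    have "restr W f \<in> tensor_fock ns UNIV"
      using assms by (auto simp: tensor_fock_def ell2_on_UNIV_eq restr.rep_eq)
    then show "orth_proj (ell2_on W UNIV) f = orth_proj (tensor_fock ns UNIV) (restr W f)"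
      by (simp add: orth_proj_ell2_on orth_proj_same[OF P])
  qed (use assms in \<open>auto intro!: etensor_in_tensor_fock\<close>)
  also have "\<dots> = complex_of_real (\<Sum>w\<in>W. 1)"
    using assms by (auto intro!: sum.cong simp: orth_proj_same[OF P] etensor_in_tensor_fock norm_etensor subset_iff)
  finally show ?thesis
    by simp
qed

context
  fixes ns :: "nat list" and M :: "(nat list list, 'e :: chilbert_space) ell2 set"
  assumes inv: "invariant_subspace ns M"
begin

private abbreviation (input) "N \<equiv> orth_compl ns M"
private abbreviation (input) "T \<equiv> compression ns M"
private abbreviation (input) "P \<equiv> orth_proj (orth_compl ns M)"

section \<open>Compressions as adjoints of restricted annihilation operators\<close>

lemma invD: "M \<subseteq> tensor_fock ns UNIV" "csubspace M" "closed M"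
  "\<And>i j f. i < length ns \<Longrightarrow> j < ns ! i \<Longrightarrow> f \<in> M \<Longrightarrow> creation i j f \<in> M"
  using inv unfolding invariant_subspace_def by blast+

lemmas N_props = csubspace_orth_compl[of ns M] closed_orth_compl[of ns M]
lemmas P_in = orth_proj_in[OF N_props]
lemmas cinner_P_left = cinner_orth_proj_left[OF N_props]
lemmas cinner_P_right = cinner_orth_proj_right[OF N_props]

lemma N_tensor_fock: "h \<in> N \<Longrightarrow> h \<in> tensor_fock ns UNIV"
  using orth_compl_subset by blast

text \<open>The complement of an invariant subspace is invariant under the adjoints, here applied
  letter by letter.\<close>

lemma annihilation_in_N:
  assumes "i < length ns" "set \<alpha> \<subseteq> {..<ns ! i}" "h \<in> N"
  shows "annihilation i \<alpha> h \<in> N"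
  using assms(2,3)
proof (induction \<alpha> arbitrary: h)
  case Nil
  then show ?case
    using assms(1) N_tensor_fock by (simp add: annihilation_Nil[of i ns])
next
  case (Cons j \<alpha>)
  have "cinner (annihilation i [j] h) g = 0" if "g \<in> M" for g
  proof (rule cinner_eq_0_commute)
    have "cinner (creation i j g) h = 0"
    proof (rule cinner_eq_0_commute)
      have "creation i j g \<in> M"
        using Cons.prems(1) assms(1) that by (auto intro: invD(4))
      then show "cinner h (creation i j g) = 0"
        using Cons.prems(2) unfolding orth_compl_def by blast
    qed
    then show "cinner g (annihilation i [j] h) = 0"
      by (simp add: cinner_creation_left)
  qed
  moreover have "annihilation i [j] h \<in> tensor_fock ns UNIV"
    using Cons.prems by (intro annihilation_in_tensor_fock assms(1) N_tensor_fock) auto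
  ultimately have "annihilation i [j] h \<in> N"
    by (simp add: orth_compl_def)
  then have "annihilation i \<alpha> (annihilation i [j] h) \<in> N"
    using Cons.IH Cons.prems(1) by simp
  then show ?case
    by (simp add: annihilation_annihilation)
qed

lemma cinner_T:
  assumes "y \<in> N"
  shows "cinner (T i j x) y = cinner x (annihilation i [j] y)"
  using assms by (simp add: compression_def cinner_P_left cinner_creation_left)

lemma T_in: "T i j x \<in> N"
  by (simp add: compression_def P_in)

lemma adjoint_T:
  assumes "i < length ns" "j < ns ! i" "y \<in> N"
  shows "adjoint_on N (T i j) y = annihilation i [j] y"
  using assms by (intro adjoint_on_eqI N_props annihilation_in_N cinner_T) auto

lemma cinner_word_op_T:
  assumes i: "i < length ns" and "set \<alpha> \<subseteq> {..<ns ! i}" "y \<in> N"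
  shows "cinner (word_op (T i) \<alpha> x) y = cinner x (annihilation i \<alpha> y)"
  using assms(2,3)
proof (induction \<alpha> arbitrary: y)
  case Nil
  then show ?case
    using i N_tensor_fock by (simp add: word_op_def annihilation_Nil[of i ns])
next
  case (Cons j \<alpha>)
  have "annihilation i [j] y \<in> N"
    using Cons.prems i by (intro annihilation_in_N) auto
  then have "cinner (T i j (word_op (T i) \<alpha> x)) y = cinner x (annihilation i \<alpha> (annihilation i [j] y))"
    using Cons by (simp add: cinner_T)
  then show ?case
    by (simp add: word_op_def annihilation_annihilation)
qed

lemma adjoint_word_op_T:
  assumes "i < length ns" "set \<alpha> \<subseteq> {..<ns ! i}" "y \<in> N"
  shows "adjoint_on N (word_op (T i) \<alpha>) y = annihilation i \<alpha> y"
  using assms by (intro adjoint_on_eqI N_props annihilation_in_N cinner_word_op_T) auto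

text \<open>By duality: creation becomes annihilation of the test vector, which stays in the
  complement, where the inner projection has no effect.\<close>

lemma P_creation_P:
  assumes "i < length ns" "j < ns ! i"
  shows "P (creation i j (P x)) = P (creation i j x)"
proof (rule cinner_eqI[OF N_props(1) P_in P_in])
  fix z assume "z \<in> N"
  then show "cinner (P (creation i j (P x))) z = cinner (P (creation i j x)) z"
    using assms annihilation_in_N[of i "[j]" z]
    by (simp add: cinner_P_left cinner_creation_left)
qed

text \<open>A factor \<open>id - \<Phi>\<close> turns the compressed vacuum projection for
  \<open>I\<close> into the one for \<open>insert i I\<close>, because intermediate projections drop
  out by \<open>P_creation_P\<close>. Membership in the polyball asks for all exponents 0 and 1; the
  constant 1 gives the defect.\<close>

lemma defect_map_foldr:
  assumes "distinct L" "set L \<subseteq> {..<length ns}" "\<forall>i\<in>set L. p ! i \<in> {0, 1}" "h \<in> N"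
  shows "foldr (\<lambda>i. id_minus_Phi N (ns ! i) (T i) ^^ (p ! i)) L id h
    = P (restr (vacuum {i \<in> set L. p ! i = 1}) h)"
  using assms
proof (induction L arbitrary: h)
  case Nil
  have "restr (vacuum {}) h = h"
    by (rule ell2_eqI) (simp add: restr.rep_eq vacuum_def)
  then show ?case
    using Nil by (simp add: orth_proj_same[OF N_props])
next
  case (Cons i L)
  define I where "I = {l \<in> set L. p ! l = 1}"
  define Y where "Y = foldr (\<lambda>i. id_minus_Phi N (ns ! i) (T i) ^^ (p ! i)) L id"
  have Y: "Y g = P (restr (vacuum I) g)" if "g \<in> N" for g
    unfolding Y_def I_def by (rule Cons.IH) (use Cons.prems that in auto)
  have i: "i < length ns" "i \<notin> I" "p ! i \<in> {0, 1}"
    using Cons.prems by (auto simp: I_def)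
  have step: "foldr (\<lambda>i. id_minus_Phi N (ns ! i) (T i) ^^ (p ! i)) (i # L) id
      = (id_minus_Phi N (ns ! i) (T i) ^^ (p ! i)) Y"
    unfolding Y_def by (simp only: foldr_Cons o_apply)
  show ?case
  proof (cases "p ! i = 1")
    case False
    then have "{l \<in> set (i # L). p ! l = 1} = I"
      by (auto simp: I_def)
    then show ?thesis
      unfolding step using False i(3) Y[OF Cons.prems(4)] by simp
  next
    case True
    have ins: "{l \<in> set (i # L). p ! l = 1} = insert i I"
      using True by (auto simp: I_def)
    have "T i j (Y (adjoint_on N (T i j) h)) = P (creation i j (restr (vacuum I) (annihilation i [j] h)))"
      if j: "j < ns ! i" for j
    proof -
      have "annihilation i [j] h \<in> N"
        using i j Cons.prems by (intro annihilation_in_N) auto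
      then have "T i j (Y (annihilation i [j] h)) = P (creation i j (restr (vacuum I) (annihilation i [j] h)))"
        using i j by (simp add: Y compression_def P_creation_P)
      then show ?thesis
        using adjoint_T[OF i(1) j Cons.prems(4)] by (simp only:)
    qed
    then have "id_minus_Phi N (ns ! i) (T i) Y h
        = P (restr (vacuum I) h) - (\<Sum>j<ns ! i. P (creation i j (restr (vacuum I) (annihilation i [j] h))))"
      using Y Cons.prems by (simp add: id_minus_Phi_def Phi_def)
    also have "\<dots> = P (restr (vacuum (insert i I)) h)"
      using sum_creation_restr_annihilation[OF N_tensor_fock[OF Cons.prems(4)] i(1,2)]
      by (simp add: orth_proj_diff[OF N_props, symmetric] orth_proj_sum[OF N_props, symmetric])
    finally show ?thesis
      unfolding step ins using True by simp
  qed
qed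

lemma bounded_op_on_T:
  assumes "i < length ns" "j < ns ! i"
  shows "bounded_op_on N (T i j)"
  unfolding bounded_op_on_def
proof (intro conjI ballI allI exI[of _ 1])
  fix x assume "x \<in> N"
  then have "norm (P (creation i j x)) \<le> norm x"
    using norm_orth_proj_le[OF N_props, of "creation i j x"] norm_creation[OF assms(1) N_tensor_fock] by simp
  then show "norm (T i j x) \<le> 1 * norm x"
    by (simp add: compression_def)
qed (simp_all add: compression_def P_in creation_add creation_scaleC orth_proj_add[OF N_props] orth_proj_scaleC[OF N_props])

text \<open>Annihilation operators in different positions commute, hence so do the compressions
  adjoint to them. Each operator required to be positive is a compressed coordinate
  projection.\<close>

lemma compression_in_regular_polyball: "T \<in> regular_polyball ns N"
  unfolding regular_polyball_def mem_Collect_eq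
proof (intro conjI allI impI ballI)
  fix s t a b h
  assume st: "s < length ns" "t < length ns" "s \<noteq> t" and ab: "a < ns ! s" "b < ns ! t" and h: "h \<in> N"
  show "T s a (T t b h) = T t b (T s a h)"
  proof (rule cinner_eqI[OF N_props(1) T_in T_in])
    fix z assume z: "z \<in> N"
    have "annihilation t [b] (annihilation s [a] z) = annihilation s [a] (annihilation t [b] z)"
      using st by (intro ell2_eqI) (auto simp: annihilation.rep_eq list_update_swap)
    then show "cinner (T s a (T t b h)) z = cinner (T t b (T s a h)) z"
      using st ab z annihilation_in_N[of s "[a]" z] annihilation_in_N[of t "[b]" z]
      by (simp add: cinner_T)
  qed
next
  fix p :: "nat list"
  assume p: "length p = length ns \<and> set p \<subseteq> {0, 1}"
  show "positive_on N (defect_map ns N T p id)"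
    unfolding positive_on_def
  proof
    fix h assume h: "h \<in> N"
    have "\<forall>i\<in>set [0..<length ns]. p ! i \<in> {0, 1}"
    proof
      fix i assume "i \<in> set [0..<length ns]"
      then have "p ! i \<in> set p"
        using p by simp
      then show "p ! i \<in> {0, 1}"
        using p by blast
    qed
    then show "cinner (defect_map ns N T p id h) h \<in> \<real>\<^sub>\<ge>\<^sub>0"
      unfolding defect_map_def using h
      by (subst defect_map_foldr) (auto simp: cinner_P_left positive_restr)
  qed
qed (auto intro: bounded_op_on_T)

section \<open>The defect operator and its square root\<close>

private abbreviation (input) "vac \<equiv> replicate (length ns) ([] :: nat list)"
private abbreviation (input) "D \<equiv> defect ns N T"

lemma defect_eq:
  assumes h: "h \<in> N"
  shows "D h = P (etensor vac (coord h vac))"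
proof -
  have ones: "{i \<in> set [0..<length ns]. replicate (length ns) (1 :: nat) ! i = 1} = {..<length ns}"
    by auto
  have "D h = P (restr (vacuum {..<length ns}) h)"
    unfolding defect_def defect_map_def ones[symmetric] using h by (intro defect_map_foldr) auto
  \<comment> \<open>Among indices of the right length only \<open>vac\<close> has an empty word in
    every position; at other lengths \<open>h\<close> vanishes.\<close>
  also have "restr (vacuum {..<length ns}) h = restr {vac} h"
  proof (rule ell2_eqI)
    fix w
    have "w \<in> vacuum {..<length ns} \<longleftrightarrow> w = vac" if "length w = length ns"
      using that by (auto simp: vacuum_def list_eq_iff_nth_eq[of w vac])
    moreover have "coord h w = 0" if "length w \<noteq> length ns"
      using that N_tensor_fock[OF h] by (auto simp: tensor_fock_def ell2_on_UNIV_eq multiwords_def)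
    ultimately show "coord (restr (vacuum {..<length ns}) h) w = coord (restr {vac} h) w"
      by (auto simp: restr.rep_eq)
  qed
  finally show ?thesis
    by (simp add: restr_singleton)
qed

lemma cinner_defect:
  assumes "x \<in> N" "y \<in> N"
  shows "cinner (D x) y = cinner (coord x vac) (coord y vac)"
  using assms by (simp add: defect_eq cinner_P_left cinner_etensor_left)

lemma norm_defect_le: "x \<in> N \<Longrightarrow> norm (D x) \<le> norm (coord x vac)"
  using norm_orth_proj_le[OF N_props, of "etensor vac (coord x vac)"] by (simp add: defect_eq norm_etensor)

lemma bounded_op_on_defect: "bounded_op_on N D"
  unfolding bounded_op_on_def
proof (intro conjI ballI allI exI[of _ 1])
  fix x assume x: "x \<in> N"
  then show "D x \<in> N"
    by (simp add: defect_eq P_in)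
  show "norm (D x) \<le> 1 * norm x"
    using norm_defect_le[OF x] norm_coord_le[of x vac] by simp
  show "D (c *\<^sub>C x) = c *\<^sub>C D x" for c
    using x complex_vector.subspace_scale[OF N_props(1)]
    by (simp add: defect_eq scaleC_ell2.rep_eq etensor_scaleC orth_proj_scaleC[OF N_props])
  show "D (x + y) = D x + D y" if "y \<in> N" for y
    using x that complex_vector.subspace_add[OF N_props(1)]
    by (simp add: defect_eq plus_ell2.rep_eq etensor_add orth_proj_add[OF N_props])
qed

text \<open>In the expanded square, \<open>(norm (D x))\<^sup>2\<close> is at most the squared norm
  of the vacuum coefficient, which equals \<open>inner (D x) x\<close>. This is the contraction
  hypothesis of \<open>op_sqrt_exists\<close>.\<close>

lemma norm_diff_defect_le:
  assumes x: "x \<in> N"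
  shows "norm (x - D x) \<le> norm x"
proof (rule power2_le_imp_le)
  have "inner (D x) x = (norm (coord x vac))\<^sup>2"
    using x by (simp add: inner_eq_Re_cinner cinner_defect cinner_self)
  moreover have "(norm (D x))\<^sup>2 \<le> (norm (coord x vac))\<^sup>2"
    using norm_defect_le[OF x] by (intro power_mono) auto
  moreover have "(norm (x - D x))\<^sup>2 = (norm x)\<^sup>2 - 2 * inner (D x) x + (norm (D x))\<^sup>2"
    by (simp add: power2_norm_eq_inner inner_diff_left inner_diff_right inner_commute)
  moreover have "0 \<le> (norm (coord x vac))\<^sup>2"
    by simp
  ultimately show "(norm (x - D x))\<^sup>2 \<le> (norm x)\<^sup>2"
    by argo
qed simp

private abbreviation (input) "R \<equiv> op_sqrt N D"

lemma R_props: "bounded_op_on N R" "positive_on N R" "\<And>x. x \<in> N \<Longrightarrow> R (R x) = D x"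
proof -
  have "cinner (D x) y = cinner x (D y)" if "x \<in> N" "y \<in> N" for x y
    using cinner_defect that cinner_commute by metis
  then have "\<exists>R. bounded_op_on N R \<and> positive_on N R \<and> (\<forall>x\<in>N. R (R x) = D x)"
    by (intro op_sqrt_exists N_props bounded_op_on_defect norm_diff_defect_le)
  from someI_ex[OF this] show "bounded_op_on N R" "positive_on N R" "\<And>x. x \<in> N \<Longrightarrow> R (R x) = D x"
    unfolding op_sqrt_def by blast+
qed

lemma cinner_R:
  assumes "x \<in> N" "y \<in> N"
  shows "cinner (R x) (R y) = cinner (coord x vac) (coord y vac)"
proof -
  have "R x \<in> N"
    using R_props(1) assms by (simp add: bounded_op_on_def)
  then have "cinner (R x) (R y) = cinner (R (R x)) y"
    using positive_on_symmetric[OF N_props(1) R_props(1,2)] assms by simp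
  then show ?thesis
    using assms by (simp add: R_props(3) cinner_defect)
qed

lemma norm_R:
  assumes "x \<in> N"
  shows "norm (R x) = norm (coord x vac)"
proof -
  have "complex_of_real ((norm (R x))\<^sup>2) = complex_of_real ((norm (coord x vac))\<^sup>2)"
    by (simp only: cinner_self[symmetric] cinner_R[OF assms assms])
  then show ?thesis
    by (simp only: of_real_eq_iff power2_eq_iff_nonneg norm_ge_zero)
qed

section \<open>The Berezin kernel of the compression\<close>

private abbreviation (input) "S \<beta> \<equiv> foldr (\<lambda>i. adjoint_on N (word_op (T i) (\<beta> ! i)))"

text \<open>Each adjoint puts \<open>\<beta> ! i\<close> in front of word \<open>i\<close> of the
  index at which \<open>h\<close> is read off. A general list \<open>L\<close> of positions makes
  the induction work; at \<open>vac\<close> the full list yields the coefficient at \<beta>.\<close>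

lemma foldr_adjoint_word_op:
  assumes "distinct L" "set L \<subseteq> {..<length ns}" "\<beta> \<in> multiwords ns" "h \<in> N"
  shows "S \<beta> L h \<in> N"
    and "length w = length ns \<Longrightarrow>
      coord (S \<beta> L h) w = coord h (map (\<lambda>i. if i \<in> set L then \<beta> ! i @ w ! i else w ! i) [0..<length ns])"
  using assms
proof (induction L arbitrary: w)
  case Nil
  {
    case 1
    then show ?case by simp
  next
    case 2
    then show ?case using map_nth[of w] by simp
  }
next
  case (Cons i L)
  have i: "i < length ns" "set (\<beta> ! i) \<subseteq> {..<ns ! i}" "i \<notin> set L"
    if "distinct (i # L)" "set (i # L) \<subseteq> {..<length ns}" "\<beta> \<in> multiwords ns"
    using that by (auto simp: multiwords_def)
  {
    case 1
    then show ?case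
      using Cons.IH(1) i by (simp add: adjoint_word_op_T annihilation_in_N)
  next
    case 2
    note i = i[OF 2(2-4)]
    have "coord (S \<beta> (i # L) h) w = coord (S \<beta> L h) (w[i := \<beta> ! i @ w ! i])"
      using 2 i Cons.IH(1) by (simp add: adjoint_word_op_T annihilation.rep_eq)
    also have "\<dots> = coord h (map (\<lambda>l. if l \<in> set L then \<beta> ! l @ w[i := \<beta> ! i @ w ! i] ! l
        else w[i := \<beta> ! i @ w ! i] ! l) [0..<length ns])"
      using 2 by (intro Cons.IH(2)) auto
    also have "map (\<lambda>l. if l \<in> set L then \<beta> ! l @ w[i := \<beta> ! i @ w ! i] ! l
        else w[i := \<beta> ! i @ w ! i] ! l) [0..<length ns]
        = map (\<lambda>l. if l \<in> set (i # L) then \<beta> ! l @ w ! l else w ! l) [0..<length ns]"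
      using i 2(1) by (intro map_cong) (auto simp: nth_list_update)
    finally show ?case .
  }
qed

lemma adjoint_words_in:
  assumes "\<beta> \<in> multiwords ns" "h \<in> N"
  shows "S \<beta> [0..<length ns] h \<in> N"
  using assms by (intro foldr_adjoint_word_op) auto

lemma coord_adjoint_words:
  assumes "\<beta> \<in> multiwords ns" "h \<in> N"
  shows "coord (S \<beta> [0..<length ns] h) vac = coord h \<beta>"
proof -
  have "map (\<lambda>i. if i \<in> set [0..<length ns] then \<beta> ! i @ vac ! i else vac ! i) [0..<length ns] = \<beta>"
    using assms by (intro nth_equalityI) (auto simp: multiwords_def)
  then show ?thesis
    using foldr_adjoint_word_op(2)[of "[0..<length ns]" \<beta> h vac] assms by (simp add: atLeast0LessThan)
qed

text \<open>A divergent \<open>infsum\<close> would be 0, so convergence comes first: the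
  coefficients have the norms of those of \<open>h\<close>, hence form a square-summable family
  \<open>g\<close>, whose expansion is the defining sum.\<close>

lemma coord_berezin_kernel:
  assumes h: "h \<in> N"
  shows "coord (berezin_kernel ns N T h) \<beta> = (if \<beta> \<in> multiwords ns then R (S \<beta> [0..<length ns] h) else 0)"
proof -
  define g where "g = (\<lambda>\<beta>. if \<beta> \<in> multiwords ns then R (S \<beta> [0..<length ns] h) else 0)"
  have "(norm (g \<beta>))\<^sup>2 = (norm (coord h \<beta>))\<^sup>2" for \<beta>
    using N_tensor_fock[OF h] h
    by (simp add: g_def norm_R adjoint_words_in coord_adjoint_words tensor_fock_def ell2_on_UNIV_eq)
  then have "(\<lambda>\<beta>. (norm (g \<beta>))\<^sup>2) summable_on UNIV"
    by (simp add: coord_summable)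
  then have G: "coord (Abs_ell2 g) = g"
    by (simp add: Abs_ell2_inverse)
  have g0: "g \<beta> = 0" if "\<beta> \<notin> multiwords ns" for \<beta>
    using that by (simp add: g_def)
  have "restr (multiwords ns) (Abs_ell2 g) = Abs_ell2 g"
    by (rule ell2_eqI) (use g0 in \<open>simp add: restr.rep_eq G\<close>)
  then have "((\<lambda>\<beta>. etensor \<beta> (g \<beta>)) has_sum Abs_ell2 g) (multiwords ns)"
    using has_sum_etensor[of "Abs_ell2 g" "multiwords ns"] by (simp add: G)
  then have "(\<Sum>\<^sub>\<infinity>\<beta>\<in>multiwords ns. etensor \<beta> (g \<beta>)) = Abs_ell2 g"
    by (rule infsumI)
  moreover have "berezin_kernel ns N T h = (\<Sum>\<^sub>\<infinity>\<beta>\<in>multiwords ns. etensor \<beta> (g \<beta>))"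
    unfolding berezin_kernel_def by (rule infsum_cong) (simp add: g_def)
  ultimately have "berezin_kernel ns N T h = Abs_ell2 g"
    by simp
  then have "coord (berezin_kernel ns N T h) \<beta> = g \<beta>"
    by (simp only: G)
  then show ?thesis
    by (simp only: g_def)
qed

text \<open>At each word, the kernel coefficients of \<open>x\<close> and \<open>h\<close> have the
  same inner product as the coefficients of \<open>x\<close> and \<open>h\<close> themselves, so the
  square roots disappear and a coordinate projection remains.\<close>

lemma berezin_compression:
  assumes h: "h \<in> N"
  shows "adjoint_on N (berezin_kernel ns N T) (degree_proj ns q (defect_space ns N T) (berezin_kernel ns N T h))
    = P (restr (words_of_degree ns q) h)"
proof -
  let ?W = "words_of_degree ns q"
  let ?K = "berezin_kernel ns N T"
  have W: "?W \<subseteq> multiwords ns"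
    by (auto simp: words_of_degree_def)
  have lin: "D (x + y) = D x + D y" "D (c *\<^sub>C x) = c *\<^sub>C D x" if "x \<in> N" "y \<in> N" for x y c
    using bounded_op_on_defect that by (auto simp: bounded_op_on_def)
  have sub: "csubspace (defect_space ns N T)"
    unfolding defect_space_def
  proof (intro csubspace_closure complex_vector.subspaceI)
    have "D 0 = 0"
      using lin(2)[of 0 0 0] complex_vector.subspace_0[OF N_props(1)] by simp
    then show "0 \<in> D ` N"
      using complex_vector.subspace_0[OF N_props(1)] by (metis image_eqI)
  next
    fix a b assume "a \<in> D ` N" "b \<in> D ` N"
    then show "a + b \<in> D ` N"
      using lin(1) complex_vector.subspace_add[OF N_props(1)] by (smt (verit) image_iff)
  next
    fix c a assume "a \<in> D ` N"
    then show "c *\<^sub>C a \<in> D ` N"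
      using lin(2) complex_vector.subspace_scale[OF N_props(1)] by (smt (verit) image_iff)
  qed
  \<comment> \<open>The coefficients already lie in the defect space, so the projection only cuts
    down the degree.\<close>
  have "degree_proj ns q (defect_space ns N T) (?K h) = restr ?W (?K h)"
    unfolding degree_proj_def
  proof (rule orth_proj_ell2_on[OF sub])
    fix w assume "w \<in> ?W"
    then have w: "w \<in> multiwords ns"
      using W by blast
    then have "coord (?K h) w = R (S w [0..<length ns] h)"
      using h by (simp add: coord_berezin_kernel)
    also have "\<dots> \<in> defect_space ns N T"
      unfolding defect_space_def
      by (rule sqrt_in_closure_range[OF N_props bounded_op_on_defect R_props adjoint_words_in[OF w h]])
    finally show "coord (?K h) w \<in> defect_space ns N T" .
  qed
  moreover have "adjoint_on N ?K (restr ?W (?K h)) = P (restr ?W h)"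
  proof (rule adjoint_on_eqI[OF N_props(1) P_in])
    fix x assume x: "x \<in> N"
    have "cinner (?K x) (restr ?W (?K h)) = cinner x (restr ?W h)"
      unfolding cinner_restr_right using W x h
      by (intro infsum_cong) (auto simp: coord_berezin_kernel cinner_R adjoint_words_in coord_adjoint_words subset_iff)
    then show "cinner (?K x) (restr ?W (?K h)) = cinner x (P (restr ?W h))"
      using x by (simp add: cinner_P_right)
  qed
  ultimately show ?thesis
    by simp
qed

section \<open>Multiplicity and curvature\<close>

text \<open>The complement is formed inside \<open>tensor_fock\<close>, so the two projections add
  up to the identity on that space.\<close>

lemma orth_proj_orth_compl:
  assumes x: "x \<in> tensor_fock ns UNIV"
  shows "P x = x - orth_proj M x"
proof (rule orth_proj_eqI[OF N_props(1)])
  show "x - orth_proj M x \<in> N"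
    using x invD orth_proj_in[OF invD(2,3)] cinner_orth_proj_diff[OF invD(2,3)] csubspace_tensor_fock
    by (auto simp: orth_compl_def intro!: complex_vector.subspace_diff)
  fix z assume "z \<in> N"
  then have "cinner z (orth_proj M x) = 0"
    using orth_proj_in[OF invD(2,3)] by (auto simp: orth_compl_def)
  then show "cinner (x - (x - orth_proj M x)) z = 0"
    by (simp add: cinner_eq_0_commute)
qed

section \<open>Fibre traces and the terms of multiplicity and curvature\<close>

context
  fixes E :: "'e set"
  assumes E: "finite E" "is_onb UNIV E" "\<And>x. x = (\<Sum>e\<in>E. cinner x e *\<^sub>C e)"
begin

definition fiber_trace :: "nat list list \<Rightarrow> real"
  where "fiber_trace w = (\<Sum>e\<in>E. (norm (orth_proj M (etensor w e)))\<^sup>2)"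

lemma norm_E: "e \<in> E \<Longrightarrow> norm e = 1"
proof -
  assume "e \<in> E"
  then have "complex_of_real ((norm e)\<^sup>2) = complex_of_real (1\<^sup>2)"
    using E(2) unfolding cinner_self[symmetric] by (auto simp: is_onb_def)
  then show ?thesis
    by (simp only: of_real_eq_iff power2_eq_iff_nonneg norm_ge_zero zero_le_one)
qed

lemma fiber_trace_bounds: "0 \<le> fiber_trace w \<and> fiber_trace w \<le> real (card E)"
proof -
  have "(norm (orth_proj M (etensor w e)))\<^sup>2 \<le> 1" if "e \<in> E" for e
    using norm_orth_proj_le[OF invD(2,3), of "etensor w e"] that
    by (simp add: norm_etensor norm_E power_le_one)
  then have "fiber_trace w \<le> real (card E) * 1"
    unfolding fiber_trace_def by (rule sum_bounded_above)
  then show ?thesis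
    by (simp add: fiber_trace_def sum_nonneg)
qed

text \<open>Creation operators are isometries that leave \<open>M\<close> invariant.\<close>

lemma norm_orth_proj_creation:
  assumes i: "i < length ns" "j < ns ! i" and x: "x \<in> tensor_fock ns UNIV"
  shows "norm (orth_proj M x) \<le> norm (orth_proj M (creation i j x))"
proof -
  define p where "p = orth_proj M x"
  have p: "p \<in> M"
    unfolding p_def by (rule orth_proj_in[OF invD(2,3)])
  then have pT: "p \<in> tensor_fock ns UNIV" and Sp: "creation i j p \<in> M"
    using invD i by auto
  \<comment> \<open>The test vector \<open>creation i j p\<close> lies in \<open>M\<close> and has
    the norm of \<open>p\<close>; Cauchy-Schwarz against it gives the bound after cancelling
    \<open>norm p\<close>.\<close>
  have "cinner (orth_proj M (creation i j x)) (creation i j p) = cinner x p"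
    using cinner_orth_proj_left[OF invD(2,3) Sp] cinner_creation_creation[OF i(1) x pT] by simp
  also have "\<dots> = cinner p p"
    using cinner_orth_proj_left[OF invD(2,3) p] by (simp add: p_def)
  finally have "(norm p)\<^sup>2 = norm (cinner (orth_proj M (creation i j x)) (creation i j p))"
    by (simp add: cinner_self norm_power)
  also have "\<dots> \<le> norm (orth_proj M (creation i j x)) * norm (creation i j p)"
    by (rule norm_cinner_le)
  also have "\<dots> = norm (orth_proj M (creation i j x)) * norm p"
    by (simp add: norm_creation[OF i(1) pT])
  finally show ?thesis
    unfolding p_def[symmetric] by (cases "norm p = 0") (auto simp: power2_eq_square)
qed

lemma mono_fiber_trace: "mono_multiwords ns fiber_trace"
  unfolding mono_multiwords_def fiber_trace_def
proof (intro ballI allI impI sum_mono power_mono norm_ge_zero)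
  fix w i j and e :: 'e
  assume w: "w \<in> multiwords ns" and ij: "i < length ns" "j < ns ! i"
  then have "i < length w"
    by (simp add: multiwords_def)
  then show "norm (orth_proj M (etensor w e)) \<le> norm (orth_proj M (etensor (w[i := j # w ! i]) e))"
    using norm_orth_proj_creation[OF ij etensor_in_tensor_fock[OF w], of e] by (simp add: creation_etensor)
qed

lemma op_trace_orth_proj_M:
  assumes W: "finite W" "W \<subseteq> multiwords ns"
  shows "op_trace (tensor_fock ns UNIV) (\<lambda>f. orth_proj M (orth_proj (ell2_on W UNIV) f))
    = complex_of_real (\<Sum>w\<in>W. fiber_trace w)"
  unfolding fiber_trace_def
  by (rule op_trace_restr[OF W(1) E(1,3) csubspace_tensor_fock closed_tensor_fock _ _ invD(2,3,1), where u = etensor])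
     (use W in \<open>auto simp: orth_proj_ell2_on intro: etensor_in_tensor_fock\<close>)

lemma mult_term_eq: "mult_term ns M q = complex_of_real (word_avg ns fiber_trace q)"
proof -
  have W: "finite (words_of_degree ns q)" "words_of_degree ns q \<subseteq> multiwords ns"
    by (rule finite_words_of_degree) (auto simp: words_of_degree_def)
  show ?thesis
    unfolding mult_term_def degree_proj_def op_trace_orth_proj_M[OF W] op_trace_ell2_proj_complex[OF W] word_avg_def
    by simp
qed

lemma mult_term_upto_eq: "mult_term_upto ns M q = complex_of_real (upto_avg ns fiber_trace q)"
proof -
  have W: "finite (words_upto ns q)" "words_upto ns q \<subseteq> multiwords ns"
    by (rule finite_words_upto) (auto simp: words_upto_def)
  show ?thesis
    unfolding mult_term_upto_def upto_proj_def op_trace_orth_proj_M[OF W] op_trace_ell2_proj_complex[OF W] upto_avg_def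
    by simp
qed

text \<open>Pythagoras for the unit vectors \<open>etensor w e\<close>: the squared norms of their
  projections to \<open>M\<close> and to its complement add up to 1.\<close>

lemma curv_term_eq:
  assumes ns: "\<forall>n\<in>set ns. 0 < n" and q: "length q = length ns"
  shows "curv_term ns N T q = of_nat (card E) - mult_term ns M q"
proof -
  let ?W = "words_of_degree ns q"
  have W: "finite ?W" "?W \<subseteq> multiwords ns"
    by (rule finite_words_of_degree) (auto simp: words_of_degree_def)
  have "op_trace N (\<lambda>h. adjoint_on N (berezin_kernel ns N T)
      (degree_proj ns q (defect_space ns N T) (berezin_kernel ns N T h)))
    = complex_of_real (\<Sum>w\<in>?W. \<Sum>e\<in>E. (norm (P (etensor w e)))\<^sup>2)"
    by (rule op_trace_restr[OF W(1) E(1,3) N_props _ _ N_props subset_refl, where u = "\<lambda>w e. P (etensor w e)"])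
       (auto simp: P_in cinner_P_right berezin_compression)
  also have "(\<Sum>w\<in>?W. \<Sum>e\<in>E. (norm (P (etensor w e)))\<^sup>2) = (\<Sum>w\<in>?W. real (card E) - fiber_trace w)"
  proof (rule sum.cong[OF refl])
    fix w assume "w \<in> ?W"
    then have w: "etensor w e \<in> tensor_fock ns UNIV" for e :: 'e
      using W by (auto intro: etensor_in_tensor_fock)
    have "(norm (P (etensor w e)))\<^sup>2 = 1 - (norm (orth_proj M (etensor w e)))\<^sup>2" if "e \<in> E" for e
      using power2_norm_orth_proj[OF invD(2,3), of "etensor w e"] norm_E[OF that]
      by (simp add: orth_proj_orth_compl[OF w] norm_etensor)
    then show "(\<Sum>e\<in>E. (norm (P (etensor w e)))\<^sup>2) = real (card E) - fiber_trace w"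
      by (simp add: fiber_trace_def sum_subtractf)
  qed
  also have "\<dots> = real (card ?W) * real (card E) - (\<Sum>w\<in>?W. fiber_trace w)"
    by (simp add: sum_subtractf)
  finally have "curv_term ns N T q
      = complex_of_real ((real (card ?W) * real (card E) - (\<Sum>w\<in>?W. fiber_trace w)) / real (card ?W))"
    unfolding curv_term_def by (simp add: degree_proj_def op_trace_ell2_proj_complex[OF W])
  \<comment> \<open>With no word of degree \<open>q\<close> both quotients would be 0 by the
    convention for division, and the constant \<open>card E\<close> would be lost.\<close>
  moreover have "card ?W \<noteq> 0"
    using words_of_degree_nonempty[OF ns q] W by simp
  ultimately show ?thesis
    by (simp add: mult_term_eq word_avg_def diff_divide_distrib)
qed

lemma curv_seq_eq:
  assumes ns: "\<forall>n\<in>set ns. 0 < n"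
  shows "curv_seq ns N T m = of_nat (card E) - mult_seq ns M m"
proof -
  let ?Q = "{q :: nat list. length q = length ns \<and> sum_list q \<le> m}"
  \<comment> \<open>The normalising binomial counts \<open>?Q\<close>, so the constant
    \<open>card E\<close> passes through the average unchanged.\<close>
  have "(\<Sum>q\<in>?Q. curv_term ns N T q) = of_nat (card ?Q) * of_nat (card E) - (\<Sum>q\<in>?Q. mult_term ns M q)"
    using ns by (simp add: curv_term_eq sum_subtractf)
  moreover have "(of_nat ((m + length ns) choose length ns) :: complex) \<noteq> 0"
    by simp
  ultimately show ?thesis
    unfolding curv_seq_def mult_seq_def card_le_sum_lists by (simp add: diff_divide_distrib)
qed

end

end

text \<open>\<open>subspace_multiplicity\<close> and \<open>curv\<close> are values of the total
  function \<open>lim\<close>, so the existence of both limits is asserted separately. Membership in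
  the polyball and finite rank of the defect are included because they give the curvature its
  meaning.\<close>

theorem theorem3p1:
  fixes k :: nat and ns :: "nat list" and M :: "(nat list list, 'e :: chilbert_space) ell2 set"
  assumes k: "k \<ge> 1" "length ns = k"
    and ns: "\<And>i. i < k \<Longrightarrow> ns ! i \<ge> 1"
    and findim: "\<exists>B :: 'e set. finite B \<and> cspan B = UNIV"
    and M: "invariant_subspace ns M"
  shows "convergent (mult_seq ns M) \<and>
    (mult_term ns M \<longlongrightarrow> subspace_multiplicity ns M) (multi_at_top k) \<and>
    iterated_limit k (mult_term_upto ns M) (subspace_multiplicity ns M) \<and>
    (\<lambda>m. (\<Sum>q | length q = k \<and> sum_list q = m. mult_term ns M q)
          / of_nat ((m + k - 1) choose (k - 1))) \<longlonglongrightarrow> subspace_multiplicity ns M \<and>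
    compression ns M \<in> regular_polyball ns (orth_compl ns M) \<and>
    (\<exists>B. finite B \<and> defect ns (orth_compl ns M) (compression ns M) ` orth_compl ns M \<subseteq> cspan B) \<and>
    convergent (curv_seq ns (orth_compl ns M) (compression ns M)) \<and>
    subspace_multiplicity ns M = of_nat (cdim (UNIV :: 'e set)) - curv ns (orth_compl ns M) (compression ns M)"
proof -
  obtain E :: "'e set" where E: "finite E" "card E = cdim (UNIV :: 'e set)" "is_onb UNIV E"
      "\<And>x. x = (\<Sum>e\<in>E. cinner x e *\<^sub>C e)"
    using finite_dim_onb[OF findim] by blast
  note E' = E(1,3,4)
  define F where "F = fiber_trace M E"
  define L where "L = complex_of_real (word_avg_lim ns F)"
  have pos: "\<forall>n\<in>set ns. 0 < n"
    using ns k by (auto simp: in_set_conv_nth Suc_le_eq)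
  note F = pos mono_fiber_trace[OF M E', folded F_def] fiber_trace_bounds[OF M E', folded F_def]
  note mult_term = mult_term_eq[OF M E', folded F_def]
  have seq: "mult_seq ns M \<longlonglongrightarrow> L"
    using tendsto_of_real[OF word_avg_sum_le_tendsto[OF F], where 'a = complex]
    by (simp add: mult_seq_def[abs_def] mult_term L_def)
  then have L: "subspace_multiplicity ns M = L"
    unfolding subspace_multiplicity_def by (rule limI)
  have net: "(mult_term ns M \<longlongrightarrow> L) (multi_at_top k)"
    using tendsto_of_real[OF word_avg_tendsto[OF F], where 'a = complex] k
    by (simp add: mult_term[abs_def] L_def)
  have it: "iterated_limit k (mult_term_upto ns M) L"
    using upto_avg_iterated_limit[OF F] k by (simp add: mult_term_upto_eq[OF M E', folded F_def, abs_def] L_def)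
  have eq: "(\<lambda>m. (\<Sum>q | length q = k \<and> sum_list q = m. mult_term ns M q)
      / of_nat ((m + k - 1) choose (k - 1))) \<longlonglongrightarrow> L"
  proof -
    have "ns \<noteq> []"
      using k by auto
    then show ?thesis
      using tendsto_of_real[OF word_avg_sum_eq_tendsto[OF F], where 'a = complex] k
      by (simp add: mult_term L_def)
  qed
  have "curv_seq ns (orth_compl ns M) (compression ns M) = (\<lambda>m. of_nat (card E) - mult_seq ns M m)"
    using curv_seq_eq[OF M E' pos] by blast
  then have curv: "curv_seq ns (orth_compl ns M) (compression ns M) \<longlonglongrightarrow> of_nat (card E) - L"
    using seq by (auto intro: tendsto_intros)
  have "defect ns (orth_compl ns M) (compression ns M) h
      \<in> cspan ((\<lambda>e. orth_proj (orth_compl ns M) (etensor (replicate (length ns) []) e)) ` E)"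
    if "h \<in> orth_compl ns M" for h
  proof -
    \<comment> \<open>The defect depends on \<open>h\<close> only through its vacuum coefficient
      \<open>x\<close>; expanding \<open>x\<close> in \<open>E\<close> puts the range into the span
      of one vector for each element of \<open>E\<close>.\<close>
    define x where "x = coord h (replicate (length ns) [])"
    note N = csubspace_orth_compl[of ns M] closed_orth_compl[of ns M]
    have "defect ns (orth_compl ns M) (compression ns M) h
        = orth_proj (orth_compl ns M) (etensor (replicate (length ns) []) (\<Sum>e\<in>E. cinner x e *\<^sub>C e))"
      using defect_eq[OF M that] E(4)[of x] by (simp add: x_def)
    also have "\<dots> = (\<Sum>e\<in>E. cinner x e *\<^sub>C orth_proj (orth_compl ns M) (etensor (replicate (length ns) []) e))"
      by (simp add: etensor_sum etensor_scaleC orth_proj_sum[OF N] orth_proj_scaleC[OF N])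
    also have "\<dots> \<in> cspan ((\<lambda>e. orth_proj (orth_compl ns M) (etensor (replicate (length ns) []) e)) ` E)"
      by (intro complex_vector.span_sum complex_vector.span_scale complex_vector.span_base imageI)
    finally show ?thesis .
  qed
  then have "\<exists>B. finite B \<and> defect ns (orth_compl ns M) (compression ns M) ` orth_compl ns M \<subseteq> cspan B"
    using E(1) by (intro exI[of _ "(\<lambda>e. orth_proj (orth_compl ns M) (etensor (replicate (length ns) []) e)) ` E"]) auto
  moreover have "L = of_nat (cdim (UNIV :: 'e set)) - curv ns (orth_compl ns M) (compression ns M)"
    unfolding curv_def limI[OF curv] E(2)[symmetric] by simp
  ultimately show ?thesis
    using seq net it eq curv compression_in_regular_polyball[OF M] unfolding L by (auto intro: convergentI)
qed

end
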